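(* Let $n\ge 3$ and let $\Sigma\subset S^{n}\subset\mathbb{R}^{n+1}$ be an $(n-1)$-dimensional $C^2$ manifold whose sectional curvature is $>1$ everywhere. Let $Z\subset\mathbb{R}^{n+1}$ be an analytic set and let $0<s<\min\{\dim_H Z,1\}$. Then $$\dim_H\{z\in\Sigma:\ \dim_H(Z\cdot z)<s\}\le (n-2)+s.$$ In particular, for $\mathcal{H}^{n-1}$-almost every $z\in\Sigma$, $\dim_H(Z\cdot z)=\min\{\dim_H Z,1\}$.
   Context: $\dim_H$ denotes Hausdorff dimension and $\mathcal{H}^{n-1}$ the $(n-1)$-dimensional Hausdorff measure. For $z\in\mathbb{R}^{n+1}$, $Z\cdot z:=\{w\cdot z: w\in Z\}\subset\mathbb{R}$, where $\cdot$ is the Euclidean inner product. The sectional curvature of $\Sigma$ is that of the induced Riemannian metric from $\mathbb{R}^{n+1}$.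
   Formalization: As the induced metric of a C² manifold is only C¹, its intrinsic sectional curvature need not be defined; here sectional curvature is given by the Gauss formula from the second fundamental form in R^{n+1}, which agrees with the intrinsic one for smoother Σ. *)

theory Defs
  imports "HOL-Analysis.Analysis"
begin

definition hausdorff_pre :: "real \<Rightarrow> real \<Rightarrow> 'a::metric_space set \<Rightarrow> ennreal" where
  "hausdorff_pre s \<delta> A =
     (INF C \<in> {C :: nat \<Rightarrow> 'a set. A \<subseteq> (\<Union>i. C i) \<and> (\<forall>i. bounded (C i) \<and> diameter (C i) \<le> \<delta>)}.
        (\<Sum>i. ennreal (diameter (C i) powr s)))"

text \<open>s-dimensional Hausdorff (outer) measure (meant for s > 0; normalising constant omitted).\<close>
definition hausdorff_measure :: "real \<Rightarrow> 'a::metric_space set \<Rightarrow> ennreal" where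
  "hausdorff_measure s A = (SUP \<delta> \<in> {0<..}. hausdorff_pre s \<delta> A)"

definition hausdorff_dim :: "'a::metric_space set \<Rightarrow> real" where
  "hausdorff_dim A = Inf {s :: real. 0 < s \<and> hausdorff_measure s A = 0}"

text \<open>A subset of a Polish space is analytic if it is empty or a continuous image of the
Baire space nat^nat (product topology of the discrete space nat).\<close>
definition analytic_set :: "'a::topological_space set \<Rightarrow> bool" where
  "analytic_set Z \<longleftrightarrow> Z = {} \<or> (\<exists>f :: (nat \<Rightarrow> nat) \<Rightarrow> 'a. continuous_on UNIV f \<and> range f = Z)"

definition C2_chart ::
  "'a::euclidean_space set \<Rightarrow> 'b::euclidean_space set \<Rightarrow> ('b \<Rightarrow> 'a) \<Rightarrow> ('b \<Rightarrow> ('b \<Rightarrow>\<^sub>L 'a))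
     \<Rightarrow> ('b \<Rightarrow> ('b \<Rightarrow>\<^sub>L ('b \<Rightarrow>\<^sub>L 'a))) \<Rightarrow> bool" where
  "C2_chart M V \<phi> D D2 \<longleftrightarrow>
     open V \<and> (\<exists>W. open W \<and> \<phi> ` V = M \<inter> W) \<and> inj_on \<phi> V \<and>
     continuous_on (\<phi> ` V) (inv_into V \<phi>) \<and>
     (\<forall>u\<in>V. (\<phi> has_derivative blinfun_apply (D u)) (at u) \<and>
             (D has_derivative blinfun_apply (D2 u)) (at u) \<and>
             inj (blinfun_apply (D u))) \<and>
     continuous_on V D2"

definition C2_submanifold :: "'b::euclidean_space itself \<Rightarrow> 'a::euclidean_space set \<Rightarrow> bool" where
  "C2_submanifold _ M \<longleftrightarrow>
     (\<forall>p\<in>M. \<exists>V (\<phi> :: 'b \<Rightarrow> 'a) D D2. C2_chart M V \<phi> D D2 \<and> p \<in> \<phi> ` V)"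

definition normal_part :: "'a::euclidean_space set \<Rightarrow> 'a \<Rightarrow> 'a" where
  "normal_part T w = (THE v. (\<forall>t\<in>T. v \<bullet> t = 0) \<and> w - v \<in> T)"

text \<open>Sectional curvature of the induced metric at phi(u), on the plane spanned by
D u a and D u b, computed via the Gauss equation from the second fundamental form
II(X,Y) = normal component of the second derivative of phi.\<close>
definition sectional_curvature ::
  "('b::euclidean_space \<Rightarrow> ('b \<Rightarrow>\<^sub>L 'a::euclidean_space)) \<Rightarrow> ('b \<Rightarrow> ('b \<Rightarrow>\<^sub>L ('b \<Rightarrow>\<^sub>L 'a)))
     \<Rightarrow> 'b \<Rightarrow> 'b \<Rightarrow> 'b \<Rightarrow> real" where
  "sectional_curvature D D2 u a b =
     (let X = blinfun_apply (D u) a; Y = blinfun_apply (D u) b;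
          T = range (blinfun_apply (D u));
          II = (\<lambda>x y. normal_part T (blinfun_apply (blinfun_apply (D2 u) x) y))
      in (II a a \<bullet> II b b - (norm (II a b))\<^sup>2) / ((norm X)\<^sup>2 * (norm Y)\<^sup>2 - (X \<bullet> Y)\<^sup>2))"

definition sectional_curvature_gt1 :: "'b::euclidean_space itself \<Rightarrow> 'a::euclidean_space set \<Rightarrow> bool" where
  "sectional_curvature_gt1 _ M \<longleftrightarrow>
     (\<forall>V (\<phi> :: 'b \<Rightarrow> 'a) D D2 u a b.
        C2_chart M V \<phi> D D2 \<and> u \<in> V \<and> independent {a, b} \<and> a \<noteq> b
        \<longrightarrow> sectional_curvature D D2 u a b > 1)"

end

theory Submission
  imports Defs
begin

text \<open>
  Let \<open>E\<close> be the set of all \<open>z \<in> \<Sigma>\<close> whose projection \<open>Z \<bullet> z\<close> is \<open>s\<close>-null, and suppose that \<open>E\<close>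
  is not null in dimension \<open>n - 2 + \<kappa> = DIM('b) - 1 + \<kappa>\<close> with \<open>s < \<kappa> < 1\<close>. As in Kaufman's projection theorem, take
  Frostman measures \<open>\<mu>\<close> on \<open>Z\<close> and \<open>\<nu>\<close> on \<open>E\<close> and integrate the \<open>s\<close>-energies of the projections of
  \<open>\<mu>\<close> against \<open>\<nu>\<close>. Finiteness of the result rests on the bound
  \<open>\<nu> {z. \<bar>z \<bullet> e\<bar> \<le> r} \<le> C * r powr \<kappa>\<close> for unit vectors \<open>e\<close>. Curvature greater than one makes the
  second fundamental form of \<open>\<Sigma>\<close> in the sphere definite, so near a zero the function
  \<open>z \<mapsto> z \<bullet> e\<close> on \<open>\<Sigma>\<close> either has nonzero gradient or is strictly convex up to sign. In the first
  case its sublevel sets are slabs, in the second they are thin shells around ellipsoids; as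
  \<open>\<kappa> < 1 \<le> n - 2\<close>, the shells are no worse than the slabs.

  Limits of measures are avoided: everything is done with finitely supported measures at a fixed
  dyadic scale, with constants independent of the scale. The passage to a fixed scale uses that the
  dyadic net content is continuous along increasing unions of arbitrary sets, which also yields
  compact subsets of positive content in analytic sets.
\<close>

subsection \<open>Dyadic cells and contents\<close>

text \<open>The exceptional set is not known to be measurable, let alone to contain compact sets of
  positive content, so the classical Frostman lemma does not apply to it. The way out: for compact
  \<open>K\<close>, a null projection has, for each \<open>\<eta>\<close>, a finite cover by
  fattened cells of total weight at most \<open>\<eta>\<close>, and the parameters whose cover uses
  only levels up to \<open>m\<close> form an increasing sequence of sets. One of these keeps content
  above a constant fixed in advance, and from then on only scales down to a fixed dyadic one matter,
  where finitely many point masses suffice. Cauchy-Schwarz bounds the energy of each such projection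
  below by a multiple of \<open>1 / \<eta>\<close>, while the average over the parameters is bounded
  independently of the scale. Contents replace Hausdorff measures because they have the same null
  sets, are finite on bounded sets, and can be distributed directly down the dyadic tree. The strict
  gaps \<open>s < t\<close> and \<open>s < \<kappa>\<close> make the geometric series over scales
  converge; \<open>\<kappa>\<close> decreases to \<open>s\<close> only at the very end.\<close>

definition cell :: "nat \<Rightarrow> 'a::euclidean_space \<Rightarrow> 'a set" where
  "cell k x = {y. \<forall>i\<in>Basis. \<lfloor>2 ^ k * (y \<bullet> i)\<rfloor> = \<lfloor>2 ^ k * (x \<bullet> i)\<rfloor>}"

text \<open>A cell carries its level, so its weight is read off without recovering a side length
  from a set. Levels are natural numbers, so no side exceeds one; this makes contents decrease when
  the exponent grows.\<close>

definition cells :: "(nat \<times> 'a::euclidean_space set) set" where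
  "cells = {(k, cell k x) | k x. True}"

text \<open>As the weights of families of cells are values of a measure, the modular law and
  continuity along increasing families are available; both are needed for increasing unions.\<close>

definition cell_weight :: "real \<Rightarrow> (nat \<times> 'a::euclidean_space set) measure" where
  "cell_weight t = density (count_space UNIV) (\<lambda>p. ennreal (2 powr (- t * real (fst p))))"

definition content :: "real \<Rightarrow> 'a::euclidean_space set \<Rightarrow> ennreal" where
  "content t A = (INF U \<in> {U. U \<subseteq> cells \<and> A \<subseteq> \<Union>(snd ` U)}. emeasure (cell_weight t) U)"

lemma self_in_cell [simp]: "x \<in> cell k x"
  by (simp add: cell_def)

lemma cell_eq: "y \<in> cell k x \<Longrightarrow> cell k y = cell k x"
  by (simp add: cell_def)

lemma cell_in_cells: "(k, cell k x) \<in> cells"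
  by (auto simp: cells_def)

lemma cells_D: "(k, Q) \<in> cells \<Longrightarrow> x \<in> Q \<Longrightarrow> Q = cell k x"
  by (auto simp: cells_def dest: cell_eq)

lemma cells_cover_D: "U \<subseteq> cells \<Longrightarrow> x \<in> \<Union>(snd ` U) \<Longrightarrow> \<exists>k. (k, cell k x) \<in> U"
proof -
  assume U: "U \<subseteq> cells" and "x \<in> \<Union>(snd ` U)"
  then obtain k Q where "(k, Q) \<in> U" "x \<in> Q" by auto
  moreover from this U have "Q = cell k x" by (intro cells_D) auto
  ultimately show ?thesis by auto
qed

lemma ennreal_less_add_pos: "c \<noteq> top \<Longrightarrow> 0 < e \<Longrightarrow> c < c + ennreal e"
  by (cases c) (auto simp: ennreal_less_iff simp flip: ennreal_plus)

lemma floor_double_eq: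
  fixes a b :: real
  assumes "\<lfloor>2 * a\<rfloor> = \<lfloor>2 * b\<rfloor>"
  shows "\<lfloor>a\<rfloor> = \<lfloor>b\<rfloor>"
proof -
  have "\<lfloor>c\<rfloor> = \<lfloor>2 * c\<rfloor> div 2" for c :: real
    using floor_divide_real_eq_div[of 2 "2 * c"] by simp
  then show ?thesis using assms by metis
qed

lemma cell_Suc_subset: "cell (Suc k) x \<subseteq> cell k x"
  unfolding cell_def using floor_double_eq[of "2 ^ k * (_ \<bullet> _)" "2 ^ k * (x \<bullet> _)"]
  by (auto simp: mult.assoc)

lemma cell_mono: "j \<le> k \<Longrightarrow> cell k x \<subseteq> cell j x"
  by (rule lift_Suc_antimono_le[of "\<lambda>k. cell k x"]) (use cell_Suc_subset in auto)

lemma cell_coord: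
  assumes "y \<in> cell k x" "i \<in> Basis"
  shows "\<bar>y \<bullet> i - x \<bullet> i\<bar> \<le> 1 / 2 ^ k"
proof -
  have "\<lfloor>2 ^ k * (y \<bullet> i)\<rfloor> = \<lfloor>2 ^ k * (x \<bullet> i)\<rfloor>" using assms by (auto simp: cell_def)
  then have "\<bar>2 ^ k * (y \<bullet> i) - 2 ^ k * (x \<bullet> i)\<bar> \<le> 1" by linarith
  then have "2 ^ k * \<bar>y \<bullet> i - x \<bullet> i\<bar> \<le> 1"
    by (simp add: abs_mult flip: right_diff_distrib)
  then show ?thesis by (simp add: field_simps)
qed

lemma cell_dist:
  fixes x y :: "'a::euclidean_space"
  assumes "y \<in> cell k x"
  shows "dist y x \<le> real DIM('a) / 2 ^ k"
proof -
  have "dist y x \<le> (\<Sum>i\<in>Basis. \<bar>(y - x) \<bullet> i\<bar>)"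
    by (simp add: dist_norm norm_le_l1)
  also have "\<dots> \<le> (\<Sum>i\<in>(Basis::'a set). 1 / 2 ^ k)"
    by (rule sum_mono) (use cell_coord[OF assms] in \<open>simp add: inner_diff_left\<close>)
  finally show ?thesis by simp
qed

lemma convex_cell: "convex (cell k x)"
proof (rule convexI)
  fix y z and u v :: real
  assume y: "y \<in> cell k x" and z: "z \<in> cell k x" and uv: "0 \<le> u" "0 \<le> v" "u + v = 1"
  show "u *\<^sub>R y + v *\<^sub>R z \<in> cell k x"
    unfolding cell_def
  proof (clarify)
    fix i :: 'a assume i: "i \<in> Basis"
    define n where "n = \<lfloor>2 ^ k * (x \<bullet> i)\<rfloor>"
    let ?a = "2 ^ k * (y \<bullet> i)" and ?b = "2 ^ k * (z \<bullet> i)"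
    have yn: "\<lfloor>?a\<rfloor> = n" "\<lfloor>?b\<rfloor> = n"
      using y z i by (auto simp: cell_def n_def)
    have "convex {real_of_int n..<real_of_int n + 1}" by simp
    moreover have "?a \<in> {real_of_int n..<real_of_int n + 1}"
      "?b \<in> {real_of_int n..<real_of_int n + 1}" using yn by (auto, linarith+)
    ultimately have "u *\<^sub>R ?a + v *\<^sub>R ?b \<in> {real_of_int n..<real_of_int n + 1}"
      using uv by (blast intro: convexD)
    then have "\<lfloor>u * ?a + v * ?b\<rfloor> = n" by (simp add: floor_eq_iff)
    moreover have "2 ^ k * ((u *\<^sub>R y + v *\<^sub>R z) \<bullet> i) = u * ?a + v * ?b"
      by (simp add: inner_add_left algebra_simps)
    ultimately show "\<lfloor>2 ^ k * ((u *\<^sub>R y + v *\<^sub>R z) \<bullet> i)\<rfloor> = \<lfloor>2 ^ k * (x \<bullet> i)\<rfloor>"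
      by (simp add: n_def)
  qed
qed

lemma countable_cells_level: "countable (range (cell k))"
proof -
  let ?\<iota> = "\<lambda>x::'a. restrict (\<lambda>i. \<lfloor>2 ^ k * (x \<bullet> i)\<rfloor>) Basis"
  have "countable (range ?\<iota>)"
    by (rule countable_subset[of _ "PiE Basis (\<lambda>_. UNIV)"]) (auto intro: countable_PiE)
  moreover have "inj_on (\<lambda>Q. ?\<iota> (SOME x. x \<in> Q)) (range (cell k))"
  proof (rule inj_onI, clarify)
    fix x y :: 'a
    assume eq: "?\<iota> (SOME z. z \<in> cell k x) = ?\<iota> (SOME z. z \<in> cell k y)"
    define a where "a = (SOME z. z \<in> cell k x)"
    define b where "b = (SOME z. z \<in> cell k y)"
    have ab: "a \<in> cell k x" "b \<in> cell k y"
      unfolding a_def b_def by (rule someI[of _ x], simp, rule someI[of _ y], simp)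
    have "b \<in> cell k a" unfolding cell_def using eq
      by (auto simp: a_def[symmetric] b_def[symmetric] fun_eq_iff restrict_def split: if_splits)
    then show "cell k x = cell k y" using ab by (metis cell_eq)
  qed
  moreover have "(\<lambda>Q. ?\<iota> (SOME x. x \<in> Q)) ` range (cell k) \<subseteq> range ?\<iota>" by auto
  ultimately show ?thesis by (meson countable_image_inj_on countable_subset)
qed

lemma countable_cells: "countable (cells :: (nat \<times> 'a::euclidean_space set) set)"
proof -
  have "cells \<subseteq> (SIGMA k:UNIV. range (cell k :: 'a \<Rightarrow> _))" by (auto simp: cells_def)
  then show ?thesis by (rule countable_subset) (auto intro: countable_cells_level)
qed

section \<open>Weights of families of cells and subadditivity of the content\<close>

lemma sets_cell_weight [simp, measurable_cong]: "sets (cell_weight t) = UNIV"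
  by (simp add: cell_weight_def)

lemma emeasure_cell_weight:
  "emeasure (cell_weight t) U = (\<integral>\<^sup>+p. ennreal (2 powr (- t * real (fst p))) \<partial>count_space U)"
  by (simp add: cell_weight_def emeasure_density nn_integral_count_space_indicator)

lemma emeasure_cell_weight_finite:
  assumes "finite U"
  shows "emeasure (cell_weight t) U = ennreal (\<Sum>p\<in>U. 2 powr (- t * real (fst p)))"
proof -
  have "emeasure (cell_weight t) U = (\<Sum>p\<in>U. emeasure (cell_weight t) {p})"
    using assms by (rule emeasure_eq_sum_singleton) simp
  also have "\<dots> = (\<Sum>p\<in>U. ennreal (2 powr (- t * real (fst p))))"
    by (rule sum.cong) (auto simp: cell_weight_def emeasure_density nn_integral_count_space_indicator
        nn_integral_indicator_singleton)
  finally show ?thesis by (simp add: sum_ennreal)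
qed

lemma emeasure_cell_weight_singleton:
  "emeasure (cell_weight t) {p} = ennreal (2 powr (- t * real (fst p)))"
  using emeasure_cell_weight_finite[of "{p}" t] by simp

lemma emeasure_cell_weight_antimono:
  assumes "s \<le> t"
  shows "emeasure (cell_weight t) U \<le> emeasure (cell_weight s) U"
  unfolding cell_weight_def
  by (subst (1 2) emeasure_density)
     (auto intro!: nn_integral_mono ennreal_leI powr_mono mult_right_mono split: split_indicator
       simp: assms)

lemma content_le: "U \<subseteq> cells \<Longrightarrow> A \<subseteq> \<Union>(snd ` U) \<Longrightarrow> content t A \<le> emeasure (cell_weight t) U"
  unfolding content_def by (rule INF_lower) simp

lemma content_less_D:
  "content t A < c \<Longrightarrow> \<exists>U. U \<subseteq> cells \<and> A \<subseteq> \<Union>(snd ` U) \<and> emeasure (cell_weight t) U < c"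
  unfolding content_def by (auto simp: INF_less_iff)

lemma content_mono: "A \<subseteq> B \<Longrightarrow> content t A \<le> content t B"
  unfolding content_def by (rule INF_superset_mono) auto

lemma content_null_mono: "content t B = 0 \<Longrightarrow> A \<subseteq> B \<Longrightarrow> content t A = 0"
  using content_mono[of A B t] by simp

lemma ennreal_between_content:
  assumes "content t A \<noteq> 0"
  shows "\<exists>c>0. ennreal c < content t A"
proof -
  have "0 < content t A" using assms by (simp add: zero_less_iff_neq_zero)
  then obtain e where e: "0 < e" "e < content t A" using dense by blast
  then have "e < top" using less_le_trans top_greatest by blast
  then show ?thesis using e by (intro exI[of _ "enn2real e"]) (simp add: enn2real_positive_iff)
qed

lemma content_antimono_exponent: "s \<le> t \<Longrightarrow> content t A \<le> content s A"
  unfolding content_def by (rule INF_mono) (auto intro: emeasure_cell_weight_antimono)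

lemma content_empty [simp]: "content t {} = 0"
  using content_le[of "{}" "{}" t] by simp

lemma content_cell_le: "A \<subseteq> cell k x \<Longrightarrow> content t A \<le> ennreal (2 powr (- t * real k))"
  using content_le[of "{(k, cell k x)}" A t]
  by (simp add: cell_in_cells emeasure_cell_weight_singleton)

lemma content_UN_le: "content t (\<Union>i. A i) \<le> (\<Sum>i. content t (A i))" for A :: "nat \<Rightarrow> _"
proof (rule ennreal_le_epsilon)
  fix e :: real assume e: "0 < e" and fin: "(\<Sum>i. content t (A i)) < top"
  have "\<exists>U. U \<subseteq> cells \<and> A i \<subseteq> \<Union>(snd ` U) \<and>
      emeasure (cell_weight t) U < content t (A i) + ennreal (e * (1/2) ^ Suc i)" for i
  proof (rule content_less_D)
    have "content t (A i) \<noteq> top"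
      using ennreal_suminf_lessD[OF fin, of i] by simp
    then show "content t (A i) < content t (A i) + ennreal (e * (1/2) ^ Suc i)"
      using e by (intro ennreal_less_add_pos) simp_all
  qed
  then obtain U where U: "\<And>i. U i \<subseteq> cells" "\<And>i. A i \<subseteq> \<Union>(snd ` U i)"
    "\<And>i. emeasure (cell_weight t) (U i) < content t (A i) + ennreal (e * (1/2) ^ Suc i)" by metis
  have "content t (\<Union>i. A i) \<le> emeasure (cell_weight t) (\<Union>i. U i)"
    using U by (intro content_le) (auto, blast)
  also have "\<dots> \<le> (\<Sum>i. emeasure (cell_weight t) (U i))"
    by (rule emeasure_subadditive_countably) auto
  also have "\<dots> \<le> (\<Sum>i. content t (A i) + ennreal (e * (1/2) ^ Suc i))"
    by (intro suminf_le less_imp_le U) auto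
  also have "\<dots> = (\<Sum>i. content t (A i)) + (\<Sum>i. ennreal (e * (1/2) ^ Suc i))"
    by (rule suminf_add[symmetric]) auto
  also have "(\<Sum>i. ennreal (e * (1/2) ^ Suc i)) = ennreal e"
    using sums_mult[OF power_half_series, of e] e by (intro suminf_ennreal_eq) auto
  finally show "content t (\<Union>i. A i) \<le> (\<Sum>i. content t (A i)) + ennreal e" .
qed

lemma content_UN_null: "(\<And>i. content t (A i) = 0) \<Longrightarrow> content t (\<Union>i::nat. A i) = 0"
  using content_UN_le[of t A] by simp

lemma content_UN_countable_null:
  assumes "countable I" "\<And>i. i \<in> I \<Longrightarrow> content t (A i) = 0"
  shows "content t (\<Union>i\<in>I. A i) = 0"
proof (cases "I = {}")
  case False
  then have "(\<Union>i\<in>I. A i) = (\<Union>n::nat. A (from_nat_into I n))"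
    using assms(1) by (metis image_image range_from_nat_into)
  moreover have "content t (A (from_nat_into I n)) = 0" for n
    using assms(2) from_nat_into[OF False] by blast
  ultimately show ?thesis using content_UN_null by metis
qed simp

lemma content_Un_le: "content t (A \<union> B) \<le> content t A + content t B"
proof -
  let ?A = "\<lambda>i. if i = (0::nat) then A else if i = 1 then B else {}"
  have "A \<union> B = (\<Union>i. ?A i)" by (auto split: if_splits)
  then have "content t (A \<union> B) \<le> (\<Sum>i. content t (?A i))" using content_UN_le by metis
  also have "\<dots> = (\<Sum>i\<in>{0,1}. content t (?A i))"
    by (rule suminf_finite) auto
  finally show ?thesis by simp
qed

lemma content_UN_finite_le:
  "finite I \<Longrightarrow> content t (\<Union>i\<in>I. A i) \<le> (\<Sum>i\<in>I. content t (A i))"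
proof (induction I rule: finite_induct)
  case (insert i I)
  then show ?case
    using order_trans[OF content_Un_le add_left_mono] by simp
qed simp

text \<open>Countably many cells of level \<open>k\<close> partition the space, so countable
  subadditivity prevents all the pieces from being null. This localises arbitrary sets at any
  scale.\<close>

lemma content_restrict_cell:
  assumes "content t A \<noteq> 0"
  shows "\<exists>x. content t (A \<inter> cell k x) \<noteq> 0"
proof (rule ccontr)
  assume *: "\<nexists>x. content t (A \<inter> cell k x) \<noteq> 0"
  have "A = (\<Union>Q\<in>range (cell k). A \<inter> Q)" using self_in_cell by blast
  moreover have "content t (\<Union>Q\<in>range (cell k). A \<inter> Q) = 0"
    by (rule content_UN_countable_null[OF countable_cells_level]) (use * in auto)
  ultimately show False using assms by simp
qed

subsection \<open>Increasing unions\<close>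

definition maximal_cells :: "(nat \<times> 'a set) set \<Rightarrow> (nat \<times> 'a set) set" where
  "maximal_cells W = {(k, Q) \<in> W. \<not> (\<exists>(j, R) \<in> W. j < k \<and> Q \<subseteq> R)}"

lemma maximal_cells_subset: "maximal_cells W \<subseteq> W"
  by (auto simp: maximal_cells_def)

lemma not_maximal_cells: "(j, R) \<in> W \<Longrightarrow> j < k \<Longrightarrow> Q \<subseteq> R \<Longrightarrow> (k, Q) \<notin> maximal_cells W"
  by (auto simp: maximal_cells_def)

text \<open>Levels are well-founded: at each point the cell of least level in \<open>W\<close> is
  maximal.\<close>

lemma Union_maximal_cells:
  assumes "W \<subseteq> cells"
  shows "\<Union>(snd ` maximal_cells W) = \<Union>(snd ` W)"
proof (intro equalityI subsetI)
  fix x assume "x \<in> \<Union>(snd ` W)"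
  then have ex: "\<exists>k. (k, cell k x) \<in> W" using assms cells_cover_D by meson
  define k where "k = (LEAST k. (k, cell k x) \<in> W)"
  have k: "(k, cell k x) \<in> W" using LeastI_ex[OF ex] by (simp add: k_def)
  have "\<not> (j < k \<and> cell k x \<subseteq> R)" if "(j, R) \<in> W" for j R
  proof
    assume j: "j < k \<and> cell k x \<subseteq> R"
    then have "R = cell j x" using that assms cells_D self_in_cell by (metis subsetD)
    then show False using that j not_less_Least[of j "\<lambda>k. (k, cell k x) \<in> W"] k_def by simp
  qed
  then have "(k, cell k x) \<in> maximal_cells W" using k by (auto simp: maximal_cells_def)
  then show "x \<in> \<Union>(snd ` maximal_cells W)" by force
qed (use maximal_cells_subset in blast)

text \<open>Cells that meet are nested, so at a point of both unions the smaller of the two cells is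
  either shared or not maximal.\<close>

lemma cells_strong_subadditive:
  assumes "U \<subseteq> cells" "V \<subseteq> cells" "A \<subseteq> \<Union>(snd ` U)" "A \<subseteq> \<Union>(snd ` V)"
  shows "emeasure (cell_weight t) (maximal_cells (U \<union> V)) + content t A
       \<le> emeasure (cell_weight t) U + emeasure (cell_weight t) V"
proof -
  let ?m = "emeasure (cell_weight t)"
  define R where "R = (U \<union> V) - maximal_cells (U \<union> V)"
  have "A \<subseteq> \<Union>(snd ` (R \<union> (U \<inter> V)))"
  proof
    fix x assume x: "x \<in> A"
    then have "x \<in> \<Union>(snd ` U)" "x \<in> \<Union>(snd ` V)" using assms(3,4) by blast+
    then have "\<exists>j. (j, cell j x) \<in> U" "\<exists>k. (k, cell k x) \<in> V"
      using cells_cover_D assms(1,2) by simp_all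
    then obtain j k where jk: "(j, cell j x) \<in> U" "(k, cell k x) \<in> V" by (elim exE)
    consider "j = k" | "j < k" | "k < j" by linarith
    then have "\<exists>l. (l, cell l x) \<in> R \<union> (U \<inter> V)"
    proof cases
      case 1
      then show ?thesis using jk by auto
    next
      case 2
      then have "(k, cell k x) \<in> R" 
        using jk not_maximal_cells[of j "cell j x" "U \<union> V" k "cell k x"] cell_mono[of j k x] by (simp add: R_def)
      then show ?thesis by auto
    next
      case 3
      then have "(j, cell j x) \<in> R" 
        using jk not_maximal_cells[of k "cell k x" "U \<union> V" j "cell j x"] cell_mono[of k j x] by (simp add: R_def)
      then show ?thesis by auto
    qed
    then obtain l where "(l, cell l x) \<in> R \<union> (U \<inter> V)" by blast
    then show "x \<in> \<Union>(snd ` (R \<union> (U \<inter> V)))" by force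
  qed
  moreover have "R \<union> (U \<inter> V) \<subseteq> cells" using assms R_def by blast
  ultimately have "content t A \<le> ?m (R \<union> (U \<inter> V))" by (intro content_le)
  also have "\<dots> \<le> ?m R + ?m (U \<inter> V)" by (rule emeasure_subadditive) auto
  finally have "?m (maximal_cells (U \<union> V)) + content t A
      \<le> (?m (maximal_cells (U \<union> V)) + ?m R) + ?m (U \<inter> V)"
    by (simp add: add.assoc add_left_mono)
  also have "?m (maximal_cells (U \<union> V)) + ?m R = ?m (maximal_cells (U \<union> V) \<union> R)"
    by (rule plus_emeasure) (auto simp: R_def)
  also have "maximal_cells (U \<union> V) \<union> R = U \<union> V"
    unfolding R_def using maximal_cells_subset[of "U \<union> V"] by blast
  also have "?m (U \<union> V) + ?m (U \<inter> V) = ?m U + ?m V"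
    by (rule emeasure_Un_Int[symmetric]) auto
  finally show ?thesis .
qed

text \<open>This is the increasing-sets property of net contents; it rests on the nesting of dyadic
  cells, hence needs no measurability. Near-optimal covers are merged one at a time. The old and the
  new cover both contain \<open>A i\<close>, so strong subadditivity refunds
  \<open>content t (A i)\<close> and each merge costs only the error of the new cover.\<close>

lemma content_incseq_le:
  fixes A :: "nat \<Rightarrow> 'a::euclidean_space set"
  assumes inc: "incseq A" and bound: "\<And>i. content t (A i) \<le> c" and c: "c < top"
  shows "content t (\<Union>i. A i) \<le> c"
proof (rule ennreal_le_epsilon)
  fix e :: real assume e: "0 < e"
  let ?m = "emeasure (cell_weight t)"
  have fin: "content t (A i) \<noteq> top" for i using bound[of i] c by auto
  have "\<exists>U. U \<subseteq> cells \<and> A i \<subseteq> \<Union>(snd ` U) \<and>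
      ?m U < content t (A i) + ennreal (e * (1/2) ^ Suc i)" for i
    using fin e by (intro content_less_D ennreal_less_add_pos) simp_all
  then obtain U where U: "\<And>i. U i \<subseteq> cells" "\<And>i. A i \<subseteq> \<Union>(snd ` U i)"
    "\<And>i. ?m (U i) < content t (A i) + ennreal (e * (1/2) ^ Suc i)" by metis
  \<comment> \<open>The families are pruned after each merge, since the weight of the plain union of
    the covers need not stay close to the contents.\<close>
  define W where "W = rec_nat (U 0) (\<lambda>i w. maximal_cells (w \<union> U (Suc i)))"
  have W0: "W 0 = U 0" and WSuc: "W (Suc i) = maximal_cells (W i \<union> U (Suc i))" for i
    by (simp_all add: W_def)
  define V where "V = (\<Union>i. U i)"
  have Wsub: "W i \<subseteq> V" for i
  proof (induction i)
    case (Suc i)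
    then show ?case using maximal_cells_subset[of "W i \<union> U (Suc i)"] by (auto simp: WSuc V_def)
  qed (auto simp: W0 V_def)
  have V: "V \<subseteq> cells" using U(1) by (auto simp: V_def)
  have Wcov: "A i \<subseteq> \<Union>(snd ` W i)" for i
  proof (cases i)
    case (Suc j)
    have "\<Union>(snd ` W i) = \<Union>(snd ` (W j \<union> U i))"
      unfolding Suc WSuc using V Wsub[of j] U(1) by (intro Union_maximal_cells) blast
    then show ?thesis using U(2)[of i] by auto
  qed (use U W0 in auto)
  \<comment> \<open>The errors \<open>e * (1/2) ^ Suc j\<close> with \<open>j \<le> i\<close> add up
    to \<open>e * (1 - (1/2) ^ Suc i)\<close>.\<close>
  have Wm: "?m (W i) \<le> content t (A i) + ennreal (e * (1 - (1/2) ^ Suc i))" for i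
  proof (induction i)
    case 0
    then show ?case using U(3)[of 0] by (simp add: W0)
  next
    case (Suc i)
    have "?m (W (Suc i)) + content t (A i) \<le> ?m (W i) + ?m (U (Suc i))"
      unfolding WSuc using V Wsub[of i] U(1) Wcov[of i] U(2)[of "Suc i"] incseq_SucD[OF inc, of i]
      by (intro cells_strong_subadditive) blast+
    also have "\<dots> \<le> (content t (A i) + ennreal (e * (1 - (1/2) ^ Suc i))) +
        (content t (A (Suc i)) + ennreal (e * (1/2) ^ Suc (Suc i)))"
      using Suc U(3)[of "Suc i"] by (intro add_mono) auto
    also have "\<dots> = content t (A i) + (content t (A (Suc i)) +
        (ennreal (e * (1 - (1/2) ^ Suc i)) + ennreal (e * (1/2) ^ Suc (Suc i))))"
      by (simp only: ac_simps)
    also have "ennreal (e * (1 - (1/2) ^ Suc i)) + ennreal (e * (1/2) ^ Suc (Suc i))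
        = ennreal (e * (1 - (1/2) ^ Suc (Suc i)))"
    proof -
      have "(1/2::real) ^ Suc i \<le> 1" by (rule power_le_one) auto
      then have "ennreal (e * (1 - (1/2) ^ Suc i)) + ennreal (e * (1/2) ^ Suc (Suc i))
          = ennreal (e * (1 - (1/2) ^ Suc i) + e * (1/2) ^ Suc (Suc i))"
        using e by (intro ennreal_plus[symmetric] mult_nonneg_nonneg) auto
      also have "e * (1 - (1/2) ^ Suc i) + e * (1/2) ^ Suc (Suc i) = e * (1 - (1/2) ^ Suc (Suc i))"
        by (simp add: algebra_simps)
      finally show ?thesis .
    qed
    finally have "content t (A i) + ?m (W (Suc i)) \<le> content t (A i) +
        (content t (A (Suc i)) + ennreal (e * (1 - (1/2) ^ Suc (Suc i))))"
      by (simp only: add.commute)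
    \<comment> \<open>Cancelling in \<open>ennreal\<close> requires \<open>content t (A i)\<close>
      to be finite, which comes from \<open>c < top\<close>.\<close>
    then show ?case using fin[of i] by (simp add: ennreal_add_left_cancel_le del: power_Suc)
  qed
  \<comment> \<open>The \<open>W i\<close> need not increase. But a cell maximal in \<open>V\<close>
    is maximal in every subfamily containing it, so once it has entered it survives all later
    prunings; the families \<open>X i\<close> of such cells do increase.\<close>
  define X where "X = (\<lambda>i. maximal_cells V \<inter> (\<Union>j\<le>i. U j))"
  have XW: "X i \<subseteq> W i" for i
  proof (induction i)
    case (Suc i)
    have sub: "W i \<union> U (Suc i) \<subseteq> V" using Wsub[of i] by (auto simp: V_def)
    have "X (Suc i) \<subseteq> maximal_cells V \<inter> (W i \<union> U (Suc i))"
      using Suc unfolding X_def atMost_Suc by blast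
    also have "\<dots> \<subseteq> W (Suc i)"
      unfolding WSuc using sub by (auto simp: maximal_cells_def)
    finally show ?case .
  qed (auto simp: X_def W0)
  have "(\<Union>i. A i) \<subseteq> \<Union>(snd ` V)" using U(2) by (force simp: V_def)
  then have "content t (\<Union>i. A i) \<le> ?m (maximal_cells V)"
    using V maximal_cells_subset[of V] Union_maximal_cells[OF V] by (intro content_le) auto
  also have "maximal_cells V = (\<Union>i. X i)"
    using maximal_cells_subset[of V] by (auto simp: X_def V_def)
  also have "?m (\<Union>i. X i) = (SUP i. ?m (X i))"
    by (rule SUP_emeasure_incseq[symmetric]) (auto simp: X_def incseq_def intro: order_trans)
  also have "\<dots> \<le> c + ennreal e"
  proof (rule SUP_least)
    fix i
    have "?m (X i) \<le> ?m (W i)" by (rule emeasure_mono[OF XW]) simp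
    also have "\<dots> \<le> content t (A i) + ennreal (e * (1 - (1/2) ^ Suc i))" by (rule Wm)
    also have "\<dots> \<le> c + ennreal e"
      using e by (intro add_mono bound ennreal_leI mult_left_le) auto
    finally show "?m (X i) \<le> c + ennreal e" .
  qed
  finally show "content t (\<Union>i. A i) \<le> c + ennreal e" .
qed

lemma content_incseq_gt:
  assumes "incseq A" "ennreal c < content t (\<Union>i. A i)"
  shows "\<exists>i. ennreal c < content t (A i)"
  using content_incseq_le[OF assms(1), of t "ennreal c"] assms(2)
  by (metis ennreal_less_top leD leI)

subsection \<open>Counting cells\<close>

lemma card_image_factor_le:
  assumes "finite (F ` S)" "\<And>u v. u \<in> S \<Longrightarrow> v \<in> S \<Longrightarrow> F u = F v \<Longrightarrow> G u = G v"
  shows "finite (G ` S) \<and> card (G ` S) \<le> card (F ` S)"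
proof -
  have "G u = G (inv_into S F (F u))" if "u \<in> S" for u
    using that by (intro assms(2)) (auto simp: inv_into_into f_inv_into_f)
  then have "G ` S = (\<lambda>y. G (inv_into S F y)) ` (F ` S)" by force
  then show ?thesis using assms(1) card_image_le by auto
qed

lemma floor_diff_le:
  fixes x y :: real
  assumes "\<bar>x - y\<bar> \<le> real L / 2 ^ k"
  shows "\<lfloor>2 ^ k * x\<rfloor> - \<lfloor>2 ^ k * y\<rfloor> \<in> {- int L..int L}"
proof -
  have "2 ^ k * \<bar>x - y\<bar> \<le> real L" using assms by (simp add: field_simps)
  then have "\<bar>2 ^ k * x - 2 ^ k * y\<bar> \<le> real L"
    by (simp add: abs_mult flip: right_diff_distrib)
  then have "2 ^ k * x \<le> 2 ^ k * y + of_int (int L)" "2 ^ k * y \<le> 2 ^ k * x + of_int (int L)"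
    by auto
  then have "\<lfloor>2 ^ k * x\<rfloor> \<le> \<lfloor>2 ^ k * y\<rfloor> + int L" "\<lfloor>2 ^ k * y\<rfloor> \<le> \<lfloor>2 ^ k * x\<rfloor> + int L"
    by (metis floor_add_int floor_mono)+
  then show ?thesis by simp
qed

text \<open>Cells are counted by columns in direction \<open>b\<close>: at most
  \<open>2 * L + 1\<close> indices for each other coordinate, and at most \<open>2 * H + 1\<close>
  cells in one column. With \<open>H\<close> independent of \<open>L\<close> this yields
  codimension-one counts for slabs.\<close>

lemma card_cells_column_le:
  fixes S :: "'a::euclidean_space set"
  assumes b: "b \<in> Basis"
    and box: "\<And>u v i. u \<in> S \<Longrightarrow> v \<in> S \<Longrightarrow> i \<in> Basis \<Longrightarrow> \<bar>u \<bullet> i - v \<bullet> i\<bar> \<le> real L / 2 ^ k"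
    and column: "\<And>u v. u \<in> S \<Longrightarrow> v \<in> S \<Longrightarrow> (\<And>i. i \<in> Basis - {b} \<Longrightarrow> \<bar>u \<bullet> i - v \<bullet> i\<bar> \<le> 1 / 2 ^ k)
      \<Longrightarrow> \<bar>u \<bullet> b - v \<bullet> b\<bar> \<le> real H / 2 ^ k"
  shows "finite (cell k ` S) \<and> card (cell k ` S) \<le> (2 * L + 1) ^ (DIM('a) - 1) * (2 * H + 1)"
proof (cases "S = {}")
  case False
  then obtain u0 where u0: "u0 \<in> S" by auto
  define n where "n = (\<lambda>(u::'a) i. \<lfloor>2 ^ k * (u \<bullet> i)\<rfloor>)"
  \<comment> \<open>Heights are measured from a representative that depends only on the indices off
    \<open>b\<close>, so all points of a column are compared with the same one.\<close>
  define rep where "rep = (\<lambda>u. SOME v. v \<in> S \<and> (\<forall>i\<in>Basis - {b}. n v i = n u i))"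
  have rep: "rep u \<in> S \<and> (\<forall>i\<in>Basis - {b}. n (rep u) i = n u i)" if "u \<in> S" for u
    unfolding rep_def by (rule someI[of _ u]) (use that in auto)
  define F where "F = (\<lambda>u. (restrict (\<lambda>i. n u i - n u0 i) (Basis - {b}), n u b - n (rep u) b))"
  let ?T = "PiE (Basis - {b}) (\<lambda>_. {- int L..int L}) \<times> {- int H..int H}"
  have "F u \<in> ?T" if u: "u \<in> S" for u
  proof -
    have "n u i - n u0 i \<in> {- int L..int L}" if "i \<in> Basis" for i
      unfolding n_def using box[OF u u0 that] by (rule floor_diff_le)
    moreover have "n u b - n (rep u) b \<in> {- int H..int H}"
      unfolding n_def
    proof (rule floor_diff_le, rule column[OF u])
      fix i assume i: "i \<in> Basis - {b}"
      then have "n u i = n (rep u) i" using rep[OF u] by simp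
      then have "\<bar>2 ^ k * (u \<bullet> i) - 2 ^ k * (rep u \<bullet> i)\<bar> \<le> 1" unfolding n_def by linarith
      then have "2 ^ k * \<bar>u \<bullet> i - rep u \<bullet> i\<bar> \<le> 1"
        by (simp add: abs_mult flip: right_diff_distrib)
      then show "\<bar>u \<bullet> i - rep u \<bullet> i\<bar> \<le> 1 / 2 ^ k" by (simp add: field_simps)
    qed (use rep[OF u] in auto)
    ultimately show ?thesis by (auto simp: F_def)
  qed
  then have sub: "F ` S \<subseteq> ?T" by blast
  have fin: "finite ?T" by (intro finite_cartesian_product finite_PiE) auto
  have "cell k u = cell k v" if uv: "u \<in> S" "v \<in> S" and eq: "F u = F v" for u v
  proof -
    have off: "n u i = n v i" if "i \<in> Basis - {b}" for i
    proof -
      have "fst (F u) i = fst (F v) i" using eq by simp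
      then show ?thesis using that by (simp add: F_def)
    qed
    then have "rep u = rep v" unfolding rep_def by simp
    then have "n u b = n v b" using eq by (simp add: F_def)
    then show ?thesis using off by (intro cell_eq) (auto simp: cell_def n_def)
  qed
  then have "finite (cell k ` S) \<and> card (cell k ` S) \<le> card (F ` S)"
    by (intro card_image_factor_le) (use sub fin finite_subset in blast)+
  moreover have "card (F ` S) \<le> card ?T" using sub fin by (rule card_mono[rotated])
  moreover have "card ?T = (2 * L + 1) ^ (DIM('a) - 1) * (2 * H + 1)"
    using b by (simp add: card_cartesian_product card_PiE nat_add_distrib nat_mult_distrib)
  ultimately show ?thesis by linarith
qed simp

lemma card_cells_box_le:
  fixes S :: "'a::euclidean_space set"
  assumes "\<And>u v i. u \<in> S \<Longrightarrow> v \<in> S \<Longrightarrow> i \<in> Basis \<Longrightarrow> \<bar>u \<bullet> i - v \<bullet> i\<bar> \<le> real L / 2 ^ k"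
  shows "finite (cell k ` S) \<and> card (cell k ` S) \<le> (2 * L + 1) ^ DIM('a)"
proof -
  obtain b :: 'a where b: "b \<in> Basis" using nonempty_Basis by blast
  have "finite (cell k ` S) \<and> card (cell k ` S) \<le> (2 * L + 1) ^ (DIM('a) - 1) * (2 * L + 1)"
    by (rule card_cells_column_le[OF b]) (use assms b in auto)
  moreover have "(2 * L + 1) ^ (DIM('a) - 1) * (2 * L + 1) = (2 * L + 1) ^ DIM('a)"
    using power_minus_mult[of "DIM('a)" "2 * L + 1"] by simp
  ultimately show ?thesis by simp
qed

lemma coord_diff_le_dist: "i \<in> Basis \<Longrightarrow> \<bar>u \<bullet> i - v \<bullet> i\<bar> \<le> dist u v"
  using Basis_le_norm[of i "u - v"] by (simp add: dist_norm inner_diff_left)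

lemma content_card_le:
  assumes "finite (cell k ` S)"
  shows "content t S \<le> ennreal (real (card (cell k ` S)) * 2 powr (- t * real k))"
proof -
  have "content t S \<le> emeasure (cell_weight t) (Pair k ` cell k ` S)"
    by (rule content_le) (auto simp: cell_in_cells intro: self_in_cell)
  also have "\<dots> = ennreal (real (card (cell k ` S)) * 2 powr (- t * real k))"
    using assms by (simp add: emeasure_cell_weight_finite sum.reindex inj_on_def)
  finally show ?thesis .
qed

lemma ex_dyadic_level:
  fixes d :: real
  assumes "0 < d" "d \<le> 1"
  shows "\<exists>k. d \<le> 1 / 2 ^ k \<and> 1 / 2 ^ k < 2 * d"
proof -
  have ex: "\<exists>n. (1/2) ^ n < d" using real_arch_pow_inv[of d "1/2"] assms by auto
  define n where "n = (LEAST n. (1/2) ^ n < d)"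
  have n: "(1/2) ^ n < d" using LeastI_ex[OF ex] by (simp add: n_def)
  then have "n \<noteq> 0" using assms by (cases n) auto
  then obtain k where k: "n = Suc k" using not0_implies_Suc by blast
  have "\<not> (1/2) ^ k < d" using not_less_Least[of k "\<lambda>n. (1/2) ^ n < d"] k n_def by simp
  then show ?thesis using n k by (intro exI[of _ k]) (auto simp: power_one_over field_simps)
qed

lemma dyadic_powr: "2 powr (- t * real k) = (1 / 2 ^ k) powr t"
proof -
  have "(1 / 2 ^ k :: real) = 2 powr (- real k)" by (simp add: powr_minus powr_realpow field_simps)
  then show ?thesis by (simp add: powr_powr mult.commute)
qed

lemma content_small_set_le:
  fixes S :: "'a::euclidean_space set"
  assumes t: "0 \<le> t" and d: "0 < d" "d \<le> 1" and S: "\<And>u v. u \<in> S \<Longrightarrow> v \<in> S \<Longrightarrow> dist u v \<le> d"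
  shows "content t S \<le> ennreal (3 ^ DIM('a) * 2 powr t * d powr t)"
proof -
  obtain k where k: "d \<le> 1 / 2 ^ k" "1 / 2 ^ k < 2 * d" using ex_dyadic_level[OF d] by blast
  have "finite (cell k ` S) \<and> card (cell k ` S) \<le> (2 * 1 + 1) ^ DIM('a)"
  proof (rule card_cells_box_le)
    fix u v i assume "u \<in> S" "v \<in> S" and i: "(i::'a) \<in> Basis"
    then have "dist u v \<le> d" using S by blast
    then show "\<bar>u \<bullet> i - v \<bullet> i\<bar> \<le> real 1 / 2 ^ k"
      using coord_diff_le_dist[OF i, of u v] k by simp
  qed
  then have fin: "finite (cell k ` S)" and c: "card (cell k ` S) \<le> 3 ^ DIM('a)" by auto
  have "content t S \<le> ennreal (real (card (cell k ` S)) * 2 powr (- t * real k))"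
    by (rule content_card_le[OF fin])
  also have "\<dots> \<le> ennreal (3 ^ DIM('a) * (2 * d) powr t)"
  proof (intro ennreal_leI mult_mono)
    show "real (card (cell k ` S)) \<le> 3 ^ DIM('a)" using c by (metis of_nat_le_iff of_nat_numeral of_nat_power)
    show "2 powr (- t * real k) \<le> (2 * d) powr t"
      unfolding dyadic_powr using k t by (intro powr_mono2) auto
  qed auto
  finally show ?thesis using d by (simp add: powr_mult mult.assoc)
qed

subsection \<open>Null sets of Hausdorff measures\<close>

lemma ennreal_le_suminf: "(f i :: ennreal) \<le> (\<Sum>i. f i)"
  using sum_le_suminf[of f "{i}"] by auto

text \<open>For null sets the mesh bound is automatic: a cover with sum at most
  \<open>\<delta> powr t\<close> has no member of diameter above \<open>\<delta>\<close>.\<close>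

lemma hausdorff_measure_null_iff:
  fixes A :: "'a::metric_space set"
  assumes t: "0 < t"
  shows "hausdorff_measure t A = 0 \<longleftrightarrow>
    (\<forall>\<eta>>0. \<exists>C :: nat \<Rightarrow> 'a set. A \<subseteq> (\<Union>i. C i) \<and> (\<forall>i. bounded (C i)) \<and>
        (\<Sum>i. ennreal (diameter (C i) powr t)) \<le> ennreal \<eta>)"
proof (intro iffI allI impI)
  fix \<eta> :: real assume H: "hausdorff_measure t A = 0" and \<eta>: "\<eta> > 0"
  have "hausdorff_pre t 1 A \<le> hausdorff_measure t A"
    unfolding hausdorff_measure_def by (rule SUP_upper) simp
  then have "hausdorff_pre t 1 A < ennreal \<eta>" using H \<eta> by simp
  then show "\<exists>C :: nat \<Rightarrow> 'a set. A \<subseteq> (\<Union>i. C i) \<and> (\<forall>i. bounded (C i)) \<and>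
        (\<Sum>i. ennreal (diameter (C i) powr t)) \<le> ennreal \<eta>"
    unfolding hausdorff_pre_def by (auto simp: INF_less_iff intro: less_imp_le)
next
  assume R: "\<forall>\<eta>>0. \<exists>C :: nat \<Rightarrow> 'a set. A \<subseteq> (\<Union>i. C i) \<and> (\<forall>i. bounded (C i)) \<and>
        (\<Sum>i. ennreal (diameter (C i) powr t)) \<le> ennreal \<eta>"
  have "hausdorff_pre t \<delta> A \<le> 0" if \<delta>: "\<delta> > 0" for \<delta>
  proof (rule ennreal_le_epsilon)
    fix e :: real assume e: "0 < e"
    define \<eta> where "\<eta> = min e (\<delta> powr t)"
    have \<eta>: "\<eta> > 0" using e \<delta> by (simp add: \<eta>_def)
    obtain C :: "nat \<Rightarrow> 'a set" where C: "A \<subseteq> (\<Union>i. C i)" "\<And>i. bounded (C i)"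
      "(\<Sum>i. ennreal (diameter (C i) powr t)) \<le> ennreal \<eta>" using R \<eta> by blast
    have "diameter (C i) \<le> \<delta>" for i
    proof (rule ccontr)
      assume "\<not> diameter (C i) \<le> \<delta>"
      then have "\<delta> powr t < diameter (C i) powr t" using \<delta> t by (intro powr_less_mono2) auto
      moreover have "ennreal (diameter (C i) powr t) \<le> (\<Sum>i. ennreal (diameter (C i) powr t))"
        by (rule ennreal_le_suminf)
      then have "ennreal (diameter (C i) powr t) \<le> ennreal \<eta>" using C(3) by (rule order_trans)
      then have "diameter (C i) powr t \<le> \<eta>" using \<eta> by simp
      ultimately show False unfolding \<eta>_def by simp
    qed
    then have "hausdorff_pre t \<delta> A \<le> (\<Sum>i. ennreal (diameter (C i) powr t))"
      unfolding hausdorff_pre_def using C by (intro INF_lower) auto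
    also have "\<dots> \<le> ennreal \<eta>" by (rule C)
    also have "\<dots> \<le> 0 + ennreal e" by (simp add: \<eta>_def ennreal_leI)
    finally show "hausdorff_pre t \<delta> A \<le> 0 + ennreal e" .
  qed
  then have "hausdorff_measure t A \<le> 0"
    unfolding hausdorff_measure_def by (intro SUP_least) auto
  then show "hausdorff_measure t A = 0" by simp
qed

lemma diameter_le_dist:
  fixes S :: "'a::metric_space set"
  assumes "0 \<le> d" "\<And>x y. x \<in> S \<Longrightarrow> y \<in> S \<Longrightarrow> dist x y \<le> d"
  shows "diameter S \<le> d"
  using assms unfolding diameter_def by (auto intro!: cSUP_least)

lemma hausdorff_null_lipschitz_image:
  fixes f :: "'a::metric_space \<Rightarrow> 'b::metric_space"
  assumes t: "0 < t" and L: "0 < L" and null: "hausdorff_measure t A = 0"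
    and lip: "\<And>x y. x \<in> A \<Longrightarrow> y \<in> A \<Longrightarrow> dist (f x) (f y) \<le> L * dist x y"
  shows "hausdorff_measure t (f ` A) = 0"
  unfolding hausdorff_measure_null_iff[OF t]
proof (intro allI impI)
  fix \<eta> :: real assume \<eta>: "\<eta> > 0"
  have "\<eta> / L powr t > 0" using \<eta> L by simp
  then obtain C :: "nat \<Rightarrow> 'a set" where C: "A \<subseteq> (\<Union>i. C i)" "\<And>i. bounded (C i)"
      "(\<Sum>i. ennreal (diameter (C i) powr t)) \<le> ennreal (\<eta> / L powr t)"
    using null unfolding hausdorff_measure_null_iff[OF t] by blast
  have d: "dist (f x) (f y) \<le> L * diameter (C i)" if "x \<in> C i \<inter> A" "y \<in> C i \<inter> A" for x y i
    using lip[of x y] diameter_bounded_bound[OF C(2), of x i y] that L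
    by (meson IntD1 IntD2 mult_left_mono less_imp_le order_trans)
  have b: "bounded (f ` (C i \<inter> A))" for i
    unfolding bounded_two_points using d by blast
  have "diameter (f ` (C i \<inter> A)) powr t \<le> L powr t * diameter (C i) powr t" for i
  proof -
    have "diameter (f ` (C i \<inter> A)) \<le> L * diameter (C i)"
      using d diameter_ge_0[OF C(2), of i] L by (intro diameter_le_dist) auto
    then have "diameter (f ` (C i \<inter> A)) powr t \<le> (L * diameter (C i)) powr t"
      using t by (intro powr_mono2 diameter_ge_0 b) auto
    then show ?thesis using L diameter_ge_0[OF C(2)] by (simp add: powr_mult)
  qed
  then have "(\<Sum>i. ennreal (diameter (f ` (C i \<inter> A)) powr t))
      \<le> (\<Sum>i. ennreal (L powr t) * ennreal (diameter (C i) powr t))"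
    by (intro suminf_le) (auto simp: ennreal_mult[symmetric] intro: ennreal_leI)
  also have "\<dots> = ennreal (L powr t) * (\<Sum>i. ennreal (diameter (C i) powr t))" by simp
  also have "\<dots> \<le> ennreal (L powr t) * ennreal (\<eta> / L powr t)" by (rule mult_left_mono[OF C(3)]) simp
  also have "\<dots> = ennreal \<eta>" using L \<eta> by (simp add: ennreal_mult[symmetric])
  finally have "(\<Sum>i. ennreal (diameter (f ` (C i \<inter> A)) powr t)) \<le> ennreal \<eta>" .
  moreover have "f ` A \<subseteq> (\<Union>i. f ` (C i \<inter> A))" using C(1) by fastforce
  ultimately show "\<exists>C. f ` A \<subseteq> (\<Union>i. C i) \<and> (\<forall>i. bounded (C i)) \<and>
        (\<Sum>i. ennreal (diameter (C i) powr t)) \<le> ennreal \<eta>"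
    using b by (intro exI[of _ "\<lambda>i. f ` (C i \<inter> A)"]) auto
qed

lemma content_null_of_hausdorff_null:
  fixes A :: "'a::euclidean_space set"
  assumes t: "0 < t" and null: "hausdorff_measure t A = 0"
  shows "content t A = 0"
proof -
  let ?K = "3 ^ DIM('a) * 2 powr t :: real"
  have bound: "content t A \<le> ennreal (2 * ?K * \<eta>)" if \<eta>: "0 < \<eta>" "\<eta> \<le> 1/2" for \<eta>
  proof -
    obtain C :: "nat \<Rightarrow> 'a set" where C: "A \<subseteq> (\<Union>i. C i)" "\<And>i. bounded (C i)"
      "(\<Sum>i. ennreal (diameter (C i) powr t)) \<le> ennreal \<eta>"
      using null \<eta> unfolding hausdorff_measure_null_iff[OF t] by blast
    \<comment> \<open>Covering sets may have diameter zero, while the cell count needs a positive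
      scale. The padding adds \<open>\<eta>\<close> to the total, and
      \<open>\<eta> \<le> 1/2\<close> keeps every \<open>d i\<close> at most one.\<close>
    define d where "d = (\<lambda>i. (diameter (C i) powr t + \<eta> * (1/2) ^ Suc i) powr (1 / t))"
    have dt: "d i powr t = diameter (C i) powr t + \<eta> * (1/2) ^ Suc i" for i
    proof -
      have "0 < diameter (C i) powr t + \<eta> * (1/2) ^ Suc i" using \<eta> by (intro add_nonneg_pos) auto
      then show ?thesis using t by (simp add: d_def powr_powr)
    qed
    have dpos: "d i > 0" for i
    proof -
      have "0 < diameter (C i) powr t + \<eta> * (1/2) ^ Suc i" using \<eta> by (intro add_nonneg_pos) auto
      then show ?thesis unfolding d_def by (metis powr_gt_zero less_irrefl)
    qed
    have "ennreal (diameter (C i) powr t) \<le> (\<Sum>i. ennreal (diameter (C i) powr t))" for i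
      by (rule ennreal_le_suminf)
    then have "ennreal (diameter (C i) powr t) \<le> ennreal \<eta>" for i using C(3) order_trans by blast
    then have dC: "diameter (C i) powr t \<le> 1/2" for i using \<eta>
      by (smt (verit) ennreal_le_iff)
    have "\<eta> * (1/2) ^ Suc i \<le> (1/2) * 1" for i
      using \<eta> by (intro mult_mono power_le_one) auto
    from add_mono[OF dC this] have dt1: "d i powr t \<le> 1" for i unfolding dt by simp
    have d1: "d i \<le> 1" for i
    proof (rule ccontr)
      assume "\<not> d i \<le> 1"
      then have "1 powr t < d i powr t" using t by (intro powr_less_mono2) auto
      then show False using dt1[of i] by simp
    qed
    have dd: "diameter (C i) \<le> d i" for i
    proof (rule ccontr)
      assume "\<not> diameter (C i) \<le> d i"
      then have "d i powr t < diameter (C i) powr t" using t dpos[of i] by (intro powr_less_mono2) auto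
      moreover have "0 \<le> \<eta> * (1/2) ^ Suc i" using \<eta> by simp
      ultimately show False unfolding dt by linarith
    qed
    have "content t A \<le> (\<Sum>i. content t (C i))"
      using content_mono[OF C(1)] content_UN_le order_trans by blast
    also have "\<dots> \<le> (\<Sum>i. ennreal ?K * ennreal (d i powr t))"
    proof (intro suminf_le)
      fix i
      have "dist u v \<le> d i" if "u \<in> C i" "v \<in> C i" for u v
        using diameter_bounded_bound[OF C(2) that] dd[of i] by linarith
      then have "content t (C i) \<le> ennreal (3 ^ DIM('a) * 2 powr t * d i powr t)"
        using t dpos d1 by (intro content_small_set_le) auto
      then show "content t (C i) \<le> ennreal ?K * ennreal (d i powr t)"
        by (simp add: ennreal_mult[symmetric])
    qed auto
    also have "\<dots> = ennreal ?K * (\<Sum>i. ennreal (d i powr t))" by simp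
    also have "(\<Sum>i. ennreal (d i powr t)) = (\<Sum>i. ennreal (diameter (C i) powr t) + ennreal (\<eta> * (1/2) ^ Suc i))"
      unfolding dt using \<eta> by (intro suminf_cong ennreal_plus) auto
    also have "\<dots> = (\<Sum>i. ennreal (diameter (C i) powr t)) + (\<Sum>i. ennreal (\<eta> * (1/2) ^ Suc i))"
      by (rule suminf_add[symmetric]) auto
    also have "(\<Sum>i. ennreal (\<eta> * (1/2) ^ Suc i)) = ennreal \<eta>"
      using sums_mult[OF power_half_series, of \<eta>] \<eta> by (intro suminf_ennreal_eq) auto
    also have "ennreal ?K * ((\<Sum>i. ennreal (diameter (C i) powr t)) + ennreal \<eta>)
        \<le> ennreal ?K * (ennreal \<eta> + ennreal \<eta>)"
      using C(3) by (intro mult_left_mono add_right_mono) auto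
    also have "\<dots> = ennreal (2 * ?K * \<eta>)"
      using \<eta> by (simp add: ennreal_mult[symmetric] ennreal_plus[symmetric] del: ennreal_plus)
    finally show ?thesis .
  qed
  have "content t A \<le> 0"
  proof (rule ennreal_le_epsilon)
    fix e :: real assume e: "0 < e"
    have K: "?K > 0" by simp
    define \<eta> where "\<eta> = min (1/2) (e / (2 * ?K))"
    have "content t A \<le> ennreal (2 * ?K * \<eta>)"
      using e K by (intro bound) (auto simp: \<eta>_def)
    also have "\<dots> \<le> ennreal e"
    proof (rule ennreal_leI)
      have "2 * ?K * \<eta> \<le> 2 * ?K * (e / (2 * ?K))" by (rule mult_left_mono) (auto simp: \<eta>_def)
      then show "2 * ?K * \<eta> \<le> e" using K by simp
    qed
    finally show "content t A \<le> 0 + ennreal e" by simp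
  qed
  then show ?thesis by simp
qed

lemma diameter_cell_le: "diameter (cell k x) \<le> real DIM('a) / 2 ^ k" for x :: "'a::euclidean_space"
proof (rule diameter_le)
  fix y z assume "y \<in> cell k x" "z \<in> cell k x"
  then have "z \<in> cell k y" using cell_eq by blast
  then show "norm (y - z) \<le> real DIM('a) / 2 ^ k"
    using cell_dist by (metis dist_commute dist_norm)
qed simp

lemma bounded_cell: "bounded (cell k x)" for x :: "'a::euclidean_space"
  unfolding bounded_def using cell_dist by (metis dist_commute)

lemma countable_enumeration:
  assumes "countable U"
  shows "\<exists>F :: nat \<Rightarrow> 'a set. (\<Union>n. F n) = (\<Union>p\<in>U. A p) \<and> (\<forall>n. F n = {} \<or> (\<exists>p\<in>U. F n = A p)) \<and>
    (\<forall>g :: 'a set \<Rightarrow> ennreal. g {} = 0 \<longrightarrow> (\<Sum>n. g (F n)) = (\<integral>\<^sup>+p. g (A p) \<partial>count_space U))"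
proof -
  define e where "e = to_nat_on U"
  define F where "F = (\<lambda>n. if n \<in> e ` U then A (inv_into U e n) else {})"
  have inj: "inj_on e U" unfolding e_def using assms by (rule inj_on_to_nat_on)
  have Fe: "F (e p) = A p" if "p \<in> U" for p using that inj by (simp add: F_def)
  have sums: "(\<Sum>n. g (F n)) = (\<integral>\<^sup>+p. g (A p) \<partial>count_space U)" if g: "g {} = 0" for g :: "'a set \<Rightarrow> ennreal"
  proof -
    have "(\<Sum>n. g (F n)) = (\<integral>\<^sup>+n. g (F n) \<partial>count_space UNIV)" by (simp add: nn_integral_count_space_nat)
    also have "\<dots> = (\<integral>\<^sup>+n. g (F n) \<partial>count_space (e ` U))"
      by (subst (2) nn_integral_count_space_indicator)
         (auto intro!: nn_integral_cong simp: F_def g split: split_indicator)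
    also have "\<dots> = (\<integral>\<^sup>+p. g (F (e p)) \<partial>count_space U)"
      using inj by (intro nn_integral_bij_count_space[symmetric]) (simp add: bij_betw_def)
    also have "\<dots> = (\<integral>\<^sup>+p. g (A p) \<partial>count_space U)" by (intro nn_integral_cong) (simp add: Fe)
    finally show ?thesis .
  qed
  have cases: "F n = {} \<or> (\<exists>p\<in>U. F n = A p)" for n
    unfolding F_def using inv_into_into[of n e U] by auto
  have "(\<Union>n. F n) = (\<Union>p\<in>U. A p)"
  proof
    show "(\<Union>n. F n) \<subseteq> (\<Union>p\<in>U. A p)"
    proof
      fix x assume "x \<in> (\<Union>n. F n)"
      then obtain n where "x \<in> F n" by blast
      then show "x \<in> (\<Union>p\<in>U. A p)" using cases[of n] by auto
    qed
    show "(\<Union>p\<in>U. A p) \<subseteq> (\<Union>n. F n)" using Fe by blast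
  qed
  then show ?thesis using cases sums by blast
qed

lemma hausdorff_null_of_content_null:
  fixes A :: "'a::euclidean_space set"
  assumes t: "0 < t" and null: "content t A = 0"
  shows "hausdorff_measure t A = 0"
  unfolding hausdorff_measure_null_iff[OF t]
proof (intro allI impI)
  fix \<eta> :: real assume \<eta>: "\<eta> > 0"
  let ?K = "real DIM('a) powr t"
  have K: "?K > 0" by simp
  have "content t A < ennreal (\<eta> / ?K)" using null \<eta> K by simp
  then obtain U where U: "U \<subseteq> cells" "A \<subseteq> \<Union>(snd ` U)"
    "emeasure (cell_weight t) U < ennreal (\<eta> / ?K)"
    using content_less_D[of t A "ennreal (\<eta> / ?K)"] by blast
  have "countable U" using U(1) countable_cells countable_subset by blast
  from countable_enumeration[OF this, of snd] obtain C
    where C: "(\<Union>n. C n) = \<Union>(snd ` U)" "\<And>n. C n = {} \<or> (\<exists>p\<in>U. C n = snd p)"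
      "\<And>g :: 'a set \<Rightarrow> ennreal. g {} = 0 \<Longrightarrow> (\<Sum>n. g (C n)) = (\<integral>\<^sup>+p. g (snd p) \<partial>count_space U)"
    by auto
  have cov: "A \<subseteq> (\<Union>n. C n)" using U(2) C(1) by simp
  have bd: "bounded (C n)" for n
  proof (cases "C n = {}")
    case False
    then obtain p where p: "p \<in> U" "C n = snd p" using C(2)[of n] by blast
    then obtain k x where "p = (k, cell k x)" using U(1) by (auto simp: cells_def)
    then show ?thesis using p bounded_cell by auto
  qed simp
  have "(\<Sum>n. ennreal (diameter (C n) powr t)) = (\<integral>\<^sup>+p. ennreal (diameter (snd p) powr t) \<partial>count_space U)"
    using t by (intro C(3)) simp
  also have "\<dots> \<le> (\<integral>\<^sup>+p. ennreal ?K * ennreal (2 powr (- t * real (fst p))) \<partial>count_space U)"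
  proof (rule nn_integral_mono)
    fix p assume "p \<in> space (count_space U)"
    then obtain k x where kx: "p = (k, cell k x)" using U(1) by (auto simp: cells_def)
    have "diameter (cell k x) powr t \<le> (real DIM('a) / 2 ^ k) powr t"
      using t diameter_cell_le bounded_cell by (intro powr_mono2 diameter_ge_0) auto
    also have "\<dots> = ?K * 2 powr (- t * real k)"
      unfolding dyadic_powr by (simp add: powr_divide)
    finally show "ennreal (diameter (snd p) powr t) \<le> ennreal ?K * ennreal (2 powr (- t * real (fst p)))"
      by (simp add: kx ennreal_mult[symmetric])
  qed
  also have "\<dots> = ennreal ?K * emeasure (cell_weight t) U"
    unfolding emeasure_cell_weight by (rule nn_integral_cmult) simp
  also have "ennreal ?K * emeasure (cell_weight t) U \<le> ennreal ?K * ennreal (\<eta> / ?K)"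
    using U(3) by (intro mult_left_mono) auto
  also have "\<dots> = ennreal \<eta>" using K \<eta> by (simp add: ennreal_mult[symmetric])
  finally show "\<exists>C :: nat \<Rightarrow> 'a set. A \<subseteq> (\<Union>i. C i) \<and> (\<forall>i. bounded (C i)) \<and>
        (\<Sum>i. ennreal (diameter (C i) powr t)) \<le> ennreal \<eta>"
    using cov bd by blast
qed

lemma hausdorff_null_iff_content_null:
  "0 < t \<Longrightarrow> hausdorff_measure t A = 0 \<longleftrightarrow> content t A = 0"
  using content_null_of_hausdorff_null hausdorff_null_of_content_null by blast

text \<open>A unit cell splits into order \<open>2 ^ (k * DIM('a))\<close> cells of level
  \<open>k\<close>, each of weight \<open>2 powr (- t * k)\<close>, and the product tends to zero.
  This later makes the infimum in \<open>hausdorff_dim\<close> range over a nonempty set.\<close>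

lemma content_UNIV_null:
  assumes t: "real DIM('a) < t"
  shows "content t (UNIV :: 'a::euclidean_space set) = 0"
proof -
  let ?D = "DIM('a)"
  have "content t (cell 0 x) = 0" for x :: 'a
  proof -
    have "content t (cell 0 x) \<le> ennreal (3 ^ ?D * (2 powr (real ?D - t)) ^ k)" for k
    proof -
      have "finite (cell k ` cell 0 x) \<and> card (cell k ` cell 0 x) \<le> (2 * 2 ^ k + 1) ^ ?D"
      proof (rule card_cells_box_le)
        fix u v i :: 'a assume uv: "u \<in> cell 0 x" "v \<in> cell 0 x" "i \<in> Basis"
        then have "u \<in> cell 0 v" using cell_eq by blast
        from cell_coord[OF this uv(3)] show "\<bar>u \<bullet> i - v \<bullet> i\<bar> \<le> real (2 ^ k) / 2 ^ k" by simp
      qed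
      moreover have "real ((2 * 2 ^ k + 1) ^ ?D) \<le> (3 * 2 ^ k) ^ ?D"
      proof -
        have "real (2 * 2 ^ k + 1) ^ ?D \<le> (3 * 2 ^ k) ^ ?D"
          using one_le_power[of "2::real" k] by (intro power_mono) auto
        then show ?thesis by simp
      qed
      ultimately have fin: "finite (cell k ` cell 0 x)"
        and c: "real (card (cell k ` cell 0 x)) \<le> (3 * 2 ^ k) ^ ?D"
        by (auto intro: order_trans[OF of_nat_mono])
      have "content t (cell 0 x) \<le> ennreal (real (card (cell k ` cell 0 x)) * 2 powr (- t * real k))"
        by (rule content_card_le[OF fin])
      also have "\<dots> \<le> ennreal ((3 * 2 ^ k) ^ ?D * 2 powr (- t * real k))"
        using c by (intro ennreal_leI mult_right_mono) auto
      also have "(3 * 2 ^ k) ^ ?D * 2 powr (- t * real k) = 3 ^ ?D * (2 powr (real ?D - t)) ^ k"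
      proof -
        have "((2::real) ^ k) ^ ?D = 2 powr (real ?D * real k)"
          by (simp add: powr_realpow[symmetric] powr_powr mult.commute)
        moreover have "(2 powr (real ?D - t)) ^ k = 2 powr (real ?D * real k) * 2 powr (- t * real k)"
          by (simp add: powr_realpow[symmetric] powr_powr powr_add[symmetric] algebra_simps)
        ultimately show ?thesis by (simp add: power_mult_distrib)
      qed
      finally show ?thesis .
    qed
    moreover have "(\<lambda>k. ennreal (3 ^ ?D * (2 powr (real ?D - t)) ^ k)) \<longlonglongrightarrow> ennreal (3 ^ ?D * 0)"
    proof (intro tendsto_ennrealI tendsto_mult tendsto_const LIMSEQ_power_zero)
      have "2 powr (real ?D - t) < 2 powr 0" using t by (intro powr_less_mono) auto
      then show "norm (2 powr (real ?D - t)) < 1" by simp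
    qed
    ultimately have "content t (cell 0 x) \<le> ennreal (3 ^ ?D * 0)"
      by (intro LIMSEQ_le_const) auto
    then show ?thesis by simp
  qed
  then show ?thesis using content_restrict_cell[of t "UNIV :: 'a set" 0] by auto
qed

subsection \<open>Compact subsets of analytic sets\<close>

text \<open>Cells are half-open, whereas compactness and continuity call for open covers. A radius
  equal to the side length costs only a constant factor in content.\<close>

definition fat :: "nat \<Rightarrow> 'a::euclidean_space set \<Rightarrow> 'a set" where
  "fat k Q = (\<Union>x\<in>Q. ball x (1 / 2 ^ k))"

lemma open_fat: "open (fat k Q)"
  by (auto simp: fat_def)

lemma subset_fat: "Q \<subseteq> fat k Q"
  by (force simp: fat_def)

lemma fat_coord:
  assumes "(k, Q) \<in> cells" "u \<in> fat k Q" "v \<in> fat k Q" "i \<in> Basis"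
  shows "\<bar>u \<bullet> i - v \<bullet> i\<bar> \<le> 3 / 2 ^ k"
proof -
  obtain x y where xy: "x \<in> Q" "y \<in> Q" "dist x u < 1 / 2 ^ k" "dist y v < 1 / 2 ^ k"
    using assms by (auto simp: fat_def)
  then have "x \<in> cell k y" using assms(1) cells_D by blast
  then have "\<bar>x \<bullet> i - y \<bullet> i\<bar> \<le> 1 / 2 ^ k" using assms(4) by (rule cell_coord)
  moreover have "\<bar>x \<bullet> i - u \<bullet> i\<bar> \<le> 1 / 2 ^ k" "\<bar>y \<bullet> i - v \<bullet> i\<bar> \<le> 1 / 2 ^ k"
    using coord_diff_le_dist[OF assms(4)] xy by (meson less_imp_le order_trans)+
  ultimately show ?thesis by linarith
qed

lemma content_fat_le:
  fixes Q :: "'a::euclidean_space set"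
  assumes "(k, Q) \<in> cells"
  shows "content t (fat k Q) \<le> ennreal (7 ^ DIM('a)) * ennreal (2 powr (- t * real k))"
proof -
  have "finite (cell k ` fat k Q) \<and> card (cell k ` fat k Q) \<le> (2 * 3 + 1) ^ DIM('a)"
    by (rule card_cells_box_le) (use fat_coord[OF assms] in simp)
  then have fin: "finite (cell k ` fat k Q)" and c: "card (cell k ` fat k Q) \<le> 7 ^ DIM('a)" by auto
  have "real (card (cell k ` fat k Q)) \<le> 7 ^ DIM('a)"
    using c by (metis of_nat_le_iff of_nat_numeral of_nat_power)
  then have "ennreal (real (card (cell k ` fat k Q)) * 2 powr (- t * real k))
      \<le> ennreal (7 ^ DIM('a) * 2 powr (- t * real k))"
    by (intro ennreal_leI mult_right_mono) auto
  then show ?thesis using content_card_le[OF fin] by (simp add: ennreal_mult) (meson order_trans)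
qed

lemma content_UN_fat_le:
  fixes U :: "(nat \<times> 'a::euclidean_space set) set"
  assumes U: "U \<subseteq> cells"
  shows "content t (\<Union>(k, Q)\<in>U. fat k Q) \<le> ennreal (7 ^ DIM('a)) * emeasure (cell_weight t) U"
proof -
  have "countable U" using U countable_cells countable_subset by blast
  from countable_enumeration[OF this, of "\<lambda>(k, Q). fat k Q"] obtain F
    where F: "(\<Union>n. F n) = (\<Union>(k, Q)\<in>U. fat k Q)"
      "\<And>g :: 'a set \<Rightarrow> ennreal. g {} = 0 \<Longrightarrow>
        (\<Sum>n. g (F n)) = (\<integral>\<^sup>+p. g (case p of (k, Q) \<Rightarrow> fat k Q) \<partial>count_space U)" by auto
  have "content t (\<Union>(k, Q)\<in>U. fat k Q) \<le> (\<Sum>n. content t (F n))"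
    unfolding F(1)[symmetric] by (rule content_UN_le)
  also have "\<dots> = (\<integral>\<^sup>+p. content t (case p of (k, Q) \<Rightarrow> fat k Q) \<partial>count_space U)" by (rule F(2)) simp
  also have "\<dots> \<le> (\<integral>\<^sup>+p. ennreal (7 ^ DIM('a)) * ennreal (2 powr (- t * real (fst p))) \<partial>count_space U)"
  proof (rule nn_integral_mono)
    fix p assume "p \<in> space (count_space U)"
    then have "(fst p, snd p) \<in> cells" using U by auto
    from content_fat_le[OF this]
    show "content t (case p of (k, Q) \<Rightarrow> fat k Q)
        \<le> ennreal (7 ^ DIM('a)) * ennreal (2 powr (- t * real (fst p)))"
      by (simp add: case_prod_unfold)
  qed
  also have "\<dots> = ennreal (7 ^ DIM('a)) * emeasure (cell_weight t) U"
    unfolding emeasure_cell_weight by (rule nn_integral_cmult) simp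
  finally show ?thesis .
qed

section \<open>Compact boxes in the Baire space and capacitability\<close>

lemma compact_bounded_sequences: "compact {x :: nat \<Rightarrow> nat. \<forall>i. x i \<le> k i}"
proof -
  have "compactin (product_topology (\<lambda>_. euclidean) UNIV) (PiE UNIV (\<lambda>i. {..k i}))"
    unfolding compactin_PiE by (simp add: finite_imp_compact)
  then have "compact (PiE UNIV (\<lambda>i. {..k i}))" by (simp add: euclidean_product_topology)
  moreover have "PiE UNIV (\<lambda>i. {..k i}) = {x. \<forall>i. x i \<le> k i}" by auto
  ultimately show ?thesis by simp
qed

lemma open_prefix_nbhd:
  fixes O' :: "(nat \<Rightarrow> nat) set"
  assumes "open O'" "x \<in> O'"
  shows "\<exists>n. \<forall>y. (\<forall>i<n. y i = x i) \<longrightarrow> y \<in> O'"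
proof -
  obtain X where X: "x \<in> PiE UNIV X" "finite {i. X i \<noteq> UNIV}" "PiE UNIV X \<subseteq> O'"
    using product_topology_open_contains_basis[of "\<lambda>_. euclidean" UNIV O' x] assms
    unfolding open_fun_def by auto
  obtain n where n: "\<And>i. X i \<noteq> UNIV \<Longrightarrow> i < n"
    using X(2) by (metis (mono_tags) finite_nat_set_iff_bounded mem_Collect_eq)
  have "y \<in> O'" if "\<forall>i<n. y i = x i" for y
  proof -
    have "y i \<in> X i" for i using n[of i] that X(1) by (cases "X i = UNIV") auto
    then show ?thesis using X(3) by auto
  qed
  then show ?thesis by blast
qed

text \<open>Finitely many prefix neighbourhoods cover the compact box, and \<open>m\<close> is at
  least each of their lengths. A sequence obeying the bounds only below \<open>m\<close> is
  truncated by \<open>min\<close> into the box, with its first \<open>m\<close> entries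
  unchanged.\<close>

lemma prefix_box_subset_open:
  fixes O' :: "(nat \<Rightarrow> nat) set"
  assumes "open O'" "{x. \<forall>i. x i \<le> k i} \<subseteq> O'"
  shows "\<exists>m. {x. \<forall>i<m. x i \<le> k i} \<subseteq> O'"
proof -
  let ?L = "{x :: nat \<Rightarrow> nat. \<forall>i. x i \<le> k i}"
  have "\<exists>n. \<forall>y. (\<forall>i<n. y i = x i) \<longrightarrow> y \<in> O'" if "x \<in> ?L" for x
    using open_prefix_nbhd[OF assms(1), of x] assms(2) that by blast
  then have "\<forall>x\<in>?L. \<exists>n. \<forall>y. (\<forall>i<n. y i = x i) \<longrightarrow> y \<in> O'" by blast
  from bchoice[OF this] obtain n
    where n: "\<And>x y. x \<in> ?L \<Longrightarrow> \<forall>i<n x. y i = x i \<Longrightarrow> y \<in> O'" by blast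
  define N where "N = (\<lambda>x. {y :: nat \<Rightarrow> nat. \<forall>i<n x. y i = x i})"
  have op: "open (N x)" for x
  proof -
    have "N x = (\<Inter>i\<in>{..<n x}. (\<lambda>y. y i) -` {x i})" by (auto simp: N_def)
    moreover have "open ((\<lambda>y :: nat \<Rightarrow> nat. y i) -` {x i})" for i
      by (intro open_vimage open_discrete continuous_on_product_coordinates)
    ultimately show ?thesis by (auto intro: open_INT)
  qed
  have "?L \<subseteq> (\<Union>x\<in>?L. N x)" by (auto simp: N_def)
  from compactE_image[OF compact_bounded_sequences op this]
  obtain F where F: "F \<subseteq> ?L" "finite F" "?L \<subseteq> (\<Union>x\<in>F. N x)" by blast
  define m where "m = Max (insert 0 (n ` F))"
  have m: "n x \<le> m" if "x \<in> F" for x using that F(2) by (simp add: m_def)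
  have "y \<in> O'" if y: "\<forall>i<m. y i \<le> k i" for y
  proof -
    define z where "z = (\<lambda>i. min (y i) (k i))"
    have "z \<in> ?L" by (simp add: z_def)
    then obtain x where x: "x \<in> F" "z \<in> N x" using F(3) by blast
    have "y i = x i" if "i < n x" for i
    proof -
      have "y i \<le> k i" using m[OF x(1)] y that by simp
      moreover have "z i = x i" using x(2) that by (simp add: N_def)
      ultimately show ?thesis by (simp add: z_def)
    qed
    then show ?thesis using n x(1) F(1) by blast
  qed
  then show ?thesis by blast
qed

text \<open>Choquet's capacitability argument. Continuity along increasing unions lets the
  coordinates of the Baire space be bounded one after another while the content of the image stays
  above \<open>c\<close>. If the limiting compact set were null, a light open cover of it would
  already contain the image of a box bounded in finitely many coordinates.\<close>

lemma analytic_content_compact: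
  fixes Z :: "'a::euclidean_space set"
  assumes "analytic_set Z" "content t Z \<noteq> 0"
  shows "\<exists>K. compact K \<and> K \<subseteq> Z \<and> content t K \<noteq> 0"
proof -
  have "Z \<noteq> {}" using assms(2) by auto
  then obtain f :: "(nat \<Rightarrow> nat) \<Rightarrow> 'a" where f: "continuous_on UNIV f" "range f = Z"
    using assms(1) by (auto simp: analytic_set_def)
  obtain c where c: "0 < c" "ennreal c < content t Z" using ennreal_between_content[OF assms(2)] by blast
  define P where "P = (\<lambda>m (k :: nat \<Rightarrow> nat). ennreal c < content t (f ` {x. \<forall>i<m. x i \<le> k i}))"
  have step: "\<exists>k'. P (Suc m) k' \<and> (\<forall>i<m. k' i = k i)" if "P m k" for m k
  proof -
    let ?B = "\<lambda>j. {x. (\<forall>i<m. x i \<le> k i) \<and> x m \<le> j}"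
    have "f ` {x. \<forall>i<m. x i \<le> k i} = (\<Union>j. f ` ?B j)" by auto
    then have "ennreal c < content t (\<Union>j. f ` ?B j)" using that by (simp add: P_def)
    moreover have "incseq (\<lambda>j. f ` ?B j)" by (auto simp: incseq_def)
    ultimately obtain j where j: "ennreal c < content t (f ` ?B j)"
      using content_incseq_gt by blast
    have "?B j = {x. \<forall>i<Suc m. x i \<le> (k(m := j)) i}" by (auto simp: less_Suc_eq)
    then have "P (Suc m) (k(m := j))" using j by (simp add: P_def)
    then show ?thesis by (intro exI[of _ "k(m := j)"]) auto
  qed
  have "P 0 (\<lambda>_. 0)" using c f by (simp add: P_def)
  then have "\<exists>g. \<forall>m. P m (g m) \<and> (\<forall>i<m. g (Suc m) i = g m i)"
    using dependent_nat_choice[of P "\<lambda>m k k'. \<forall>i<m. k' i = k i"] step by blast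
  then obtain g where g: "\<And>m. P m (g m)" "\<And>m i. i < m \<Longrightarrow> g (Suc m) i = g m i" by blast
  define k where "k = (\<lambda>i. g (Suc i) i)"
  have gk: "g m i = k i" if "i < m" for m i
    using that
  proof (induction m)
    case (Suc m)
    then show ?case using g(2)[of i m] by (cases "i = m") (auto simp: k_def)
  qed simp
  have Pk: "ennreal c < content t (f ` {x. \<forall>i<m. x i \<le> k i})" for m
    using g(1)[of m] gk[of _ m] by (simp add: P_def)
  define K where "K = f ` {x. \<forall>i. x i \<le> k i}"
  have "compact K" unfolding K_def
    by (rule compact_continuous_image[OF continuous_on_subset[OF f(1)] compact_bounded_sequences]) simp
  moreover have "K \<subseteq> Z" using f(2) by (auto simp: K_def)
  moreover have "content t K \<noteq> 0"
  proof
    assume "content t K = 0"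
    \<comment> \<open>The divisor is the loss incurred when cells are replaced by their open
      neighbourhoods.\<close>
    then have "content t K < ennreal (c / 7 ^ DIM('a))" using c by simp
    from content_less_D[OF this] obtain U where U: "U \<subseteq> cells" "K \<subseteq> \<Union>(snd ` U)"
      "emeasure (cell_weight t) U < ennreal (c / 7 ^ DIM('a))" by auto
    define V where "V = (\<Union>(k, Q)\<in>U. fat k Q)"
    have "open V" unfolding V_def by (auto intro: open_fat)
    then have "open (f -` V)" using f(1) by (rule open_vimage)
    moreover have "K \<subseteq> V" using U(2) subset_fat unfolding V_def by (fastforce simp: subset_iff)
    then have "{x. \<forall>i. x i \<le> k i} \<subseteq> f -` V" by (auto simp: K_def)
    ultimately obtain m where "{x. \<forall>i<m. x i \<le> k i} \<subseteq> f -` V"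
      using prefix_box_subset_open by blast
    then have "content t (f ` {x. \<forall>i<m. x i \<le> k i}) \<le> content t V" by (intro content_mono) auto
    also have "\<dots> \<le> ennreal (7 ^ DIM('a)) * emeasure (cell_weight t) U"
      unfolding V_def by (rule content_UN_fat_le[OF U(1)])
    also have "\<dots> \<le> ennreal (7 ^ DIM('a)) * ennreal (c / 7 ^ DIM('a))"
      using U(3) by (intro mult_left_mono) auto
    also have "\<dots> = ennreal c" using c by (simp add: ennreal_mult[symmetric])
    finally show False using Pk[of m] by simp
  qed
  ultimately show ?thesis by blast
qed

subsection \<open>Discrete Frostman measures\<close>

text \<open>The growth condition is required only down to the scale \<open>1 / 2 ^ N\<close>, but
  with constant one whatever \<open>N\<close> is, so later constants do not depend on
  \<open>N\<close>.\<close>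

definition frostman :: "real \<Rightarrow> nat \<Rightarrow> 'a::euclidean_space set \<Rightarrow> ('a \<Rightarrow> real) \<Rightarrow> bool" where
  "frostman t N Y \<nu> \<longleftrightarrow> finite Y \<and> (\<forall>y. 0 \<le> \<nu> y) \<and>
     (\<forall>j\<le>N. \<forall>x. sum \<nu> (Y \<inter> cell j x) \<le> 2 powr (- t * real j))"

lemma frostman_card_le:
  assumes "frostman t N Y \<nu>" "k \<le> N" "finite (cell k ` S)" "real (card (cell k ` S)) \<le> c"
  shows "sum \<nu> (Y \<inter> S) \<le> c * 2 powr (- t * real k)"
proof -
  have Y: "finite Y" "\<And>y. 0 \<le> \<nu> y" and fr: "\<And>x. sum \<nu> (Y \<inter> cell k x) \<le> 2 powr (- t * real k)"
    using assms by (auto simp: frostman_def)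
  have "sum \<nu> (Y \<inter> S) = (\<Sum>Q\<in>cell k ` S. sum \<nu> {y \<in> Y \<inter> S. cell k y = Q})"
    using assms(3) Y by (intro sum.group[symmetric]) auto
  also have "\<dots> \<le> (\<Sum>Q\<in>cell k ` S. sum \<nu> (Y \<inter> Q))"
    using Y by (intro sum_mono sum_mono2) auto
  also have "\<dots> \<le> (\<Sum>Q\<in>cell k ` S. 2 powr (- t * real k))"
    using fr by (intro sum_mono) auto
  also have "\<dots> \<le> c * 2 powr (- t * real k)" using assms(4) by (simp add: mult_right_mono)
  finally show ?thesis .
qed

text \<open>The mass of a cell is passed on to its subcells in proportion to their contents. By
  subadditivity no subcell receives more than its content.\<close>

lemma frostman_above_level:
  fixes A :: "'a::euclidean_space set"
  assumes "k \<le> N" "A \<subseteq> cell k x" "0 \<le> c" "ennreal c \<le> content t A"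
  shows "\<exists>Y \<nu>. Y \<subseteq> A \<and> finite Y \<and> (\<forall>y. 0 \<le> \<nu> y) \<and> sum \<nu> Y = c \<and>
    (\<forall>j. k \<le> j \<longrightarrow> j \<le> N \<longrightarrow> (\<forall>x. sum \<nu> (Y \<inter> cell j x) \<le> 2 powr (- t * real j)))"
  using assms
proof (induction "N - k" arbitrary: k A x c)
  case 0
  then have k: "k = N" by simp
  show ?case
  proof (cases "A = {}")
    case True
    then show ?thesis using 0 by (intro exI[of _ "{}"] exI[of _ "\<lambda>_. 0"]) auto
  next
    case False
    then obtain y where y: "y \<in> A" by auto
    have "ennreal c \<le> ennreal (2 powr (- t * real N))"
      using 0 content_cell_le[of A k x t] k by (meson order_trans)
    then have "c \<le> 2 powr (- t * real N)" by simp
    moreover have "sum (\<lambda>_. c) ({y} \<inter> B) \<le> c" for B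
      using 0 by (cases "y \<in> B") auto
    ultimately show ?thesis using y 0 k
      by (intro exI[of _ "{y}"] exI[of _ "\<lambda>_. c"]) (auto intro: order_trans)
  qed
next
  case (Suc n)
  have cle: "c \<le> 2 powr (- t * real k)"
  proof -
    have "ennreal c \<le> ennreal (2 powr (- t * real k))"
      using Suc.prems content_cell_le[of A k x t] by (meson order_trans)
    then show ?thesis by simp
  qed
  define \<Q> where "\<Q> = cell (Suc k) ` A"
  have fin: "finite \<Q>"
  proof -
    have "finite (cell (Suc k) ` A) \<and> card (cell (Suc k) ` A) \<le> (2 * 2 + 1) ^ DIM('a)"
    proof (rule card_cells_box_le)
      fix u v i assume uv: "u \<in> A" "v \<in> A" "(i::'a) \<in> Basis"
      then have "u \<in> cell k v" using Suc.prems(2) cell_eq by blast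
      from cell_coord[OF this uv(3)] show "\<bar>u \<bullet> i - v \<bullet> i\<bar> \<le> real 2 / 2 ^ Suc k" by simp
    qed
    then show ?thesis by (simp add: \<Q>_def)
  qed
  define m where "m = (\<lambda>Q. enn2real (content t (A \<inter> Q)))"
  have mQ: "content t (A \<inter> Q) = ennreal (m Q)" if "Q \<in> \<Q>" for Q
  proof -
    from that obtain y where "Q = cell (Suc k) y" unfolding \<Q>_def by blast
    then have "content t (A \<inter> Q) \<le> ennreal (2 powr (- t * real (Suc k)))"
      by (intro content_cell_le) auto
    then have "content t (A \<inter> Q) < top" by (simp add: le_less_trans)
    then show ?thesis by (simp add: m_def)
  qed
  define s where "s = sum m \<Q>"
  have m0: "0 \<le> m Q" for Q by (simp add: m_def)
  have cs: "c \<le> s"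
  proof -
    have "A = (\<Union>Q\<in>\<Q>. A \<inter> Q)" by (auto simp: \<Q>_def intro: self_in_cell)
    then have "content t A \<le> (\<Sum>Q\<in>\<Q>. content t (A \<inter> Q))"
      using content_UN_finite_le[OF fin] by metis
    also have "\<dots> = (\<Sum>Q\<in>\<Q>. ennreal (m Q))" using mQ by simp
    also have "\<dots> = ennreal s" unfolding s_def using m0 by (simp add: sum_ennreal)
    finally have "ennreal c \<le> ennreal s" using Suc.prems(4) by (rule order_trans[rotated])
    moreover have "0 \<le> s" unfolding s_def by (rule sum_nonneg) (rule m0)
    ultimately show ?thesis by simp
  qed
  show ?case
  proof (cases "s = 0")
    case True
    then have "c = 0" using cs Suc.prems by simp
    then show ?thesis by (intro exI[of _ "{}"] exI[of _ "\<lambda>_. 0"]) auto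
  next
    case False
    then have s: "s > 0" using cs Suc.prems by simp
    define w where "w = (\<lambda>Q. c * m Q / s)"
    have w: "0 \<le> w Q" "w Q \<le> m Q" for Q
    proof -
      show "0 \<le> w Q" using Suc.prems m0 s by (simp add: w_def)
      show "w Q \<le> m Q" using cs s m0[of Q] by (simp add: w_def pos_divide_le_eq mult_right_mono mult.commute)
    qed
    define R where "R = (\<lambda>Q Y \<nu>. Y \<subseteq> A \<inter> Q \<and> finite Y \<and> (\<forall>y. 0 \<le> \<nu> y) \<and> sum \<nu> Y = w Q \<and>
      (\<forall>j. Suc k \<le> j \<longrightarrow> j \<le> N \<longrightarrow> (\<forall>x. sum \<nu> (Y \<inter> cell j x) \<le> 2 powr (- t * real j))))"
    have "\<exists>Y \<nu>. R Q Y \<nu>" if Q: "Q \<in> \<Q>" for Q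
    proof -
      obtain y where y: "Q = cell (Suc k) y" using Q unfolding \<Q>_def by blast
      show ?thesis unfolding R_def
      proof (rule Suc.hyps(1))
        show "n = N - Suc k" "Suc k \<le> N" using Suc.hyps(2) by auto
        show "A \<inter> Q \<subseteq> cell (Suc k) y" using y by auto
        show "ennreal (w Q) \<le> content t (A \<inter> Q)" unfolding mQ[OF Q] using w by (intro ennreal_leI)
      qed (rule w)
    qed
    then obtain Y \<mu> where "\<And>Q. Q \<in> \<Q> \<Longrightarrow> R Q (Y Q) (\<mu> Q)" by metis
    then have Y: "\<And>Q. Q \<in> \<Q> \<Longrightarrow> Y Q \<subseteq> A \<inter> Q" "\<And>Q. Q \<in> \<Q> \<Longrightarrow> finite (Y Q)"
      and \<mu>: "\<And>Q y. Q \<in> \<Q> \<Longrightarrow> 0 \<le> \<mu> Q y" "\<And>Q. Q \<in> \<Q> \<Longrightarrow> sum (\<mu> Q) (Y Q) = w Q"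
        "\<And>Q j x. Q \<in> \<Q> \<Longrightarrow> Suc k \<le> j \<Longrightarrow> j \<le> N \<Longrightarrow> sum (\<mu> Q) (Y Q \<inter> cell j x) \<le> 2 powr (- t * real j)"
      unfolding R_def by blast+
    define X where "X = (\<Union>Q\<in>\<Q>. Y Q)"
    define \<nu> where "\<nu> = (\<lambda>y. if cell (Suc k) y \<in> \<Q> then \<mu> (cell (Suc k) y) y else 0)"
    have cellQ: "cell (Suc k) y = Q" if "Q \<in> \<Q>" "y \<in> Q" for Q y
      using that by (auto simp: \<Q>_def dest: cell_eq)
    have \<nu>\<mu>: "\<nu> y = \<mu> Q y" if "Q \<in> \<Q>" "y \<in> Y Q" for Q y
      using that Y(1)[of Q] cellQ[of Q y] by (auto simp: \<nu>_def)
    have "finite X" unfolding X_def using fin Y(2) by blast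
    moreover have "X \<subseteq> A" unfolding X_def using Y(1) by blast
    moreover have \<nu>0: "0 \<le> \<nu> y" for y using \<mu>(1) by (simp add: \<nu>_def)
    moreover have tot: "sum \<nu> X = c"
    proof -
      have "sum \<nu> X = (\<Sum>Q\<in>\<Q>. sum \<nu> (Y Q))"
        unfolding X_def
      proof (rule sum.UNION_disjoint[OF fin])
        show "\<forall>i\<in>\<Q>. \<forall>j\<in>\<Q>. i \<noteq> j \<longrightarrow> Y i \<inter> Y j = {}" using Y(1) cellQ by blast
      qed (use Y(2) in auto)
      also have "\<dots> = (\<Sum>Q\<in>\<Q>. w Q)"
        using \<nu>\<mu> \<mu>(2) by (intro sum.cong) (auto cong: sum.cong)
      also have "\<dots> = c" using s unfolding w_def s_def
        by (simp flip: sum_divide_distrib sum_distrib_left)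
      finally show ?thesis .
    qed
    moreover have "sum \<nu> (X \<inter> cell j z) \<le> 2 powr (- t * real j)" if j: "k \<le> j" "j \<le> N" for j z
    proof (cases "j = k")
      case True
      have "sum \<nu> (X \<inter> cell j z) \<le> sum \<nu> X"
        using \<open>finite X\<close> \<nu>0 by (intro sum_mono2) auto
      then show ?thesis using tot cle True by simp
    next
      case False
      then have j': "Suc k \<le> j" using j by simp
      define Q where "Q = cell (Suc k) z"
      have sub: "cell j z \<subseteq> Q" unfolding Q_def by (rule cell_mono[OF j'])
      show ?thesis
      proof (cases "Q \<in> \<Q>")
        case True
        have "X \<inter> cell j z = Y Q \<inter> cell j z"
        proof
          show "X \<inter> cell j z \<subseteq> Y Q \<inter> cell j z"
          proof
            fix y assume y: "y \<in> X \<inter> cell j z"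
            then obtain R where R: "R \<in> \<Q>" "y \<in> Y R" by (auto simp: X_def)
            then have "cell (Suc k) y = R" using Y(1) cellQ by blast
            moreover have "cell (Suc k) y = Q" using y sub cellQ[OF True] by blast
            ultimately show "y \<in> Y Q \<inter> cell j z" using R y by simp
          qed
        qed (use True X_def in blast)
        then have "sum \<nu> (X \<inter> cell j z) = sum (\<mu> Q) (Y Q \<inter> cell j z)"
          using \<nu>\<mu>[OF True] by (auto intro: sum.cong)
        then show ?thesis using \<mu>(3)[OF True j' j(2)] by simp
      next
        case False
        have "X \<inter> cell j z = {}"
        proof (rule ccontr)
          assume "X \<inter> cell j z \<noteq> {}"
          then obtain y R where y: "R \<in> \<Q>" "y \<in> Y R" "y \<in> cell j z" by (auto simp: X_def)
          then have "y \<in> R" using Y(1) by blast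
          then have "R = cell (Suc k) y" using cellQ[OF y(1)] by simp
          also have "\<dots> = Q" unfolding Q_def by (rule cell_eq) (use y(3) sub Q_def in blast)
          finally show False using False y(1) by simp
        qed
        then show ?thesis by simp
      qed
    qed
    ultimately show ?thesis by blast
  qed
qed

text \<open>Levels coarser than \<open>k\<close> come for free: all mass lies in one cell of level
  \<open>k\<close>, and \<open>2 powr (- t * j)\<close> does not decrease when \<open>j\<close>
  becomes smaller.\<close>

lemma frostman_exists:
  fixes A :: "'a::euclidean_space set"
  assumes t: "0 \<le> t" and "k \<le> N" "A \<subseteq> cell k x" "0 \<le> c" "ennreal c \<le> content t A"
  shows "\<exists>Y \<nu>. Y \<subseteq> A \<and> frostman t N Y \<nu> \<and> sum \<nu> Y = c"
proof -
  obtain Y \<nu> where Y: "Y \<subseteq> A" "finite Y" "\<And>y. 0 \<le> \<nu> y" "sum \<nu> Y = c"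
    "\<And>j x. k \<le> j \<Longrightarrow> j \<le> N \<Longrightarrow> sum \<nu> (Y \<inter> cell j x) \<le> 2 powr (- t * real j)"
    using frostman_above_level[OF assms(2-5)] by blast
  have "sum \<nu> (Y \<inter> cell j z) \<le> 2 powr (- t * real j)" if "j \<le> N" for j z
  proof (cases "k \<le> j")
    case False
    have "sum \<nu> (Y \<inter> cell j z) \<le> sum \<nu> Y" using Y by (intro sum_mono2) auto
    also have "sum \<nu> Y = sum \<nu> (Y \<inter> cell k x)" using Y(1) assms(3) by (metis inf.absorb1 order_trans)
    also have "\<dots> \<le> 2 powr (- t * real k)" using Y(5) assms(2) by blast
    also have "\<dots> \<le> 2 powr (- t * real j)" using False t by (intro powr_mono) (auto simp: mult_left_mono)
    finally show ?thesis .
  qed (use Y(5) that in blast)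
  then show ?thesis using Y unfolding frostman_def by blast
qed

lemma frostman_ball_le:
  fixes x :: "'a::euclidean_space"
  assumes fr: "frostman t N Y \<nu>" and t: "0 \<le> t" and r: "1 / 2 ^ N \<le> r" "r \<le> 1"
  shows "sum \<nu> {y \<in> Y. dist x y \<le> r} \<le> 5 ^ DIM('a) * 2 powr t * r powr t"
proof -
  have r0: "0 < r" using r by (auto intro: less_le_trans[rotated])
  obtain k where k: "r \<le> 1 / 2 ^ k" "1 / 2 ^ k < 2 * r" using ex_dyadic_level[OF r0 r(2)] by blast
  have kN: "k \<le> N"
  proof -
    have "(1::real) / 2 ^ N \<le> 1 / 2 ^ k" using r k by linarith
    then have "(2::real) ^ k \<le> 2 ^ N" by (simp add: field_simps)
    then show ?thesis by simp
  qed
  have "finite (cell k ` cball x r) \<and> card (cell k ` cball x r) \<le> (2 * 2 + 1) ^ DIM('a)"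
  proof (rule card_cells_box_le)
    fix u v i assume uv: "u \<in> cball x r" "v \<in> cball x r" "(i::'a) \<in> Basis"
    have "dist u v \<le> 2 * r" using uv dist_triangle2[of u v x] by (simp add: dist_commute)
    then show "\<bar>u \<bullet> i - v \<bullet> i\<bar> \<le> real 2 / 2 ^ k"
      using coord_diff_le_dist[OF uv(3), of u v] k by simp
  qed
  then have fin: "finite (cell k ` cball x r)" and c: "card (cell k ` cball x r) \<le> 5 ^ DIM('a)"
    by auto
  have c': "real (card (cell k ` cball x r)) \<le> 5 ^ DIM('a)"
    using c by (metis of_nat_le_iff of_nat_numeral of_nat_power)
  have "sum \<nu> (Y \<inter> cball x r) \<le> 5 ^ DIM('a) * 2 powr (- t * real k)"
    by (rule frostman_card_le[OF fr kN fin c'])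
  also have "\<dots> \<le> 5 ^ DIM('a) * (2 * r) powr t"
    unfolding dyadic_powr using k t by (intro mult_left_mono powr_mono2) auto
  also have "\<dots> = 5 ^ DIM('a) * 2 powr t * r powr t" using r0 by (simp add: powr_mult)
  also have "Y \<inter> cball x r = {y \<in> Y. dist x y \<le> r}" by auto
  finally show ?thesis .
qed

subsection \<open>Energies\<close>

text \<open>Layer-cake summation over dyadic shells of \<open>g\<close>: the \<open>j\<close>-th
  shell contributes at most \<open>2 powr (s * Suc j)\<close> times the mass
  \<open>C * 2 powr (- \<kappa> * j)\<close>, a geometric series of ratio
  \<open>2 powr (s - \<kappa>) < 1\<close>. The shift by \<open>\<delta>\<close> cuts the series off
  where the mass bound ceases to hold.\<close>

lemma layer_sum_le:
  fixes g :: "'a \<Rightarrow> real"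
  assumes s: "0 < s" "s < \<kappa>" and C: "0 \<le> C" and \<delta>: "0 < \<delta>" "\<delta> \<le> 1"
    and Y: "finite Y" "\<And>y. 0 \<le> \<nu> y" "\<And>y. y \<in> Y \<Longrightarrow> 0 \<le> g y"
    and tot: "sum \<nu> Y \<le> C"
    and lev: "\<And>r. \<delta> \<le> r \<Longrightarrow> r \<le> 1 \<Longrightarrow> sum \<nu> {y \<in> Y. g y \<le> r} \<le> C * r powr \<kappa>"
  shows "(\<Sum>y\<in>Y. \<nu> y * (g y + \<delta>) powr (- s)) \<le> C * (1 + 2 powr s / (1 - 2 powr (s - \<kappa>)))"
proof -
  obtain J where J: "\<delta> \<le> 1 / 2 ^ J" "1 / 2 ^ J < 2 * \<delta>" using ex_dyadic_level[OF \<delta>] by blast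
  let ?q = "2 powr (s - \<kappa>)"
  have pt: "(g y + \<delta>) powr (- s) \<le> 1 + (\<Sum>j\<le>J. 2 powr (s * real (Suc j)) * of_bool (g y \<le> 1 / 2 ^ j))"
    if y: "y \<in> Y" for y
  proof -
    let ?S = "\<Sum>j\<le>J. 2 powr (s * real (Suc j)) * of_bool (g y \<le> 1 / 2 ^ j)"
    have S0: "0 \<le> ?S" by (intro sum_nonneg) auto
    show ?thesis
    proof (cases "g y \<le> 1")
      case False
      then have "(g y + \<delta>) powr (- s) \<le> 1 powr (- s)"
        using s \<delta> by (intro powr_mono2') auto
      then show ?thesis using S0 by simp
    next
      case True
      \<comment> \<open>The finest level \<open>j \<le> J\<close> with
        \<open>g y \<le> 1 / 2 ^ j\<close> bounds \<open>g y + \<delta>\<close> below: by failure at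
        \<open>Suc j\<close> if \<open>j < J\<close>, and by \<open>1 / 2 ^ J < 2 * \<delta>\<close>
        if \<open>j = J\<close>.\<close>
      define M where "M = {j. j \<le> J \<and> g y \<le> 1 / 2 ^ j}"
      have M: "finite M" "M \<noteq> {}" using True by (auto simp: M_def intro: exI[of _ 0])
      define j where "j = Max M"
      have j: "j \<le> J" "g y \<le> 1 / 2 ^ j" using Max_in[OF M] by (auto simp: j_def M_def)
      have lower: "1 / 2 ^ Suc j \<le> g y + \<delta>"
      proof (cases "j = J")
        case True
        then show ?thesis using J Y(3)[OF y] by simp
      next
        case False
        then have "Suc j \<notin> M" using Max_ge[OF M(1), of "Suc j"] by (auto simp: j_def)
        then show ?thesis using False j \<delta> by (auto simp: M_def)
      qed
      have "(g y + \<delta>) powr (- s) \<le> (1 / 2 ^ Suc j) powr (- s)"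
        using s lower by (intro powr_mono2') auto
      also have "\<dots> = 2 powr (s * real (Suc j))" using dyadic_powr[of "- s" "Suc j"] by simp
      also have "\<dots> = 2 powr (s * real (Suc j)) * of_bool (g y \<le> 1 / 2 ^ j)" using j by simp
      also have "\<dots> \<le> ?S" using j by (intro member_le_sum) auto
      finally show ?thesis by simp
    qed
  qed
  have q: "0 < ?q" "?q < 1"
  proof -
    have "?q < 2 powr 0" using s by (intro powr_less_mono) auto
    then show "?q < 1" by simp
  qed simp
  have "(\<Sum>y\<in>Y. \<nu> y * (g y + \<delta>) powr (- s))
      \<le> (\<Sum>y\<in>Y. \<nu> y * (1 + (\<Sum>j\<le>J. 2 powr (s * real (Suc j)) * of_bool (g y \<le> 1 / 2 ^ j))))"
    using pt Y by (intro sum_mono mult_left_mono) auto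
  also have "\<dots> = sum \<nu> Y + (\<Sum>y\<in>Y. \<Sum>j\<le>J. 2 powr (s * real (Suc j)) * (\<nu> y * of_bool (g y \<le> 1 / 2 ^ j)))"
    by (simp add: distrib_left sum.distrib sum_distrib_left mult.left_commute del: sum_mult_of_bool_eq)
  also have "(\<Sum>y\<in>Y. \<Sum>j\<le>J. 2 powr (s * real (Suc j)) * (\<nu> y * of_bool (g y \<le> 1 / 2 ^ j)))
      = (\<Sum>j\<le>J. 2 powr (s * real (Suc j)) * sum \<nu> {y \<in> Y. g y \<le> 1 / 2 ^ j})"
  proof (subst sum.swap, rule sum.cong[OF refl])
    fix j
    have "(\<Sum>y\<in>Y. \<nu> y * of_bool (g y \<le> 1 / 2 ^ j)) = sum \<nu> {y \<in> Y. g y \<le> 1 / 2 ^ j}"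
      using Y(1) by (simp add: Int_def)
    then show "(\<Sum>y\<in>Y. 2 powr (s * real (Suc j)) * (\<nu> y * of_bool (g y \<le> 1 / 2 ^ j)))
        = 2 powr (s * real (Suc j)) * sum \<nu> {y \<in> Y. g y \<le> 1 / 2 ^ j}"
      by (simp only: sum_distrib_left[symmetric])
  qed
  also have "\<dots> \<le> (\<Sum>j\<le>J. C * 2 powr s * ?q ^ j)"
  proof (rule sum_mono)
    fix j assume "j \<in> {..J}"
    then have "\<delta> \<le> 1 / 2 ^ j" using J by (auto intro!: order_trans[OF J(1)] divide_left_mono)
    then have "sum \<nu> {y \<in> Y. g y \<le> 1 / 2 ^ j} \<le> C * (1 / 2 ^ j) powr \<kappa>" by (intro lev) auto
    then have "2 powr (s * real (Suc j)) * sum \<nu> {y \<in> Y. g y \<le> 1 / 2 ^ j}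
        \<le> 2 powr (s * real (Suc j)) * (C * 2 powr (- \<kappa> * real j))"
      unfolding dyadic_powr by (intro mult_left_mono) auto
    also have "\<dots> = C * 2 powr s * ?q ^ j"
      by (simp add: powr_realpow[symmetric] powr_powr powr_add[symmetric] algebra_simps)
    finally show "2 powr (s * real (Suc j)) * sum \<nu> {y \<in> Y. g y \<le> 1 / 2 ^ j} \<le> C * 2 powr s * ?q ^ j" .
  qed
  also have "\<dots> = C * 2 powr s * (\<Sum>j\<le>J. ?q ^ j)" by (simp add: sum_distrib_left)
  also have "\<dots> \<le> C * 2 powr s * (1 / (1 - ?q))"
  proof (intro mult_left_mono)
    have "(\<Sum>j\<le>J. ?q ^ j) \<le> (\<Sum>j. ?q ^ j)" using q by (intro sum_le_suminf summable_geometric) auto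
    then show "(\<Sum>j\<le>J. ?q ^ j) \<le> 1 / (1 - ?q)" using q suminf_geometric[of ?q] by simp
  qed (use C in auto)
  finally show ?thesis using tot by (simp add: algebra_simps)
qed

lemma frostman_potential_le:
  fixes x :: "'a::euclidean_space"
  assumes fr: "frostman t N X \<mu>" and s: "0 < s" "s < t" and tot: "sum \<mu> X \<le> 1"
  shows "(\<Sum>y\<in>X. \<mu> y * (dist x y + 1 / 2 ^ N) powr (- s))
    \<le> 5 ^ DIM('a) * 2 powr t * (1 + 2 powr s / (1 - 2 powr (s - t)))"
proof (rule layer_sum_le[OF s])
  have "1 * 1 \<le> (5::real) ^ DIM('a) * 2 powr t" using s by (intro mult_mono ge_one_powr_ge_zero) auto
  then show "sum \<mu> X \<le> 5 ^ DIM('a) * 2 powr t" using tot by simp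
  show "sum \<mu> {y \<in> X. dist x y \<le> r} \<le> 5 ^ DIM('a) * 2 powr t * r powr t"
    if "1 / 2 ^ N \<le> r" "r \<le> 1" for r
    using that s by (intro frostman_ball_le[OF fr]) auto
qed (use fr in \<open>auto simp: frostman_def\<close>)

text \<open>Mass concentrated on a set of small content has large energy. Each point is assigned to
  one fattened cell containing its image, only pairs assigned to the same cell are kept, and
  Cauchy-Schwarz is applied over the cells.\<close>

lemma energy_lower_bound:
  fixes p :: "'a \<Rightarrow> real"
  assumes X: "finite X" "\<And>x. 0 \<le> \<mu> x" and s: "0 < s"
    and U: "finite U" "U \<subseteq> cells" "\<And>q. q \<in> U \<Longrightarrow> fst q \<le> N"
    and cov: "p ` X \<subseteq> (\<Union>(k, Q)\<in>U. fat k Q)"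
    and \<eta>: "(\<Sum>q\<in>U. 2 powr (- s * real (fst q))) \<le> \<eta>"
  shows "(sum \<mu> X)\<^sup>2 \<le> 4 powr s * \<eta> * (\<Sum>x\<in>X. \<Sum>y\<in>X. \<mu> x * \<mu> y * (\<bar>p x - p y\<bar> + 1 / 2 ^ N) powr (- s))"
proof -
  have "\<forall>x\<in>X. \<exists>q\<in>U. p x \<in> fat (fst q) (snd q)" using cov unfolding case_prod_unfold by blast
  then obtain h where h: "\<And>x. x \<in> X \<Longrightarrow> h x \<in> U" "\<And>x. x \<in> X \<Longrightarrow> p x \<in> fat (fst (h x)) (snd (h x))"
    by metis
  define F where "F = (\<lambda>q. {x \<in> X. h x = q})"
  have finF: "finite (F q)" for q using X by (simp add: F_def)
  define w where "w = (\<lambda>q :: nat \<times> real set. 2 powr (- s * real (fst q)))"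
  define E where "E = (\<lambda>x y. \<mu> x * \<mu> y * (\<bar>p x - p y\<bar> + 1 / 2 ^ N) powr (- s))"
  have E0: "0 \<le> E x y" for x y using X by (simp add: E_def)
  have wpos: "w q > 0" for q by (simp add: w_def)
  have XF: "(\<Sum>x\<in>X. G x) = (\<Sum>q\<in>U. \<Sum>x\<in>F q. G x)" for G :: "'a \<Rightarrow> real"
    unfolding F_def using X(1) U(1) h(1) by (intro sum.group[symmetric]) auto
  have loc: "(sum \<mu> (F q))\<^sup>2 / w q \<le> 4 powr s * (\<Sum>x\<in>F q. \<Sum>y\<in>F q. E x y)" if q: "q \<in> U" for q
  proof -
    have "\<mu> x * \<mu> y / w q \<le> 4 powr s * E x y" if xy: "x \<in> F q" "y \<in> F q" for x y
    proof -
      have "(fst q, snd q) \<in> cells" using q U(2) by auto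
      then have "\<bar>p x \<bullet> 1 - p y \<bullet> 1\<bar> \<le> 3 / 2 ^ fst q"
        using xy h(2)[of x] h(2)[of y] by (intro fat_coord[of _ "snd q"]) (auto simp: F_def)
      moreover have "1 / 2 ^ N \<le> (1::real) / 2 ^ fst q"
        using U(3)[OF q] by (intro divide_left_mono power_increasing) auto
      \<comment> \<open>Two points of a fattened cell differ by at most three cell sides, and
        \<open>fst q \<le> N\<close> makes the shift at most one more; hence the factor
        four.\<close>
      ultimately have le: "\<bar>p x - p y\<bar> + 1 / 2 ^ N \<le> 4 * (1 / 2 ^ fst q)" by simp
      have "(4 * (1 / 2 ^ fst q)) powr (- s) \<le> (\<bar>p x - p y\<bar> + 1 / 2 ^ N) powr (- s)"
        using s le by (intro powr_mono2') (auto intro: add_nonneg_pos)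
      moreover have "(4 * (1 / 2 ^ fst q)) powr (- s) = 4 powr (- s) * (1 / w q)"
      proof -
        have "(1 / 2 ^ fst q :: real) powr (- s) = 1 / w q"
          unfolding w_def dyadic_powr by (simp add: powr_minus_divide)
        then show ?thesis by (subst powr_mult) auto
      qed
      ultimately have "4 powr (- s) * (1 / w q) \<le> (\<bar>p x - p y\<bar> + 1 / 2 ^ N) powr (- s)" by simp
      then have "4 powr s * (\<mu> x * \<mu> y) * (4 powr (- s) * (1 / w q))
          \<le> 4 powr s * (\<mu> x * \<mu> y) * (\<bar>p x - p y\<bar> + 1 / 2 ^ N) powr (- s)"
        using X by (intro mult_left_mono) auto
      moreover have "4 powr s * (\<mu> x * \<mu> y) * (4 powr (- s) * (1 / w q))
          = (4 powr s * 4 powr (- s)) * (\<mu> x * \<mu> y / w q)" by simp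
      moreover have "4 powr s * 4 powr (- s) = (1::real)" by (simp add: powr_add[symmetric])
      ultimately have "\<mu> x * \<mu> y / w q
          \<le> 4 powr s * (\<mu> x * \<mu> y) * (\<bar>p x - p y\<bar> + 1 / 2 ^ N) powr (- s)"
        by (metis mult_1)
      then show ?thesis unfolding E_def by (simp only: mult.assoc)
    qed
    then have "(\<Sum>x\<in>F q. \<Sum>y\<in>F q. \<mu> x * \<mu> y / w q) \<le> (\<Sum>x\<in>F q. \<Sum>y\<in>F q. 4 powr s * E x y)"
      by (intro sum_mono)
    moreover have "(\<Sum>x\<in>F q. \<Sum>y\<in>F q. \<mu> x * \<mu> y / w q) = (sum \<mu> (F q))\<^sup>2 / w q"
      by (simp add: power2_eq_square sum_product sum_divide_distrib)
    ultimately show ?thesis by (simp add: sum_distrib_left)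
  qed
  \<comment> \<open>Splitting off \<open>sqrt (w q)\<close> turns the second Cauchy-Schwarz factor
    into the total weight of the cover.\<close>
  have "(sum \<mu> X)\<^sup>2 = (\<Sum>q\<in>U. (sum \<mu> (F q) / sqrt (w q)) * sqrt (w q))\<^sup>2"
    using XF[of \<mu>] wpos by (simp add: less_imp_neq[symmetric])
  also have "\<dots> \<le> (\<Sum>q\<in>U. (sum \<mu> (F q) / sqrt (w q))\<^sup>2) * (\<Sum>q\<in>U. (sqrt (w q))\<^sup>2)"
    by (rule Cauchy_Schwarz_ineq_sum)
  also have "\<dots> = (\<Sum>q\<in>U. (sum \<mu> (F q))\<^sup>2 / w q) * (\<Sum>q\<in>U. w q)"
    using wpos by (simp add: power_divide less_imp_le)
  also have "\<dots> \<le> (\<Sum>q\<in>U. 4 powr s * (\<Sum>x\<in>F q. \<Sum>y\<in>F q. E x y)) * \<eta>"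
    using \<eta> by (intro mult_mono sum_mono loc sum_nonneg mult_nonneg_nonneg E0) (simp_all add: w_def)
  also have "\<dots> \<le> (4 powr s * (\<Sum>x\<in>X. \<Sum>y\<in>X. E x y)) * \<eta>"
  proof (rule mult_right_mono)
    have "(\<Sum>q\<in>U. \<Sum>x\<in>F q. \<Sum>y\<in>F q. E x y) \<le> (\<Sum>q\<in>U. \<Sum>x\<in>F q. \<Sum>y\<in>X. E x y)"
      using X(1) E0 by (intro sum_mono sum_mono2) (auto simp: F_def)
    also have "\<dots> = (\<Sum>x\<in>X. \<Sum>y\<in>X. E x y)" by (rule XF[symmetric])
    finally show "(\<Sum>q\<in>U. 4 powr s * (\<Sum>x\<in>F q. \<Sum>y\<in>F q. E x y)) \<le> 4 powr s * (\<Sum>x\<in>X. \<Sum>y\<in>X. E x y)"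
      by (simp add: sum_distrib_left[symmetric])
    have "0 \<le> (\<Sum>q\<in>U. w q)" using wpos by (intro sum_nonneg) (simp add: less_imp_le)
    then show "0 \<le> \<eta>" using \<eta> unfolding w_def by linarith
  qed
  finally show ?thesis unfolding E_def by (simp add: mult_ac)
qed

subsection \<open>Sublevel sets\<close>

lemma mvt_segment:
  fixes f :: "'b::euclidean_space \<Rightarrow> real"
  assumes "\<And>x. x \<in> closed_segment u v \<Longrightarrow> (f has_derivative f' x) (at x)"
  shows "\<exists>x\<in>closed_segment u v. f v - f u = f' x (v - u)"
proof -
  define h where "h = (\<lambda>t::real. u + t *\<^sub>R (v - u))"
  have hseg: "h t \<in> closed_segment u v" if "0 \<le> t" "t \<le> 1" for t
    unfolding closed_segment_def h_def using that
    by (intro CollectI exI[of _ t]) (auto simp: algebra_simps)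
  have "\<exists>t\<in>{0..1}. (f \<circ> h) 1 - (f \<circ> h) 0 = (f' (h t) \<circ> (\<lambda>a. a *\<^sub>R (v - u))) (1 - 0)"
  proof (rule mvt_very_simple)
    fix t :: real assume t: "0 \<le> t" "t \<le> 1"
    have "(h has_derivative (\<lambda>a. a *\<^sub>R (v - u))) (at t within {0..1})"
      unfolding h_def by (auto intro!: derivative_eq_intros)
    moreover have "(f has_derivative f' (h t)) (at (h t) within h ` {0..1})"
      using assms[OF hseg[OF t]] by (rule has_derivative_at_withinI)
    ultimately show "(f \<circ> h has_derivative f' (h t) \<circ> (\<lambda>a. a *\<^sub>R (v - u))) (at t within {0..1})"
      by (rule diff_chain_within)
  qed simp
  then show ?thesis using hseg by (auto simp: h_def)
qed

lemma convex_mvt: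
  fixes f :: "'b::euclidean_space \<Rightarrow> real"
  assumes "convex B" "\<And>x. x \<in> B \<Longrightarrow> (f has_derivative f' x) (at x)" "u \<in> B" "v \<in> B"
  shows "\<exists>x\<in>B. f v - f u = f' x (v - u)"
  using mvt_segment[of u v f f'] closed_segment_subset[OF assms(3,4,1)] assms(2) by blast

text \<open>In direction \<open>b\<close> the function changes at rate at least \<open>m\<close>, so
  two points of the slab in one column are within \<open>2 + DIM('b) * \<Gamma>\<close> cell sides:
  the \<open>2\<close> pays for the thickness of the slab, the rest for sideways motion of up to one
  cell side per coordinate.\<close>

lemma card_cells_slab_le:
  fixes f :: "'b::euclidean_space \<Rightarrow> real"
  assumes B: "convex B" and f: "\<And>u. u \<in> B \<Longrightarrow> (f has_derivative (\<lambda>a. g u \<bullet> a)) (at u)"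
    and b: "b \<in> Basis" and m: "0 < m" "\<And>u. u \<in> B \<Longrightarrow> m \<le> \<bar>g u \<bullet> b\<bar>"
    and \<Gamma>: "\<And>u i. u \<in> B \<Longrightarrow> i \<in> Basis \<Longrightarrow> \<bar>g u \<bullet> i\<bar> \<le> real \<Gamma> * m"
    and box: "\<And>u v i. u \<in> B \<Longrightarrow> v \<in> B \<Longrightarrow> i \<in> Basis \<Longrightarrow> \<bar>u \<bullet> i - v \<bullet> i\<bar> \<le> real L / 2 ^ k"
  shows "finite (cell k ` {u \<in> B. \<bar>f u\<bar> \<le> m / 2 ^ k}) \<and>
    card (cell k ` {u \<in> B. \<bar>f u\<bar> \<le> m / 2 ^ k})
      \<le> (2 * L + 1) ^ (DIM('b) - 1) * (2 * (2 + DIM('b) * \<Gamma>) + 1)"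
proof (rule card_cells_column_le[OF b])
  fix u v
  assume u: "u \<in> {u \<in> B. \<bar>f u\<bar> \<le> m / 2 ^ k}" and v: "v \<in> {u \<in> B. \<bar>f u\<bar> \<le> m / 2 ^ k}"
    and off: "\<And>i. i \<in> Basis - {b} \<Longrightarrow> \<bar>u \<bullet> i - v \<bullet> i\<bar> \<le> 1 / 2 ^ k"
  obtain x where x: "x \<in> B" "f u - f v = g x \<bullet> (u - v)"
    using convex_mvt[OF B f, where u = v and v = u] u v by auto
  have "g x \<bullet> (u - v) = (\<Sum>i\<in>Basis. (g x \<bullet> i) * ((u - v) \<bullet> i))" by (rule euclidean_inner)
  also have "\<dots> = (g x \<bullet> b) * ((u - v) \<bullet> b) + (\<Sum>i\<in>Basis - {b}. (g x \<bullet> i) * ((u - v) \<bullet> i))"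
    using b by (simp add: sum.remove)
  finally have "\<bar>(g x \<bullet> b) * ((u - v) \<bullet> b)\<bar>
      \<le> \<bar>f u - f v\<bar> + \<bar>\<Sum>i\<in>Basis - {b}. (g x \<bullet> i) * ((u - v) \<bullet> i)\<bar>" using x(2) by linarith
  moreover have "\<bar>f u - f v\<bar> \<le> 2 * (m / 2 ^ k)" using u v by auto
  moreover have "\<bar>\<Sum>i\<in>Basis - {b}. (g x \<bullet> i) * ((u - v) \<bullet> i)\<bar>
      \<le> real DIM('b) * (real \<Gamma> * m * (1 / 2 ^ k))"
  proof -
    have "\<bar>\<Sum>i\<in>Basis - {b}. (g x \<bullet> i) * ((u - v) \<bullet> i)\<bar>
        \<le> (\<Sum>i\<in>Basis - {b}. \<bar>(g x \<bullet> i) * ((u - v) \<bullet> i)\<bar>)" by (rule sum_abs)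
    also have "\<dots> \<le> (\<Sum>i\<in>Basis - {b}. real \<Gamma> * m * (1 / 2 ^ k))"
    proof (rule sum_mono)
      fix i assume i: "i \<in> Basis - {b}"
      show "\<bar>(g x \<bullet> i) * ((u - v) \<bullet> i)\<bar> \<le> real \<Gamma> * m * (1 / 2 ^ k)"
        unfolding abs_mult inner_diff_left using \<Gamma>[OF x(1)] off[OF i] i m(1)
        by (intro mult_mono) auto
    qed
    also have "\<dots> = real (card (Basis - {b})) * (real \<Gamma> * m * (1 / 2 ^ k))" by simp
    also have "\<dots> \<le> real DIM('b) * (real \<Gamma> * m * (1 / 2 ^ k))"
      using m(1) by (intro mult_right_mono) (auto intro: card_mono)
    finally show ?thesis .
  qed
  ultimately have "\<bar>(g x \<bullet> b) * ((u - v) \<bullet> b)\<bar>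
      \<le> 2 * (m / 2 ^ k) + real DIM('b) * (real \<Gamma> * m * (1 / 2 ^ k))" by linarith
  also have "\<dots> = m * ((2 + real DIM('b) * real \<Gamma>) / 2 ^ k)" by (simp add: field_simps)
  finally have "\<bar>(g x \<bullet> b) * ((u - v) \<bullet> b)\<bar> \<le> m * ((2 + real DIM('b) * real \<Gamma>) / 2 ^ k)" .
  moreover have "m * \<bar>(u - v) \<bullet> b\<bar> \<le> \<bar>(g x \<bullet> b) * ((u - v) \<bullet> b)\<bar>"
    unfolding abs_mult using m(2)[OF x(1)] by (intro mult_right_mono) auto
  ultimately have "m * \<bar>(u - v) \<bullet> b\<bar> \<le> m * ((2 + real DIM('b) * real \<Gamma>) / 2 ^ k)" by linarith
  then have "\<bar>(u - v) \<bullet> b\<bar> \<le> (2 + real DIM('b) * real \<Gamma>) / 2 ^ k"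
    using m(1) by (rule mult_left_le_imp_le)
  then show "\<bar>u \<bullet> b - v \<bullet> b\<bar> \<le> real (2 + DIM('b) * \<Gamma>) / 2 ^ k" by (simp add: inner_diff_left)
qed (use box in auto)

text \<open>The slab has thickness of order \<open>r / m\<close> and meets about
  \<open>(\<Lambda> * 2 ^ k) ^ (DIM('b) - 1)\<close> cells of comparable side
  \<open>1 / 2 ^ k\<close>. The integer part of the Frostman exponent cancels the powers of
  \<open>2 ^ k\<close>, and \<open>\<kappa>\<close> is left for the thickness. The power of
  \<open>\<Lambda>\<close> is kept because it makes the sum over shrinking shells converge.\<close>

lemma frostman_slab_le:
  fixes f :: "'b::euclidean_space \<Rightarrow> real" and \<Lambda> :: real
  assumes fr: "frostman (real (DIM('b) - 1) + \<kappa>) N Y \<nu>" and \<kappa>: "0 < \<kappa>"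
    and B: "convex B" and f: "\<And>u. u \<in> B \<Longrightarrow> (f has_derivative (\<lambda>a. g u \<bullet> a)) (at u)"
    and b: "b \<in> Basis" and m: "0 < m" "m \<le> 1" "\<And>u. u \<in> B \<Longrightarrow> m \<le> \<bar>g u \<bullet> b\<bar>"
    and \<Gamma>: "\<And>u i. u \<in> B \<Longrightarrow> i \<in> Basis \<Longrightarrow> \<bar>g u \<bullet> i\<bar> \<le> real \<Gamma> * m"
    and box: "\<And>u v i. u \<in> B \<Longrightarrow> v \<in> B \<Longrightarrow> i \<in> Basis \<Longrightarrow> \<bar>u \<bullet> i - v \<bullet> i\<bar> \<le> \<Lambda>"
    and r: "1 / 2 ^ N \<le> r" "2 * r \<le> m * \<Lambda>" and \<Lambda>: "\<Lambda> \<le> 1"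
  shows "sum \<nu> (Y \<inter> {u \<in> B. \<bar>f u\<bar> \<le> r})
    \<le> 5 ^ (DIM('b) - 1) * real (2 * (2 + DIM('b) * \<Gamma>) + 1) * \<Lambda> ^ (DIM('b) - 1) * (2 * r / m) powr \<kappa>"
proof -
  let ?d = "DIM('b) - 1"
  have r0: "0 < r" using r by (auto intro: less_le_trans[rotated])
  have \<Lambda>0: "0 < \<Lambda>" using r(2) r0 m(1) mult_nonneg_nonpos[of m \<Lambda>] by linarith
  have "m * \<Lambda> \<le> m * 1" using m \<Lambda> by (intro mult_left_mono) auto
  then have rm: "0 < r / m" "r / m \<le> 1"
  proof -
    have "r \<le> m" using \<open>m * \<Lambda> \<le> m * 1\<close> r(2) r0 by linarith
    then show "0 < r / m" "r / m \<le> 1" using r0 m(1) by auto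
  qed
  obtain k where k: "r / m \<le> 1 / 2 ^ k" "1 / 2 ^ k < 2 * (r / m)" using ex_dyadic_level[OF rm] by blast
  \<comment> \<open>As \<open>m \<le> 1\<close>, the scale \<open>r / m\<close> is no finer than
    \<open>r\<close>, so \<open>k\<close> stays in the range \<open>k \<le> N\<close> of the growth
    condition.\<close>
  have "r \<le> r / m" using m r0 by (simp add: field_simps)
  then have "(1::real) / 2 ^ N \<le> 1 / 2 ^ k" using r k by linarith
  then have "(2::real) ^ k \<le> 2 ^ N" by (simp add: field_simps)
  then have kN: "k \<le> N" by simp
  have "2 * (r / m) \<le> \<Lambda>" using r(2) m by (simp add: field_simps)
  then have k\<Lambda>: "1 / 2 ^ k \<le> \<Lambda>" using k by linarith
  then have \<Lambda>k: "1 \<le> \<Lambda> * 2 ^ k" by (simp add: field_simps)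
  define L where "L = nat \<lceil>\<Lambda> * 2 ^ k\<rceil>"
  have L: "\<Lambda> * 2 ^ k \<le> real L" "real L \<le> 2 * (\<Lambda> * 2 ^ k)"
    using \<Lambda>k unfolding L_def by linarith+
  have "\<Lambda> \<le> real L / 2 ^ k" using L by (simp add: field_simps)
  then have box': "\<And>u v i. u \<in> B \<Longrightarrow> v \<in> B \<Longrightarrow> i \<in> Basis \<Longrightarrow> \<bar>u \<bullet> i - v \<bullet> i\<bar> \<le> real L / 2 ^ k"
    using box order_trans by blast
  let ?S = "{u \<in> B. \<bar>f u\<bar> \<le> m / 2 ^ k}"
  let ?H = "2 * (2 + DIM('b) * \<Gamma>) + 1"
  have fin: "finite (cell k ` ?S)" and c: "card (cell k ` ?S) \<le> (2 * L + 1) ^ ?d * ?H"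
    using card_cells_slab_le[OF B f b m(1,3) \<Gamma> box'] by auto
  have "real (card (cell k ` ?S)) \<le> real ((2 * L + 1) ^ ?d * ?H)" using c by (rule of_nat_mono)
  also have "\<dots> = (2 * real L + 1) ^ ?d * real ?H" by (simp only: of_nat_mult of_nat_power of_nat_add of_nat_numeral of_nat_1)
  also have "\<dots> \<le> (5 * (\<Lambda> * 2 ^ k)) ^ ?d * real ?H"
    using L \<Lambda>k by (intro mult_right_mono power_mono) auto
  finally have c': "real (card (cell k ` ?S)) \<le> (5 * (\<Lambda> * 2 ^ k)) ^ ?d * real ?H" .
  have "r \<le> m / 2 ^ k" using k m by (simp add: field_simps)
  then have "sum \<nu> (Y \<inter> {u \<in> B. \<bar>f u\<bar> \<le> r}) \<le> sum \<nu> (Y \<inter> ?S)"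
    using fr by (intro sum_mono2) (auto simp: frostman_def)
  also have "\<dots> \<le> (5 * (\<Lambda> * 2 ^ k)) ^ ?d * real ?H * 2 powr (- (real ?d + \<kappa>) * real k)"
    by (rule frostman_card_le[OF fr kN fin c'])
  also have "2 powr (- (real ?d + \<kappa>) * real k) = (1 / 2 ^ k) ^ ?d * (1 / 2 ^ k) powr \<kappa>"
    unfolding dyadic_powr powr_add by (subst powr_realpow) auto
  also have "(5 * (\<Lambda> * 2 ^ k)) ^ ?d * real ?H * ((1 / 2 ^ k) ^ ?d * (1 / 2 ^ k) powr \<kappa>)
      = 5 ^ ?d * real ?H * \<Lambda> ^ ?d * (1 / 2 ^ k) powr \<kappa>"
    by (simp add: power_mult_distrib power_divide)
  also have "\<dots> \<le> 5 ^ ?d * real ?H * \<Lambda> ^ ?d * (2 * r / m) powr \<kappa>"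
    using k \<Lambda>0 \<kappa> by (intro mult_left_mono powr_mono2) auto
  finally show ?thesis by simp
qed

lemma ge_one_coefficient: "1 \<le> (5::real) ^ n * real (2 * (2 + d * \<Gamma>) + 1)"
  using mult_mono[of 1 "(5::real) ^ n" 1 "real (2 * (2 + d * \<Gamma>) + 1)"] by simp

text \<open>The slab bound with \<open>m = c\<close> and \<open>\<Lambda> = 1\<close>; for
  \<open>r > c / 2\<close> the total mass is bound enough.\<close>

lemma frostman_transversal_le:
  fixes f :: "'b::euclidean_space \<Rightarrow> real"
  assumes fr: "frostman (real (DIM('b) - 1) + \<kappa>) N Y \<nu>" and \<kappa>: "0 < \<kappa>"
    and tot: "sum \<nu> Y \<le> 1" and Y: "Y \<subseteq> B"
    and B: "convex B" and f: "\<And>u. u \<in> B \<Longrightarrow> (f has_derivative (\<lambda>a. g u \<bullet> a)) (at u)"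
    and b: "b \<in> Basis" and c: "0 < c" "c \<le> 1" "\<And>u. u \<in> B \<Longrightarrow> c \<le> \<bar>g u \<bullet> b\<bar>"
    and \<Gamma>: "\<And>u i. u \<in> B \<Longrightarrow> i \<in> Basis \<Longrightarrow> \<bar>g u \<bullet> i\<bar> \<le> real \<Gamma> * c"
    and box: "\<And>u v i. u \<in> B \<Longrightarrow> v \<in> B \<Longrightarrow> i \<in> Basis \<Longrightarrow> \<bar>u \<bullet> i - v \<bullet> i\<bar> \<le> 1"
    and r: "1 / 2 ^ N \<le> r"
  shows "sum \<nu> {y \<in> Y. \<bar>f y\<bar> \<le> r}
    \<le> 5 ^ (DIM('b) - 1) * real (2 * (2 + DIM('b) * \<Gamma>) + 1) * (2 / c) powr \<kappa> * r powr \<kappa>"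
proof -
  let ?K = "5 ^ (DIM('b) - 1) * real (2 * (2 + DIM('b) * \<Gamma>) + 1)"
  have r0: "0 < r" using r by (auto intro: less_le_trans[rotated])
  have eq: "{y \<in> Y. \<bar>f y\<bar> \<le> r} = Y \<inter> {u \<in> B. \<bar>f u\<bar> \<le> r}" using Y by auto
  have pw: "(2 * r / c) powr \<kappa> = (2 / c) powr \<kappa> * r powr \<kappa>"
    using r0 c by (simp add: powr_mult[symmetric])
  have "sum \<nu> {y \<in> Y. \<bar>f y\<bar> \<le> r} \<le> ?K * (2 * r / c) powr \<kappa>"
  proof (cases "2 * r \<le> c")
    case True
    then show ?thesis
      using frostman_slab_le[OF fr \<kappa> B f b c \<Gamma> box r] unfolding eq by simp
  next
    case False
    have "sum \<nu> {y \<in> Y. \<bar>f y\<bar> \<le> r} \<le> sum \<nu> Y"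
      using fr by (intro sum_mono2) (auto simp: frostman_def)
    also have "\<dots> \<le> 1 * 1" using tot by simp
    also have "\<dots> \<le> ?K * (2 * r / c) powr \<kappa>"
      using False c \<kappa> by (intro mult_mono ge_one_coefficient ge_one_powr_ge_zero) auto
    finally show ?thesis .
  qed
  then show ?thesis unfolding pw by (simp add: mult.assoc)
qed

section \<open>Functions whose gradient map expands distances\<close>

lemma ex_large_coord:
  fixes v :: "'b::euclidean_space"
  shows "\<exists>b\<in>Basis. norm v \<le> real DIM('b) * \<bar>v \<bullet> b\<bar>"
proof (rule ccontr)
  assume "\<not> ?thesis"
  then have *: "\<And>b. b \<in> Basis \<Longrightarrow> real DIM('b) * \<bar>v \<bullet> b\<bar> < norm v" by auto
  have "real DIM('b) * norm v \<le> real DIM('b) * (\<Sum>b\<in>Basis. \<bar>v \<bullet> b\<bar>)"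
    by (intro mult_left_mono norm_le_l1) auto
  also have "\<dots> = (\<Sum>b\<in>Basis. real DIM('b) * \<bar>v \<bullet> b\<bar>)" by (simp add: sum_distrib_left)
  also have "\<dots> < (\<Sum>b\<in>(Basis::'b set). norm v)" using * by (intro sum_strict_mono) auto
  finally show False by simp
qed

text \<open>A function with expanding gradient is studied on the dyadic shells of its gradient: each
  shell is covered by boundedly many cells on which some partial derivative is comparable with
  the gradient, and the innermost set is contained in a ball of radius comparable to the square
  root of the level.\<close>

lemma frostman_expanding_gradient_le:
  fixes c \<kappa> :: real and G :: nat
  assumes c: "0 < c" "c \<le> 1" and \<kappa>: "0 < \<kappa>" "\<kappa> < 1" and G: "1 \<le> G" and d2: "2 \<le> DIM('b)"
  shows "\<exists>C\<ge>1. \<forall>(B :: 'b::euclidean_space set) f g Y \<nu> N r.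
    frostman (real (DIM('b) - 1) + \<kappa>) N Y \<nu> \<longrightarrow> sum \<nu> Y \<le> 1 \<longrightarrow> Y \<subseteq> B \<longrightarrow> convex B \<longrightarrow>
    (\<forall>u\<in>B. (f has_derivative (\<lambda>a. g u \<bullet> a)) (at u)) \<longrightarrow>
    (\<forall>u\<in>B. norm (g u) \<le> real G) \<longrightarrow>
    (\<forall>u\<in>B. \<forall>v\<in>B. c * dist u v \<le> dist (g u) (g v) \<and> dist (g u) (g v) \<le> real G * dist u v) \<longrightarrow>
    1 / 2 ^ N \<le> r \<longrightarrow> r \<le> 1 \<longrightarrow>
    sum \<nu> {y \<in> Y. \<bar>f y\<bar> \<le> r} \<le> C * r powr \<kappa>"
proof -
  let ?d = "real DIM('b)" and ?\<tau> = "real (DIM('b) - 1) + \<kappa>"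
  \<comment> \<open>On cells of level \<open>i + p\<close> the gradient varies by at most
    \<open>\<rho> / (4 * ?d)\<close>, with \<open>\<rho> = G / 2 ^ i\<close>. This is half of the
    size \<open>\<rho> / (2 * ?d)\<close> guaranteed for its largest coordinate at one point of the
    shell.\<close>
  obtain p where p: "4 * ?d\<^sup>2 < 2 ^ p" using real_arch_pow[of 2 "4 * ?d\<^sup>2"] by auto
  define \<Gamma> where "\<Gamma> = 8 * DIM('b) * G"
  define K1 where "K1 = 5 ^ (DIM('b) - 1) * real (2 * (2 + DIM('b) * \<Gamma>) + 1)"
  define L where "L = nat \<lceil>2 * real G * 2 ^ p / c\<rceil>"
  define K2 where "K2 = (2 * real L + 1) ^ DIM('b)"
  \<comment> \<open>For the \<open>i\<close>-th shell the factor
    \<open>(1 / 2 ^ k) ^ (DIM('b) - 1)\<close> gains at least \<open>1 / 2 ^ i\<close>, while the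
    small gradient loses \<open>(2 ^ i) powr \<kappa>\<close>; together they give
    \<open>q ^ i\<close>.\<close>
  define q where "q = 2 powr (\<kappa> - 1)"
  define K3 where "K3 = K2 * (K1 * (8 * ?d) powr \<kappa>)"
  define K4 where "K4 = 2 * real G / c * sqrt (8 * ?d * 2 ^ p)"
  define K5 where "K5 = 5 ^ DIM('b) * 2 powr ?\<tau> * K4 powr ?\<tau> + K4 powr (2 * \<kappa>)"
  define C where "C = K3 / (1 - q) + K5 + 1"
  have q: "0 < q" "q < 1"
  proof -
    have "q < 2 powr 0" unfolding q_def using \<kappa> by (intro powr_less_mono) auto
    then show "q < 1" by simp
  qed (simp add: q_def)
  have K10: "0 \<le> K1" by (simp add: K1_def)
  have K20: "0 \<le> K2" by (simp add: K2_def add.commute)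
  have K30: "0 \<le> K3" unfolding K3_def using K10 K20 by simp
  have K4: "1 \<le> K4"
  proof -
    have "1 * 1 \<le> (2 * real G / c) * sqrt (8 * ?d * 2 ^ p)"
    proof (rule mult_mono)
      show "1 \<le> 2 * real G / c" using G c by (simp add: field_simps)
      have "(1::real) * 1 \<le> (8 * ?d) * 2 ^ p" using d2 by (intro mult_mono) auto
      then show "1 \<le> sqrt (8 * ?d * 2 ^ p)" by simp
    qed (use c in auto)
    then show ?thesis by (simp add: K4_def)
  qed
  have K50: "0 \<le> K5" by (simp add: K5_def)
  have C1: "1 \<le> C" unfolding C_def using K30 K50 q by simp
  have "sum \<nu> {y \<in> Y. \<bar>f y\<bar> \<le> r} \<le> C * r powr \<kappa>"
    if fr: "frostman ?\<tau> N Y \<nu>" and tot: "sum \<nu> Y \<le> 1" and Y: "Y \<subseteq> B" and B: "convex B"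
      and f: "\<forall>u\<in>B. (f has_derivative (\<lambda>a. g u \<bullet> a)) (at u)"
      and gG: "\<forall>u\<in>B. norm (g u) \<le> real G"
      and ge: "\<forall>u\<in>B. \<forall>v\<in>B. c * dist u v \<le> dist (g u) (g v) \<and> dist (g u) (g v) \<le> real G * dist u v"
      and r: "1 / 2 ^ N \<le> r" "r \<le> 1"
    for B :: "'b set" and f g Y \<nu> N r
  proof -
    have Yfin: "finite Y" "\<And>y. 0 \<le> \<nu> y" using fr by (auto simp: frostman_def)
    have r0: "0 < r" using r(1) by (auto intro: less_le_trans[rotated])
    define S where "S = {y \<in> Y. \<bar>f y\<bar> \<le> r}"
    define P where "P = (\<lambda>i. {u \<in> B. real G / 2 ^ Suc i < norm (g u) \<and> norm (g u) \<le> real G / 2 ^ i})"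
    have dist_le: "dist u v \<le> 2 * real G / c / 2 ^ i"
      if "u \<in> B" "v \<in> B" "norm (g u) \<le> real G / 2 ^ i" "norm (g v) \<le> real G / 2 ^ i" for u v i
    proof -
      have "c * dist u v \<le> dist (g u) (g v)" using ge that by blast
      also have "\<dots> \<le> norm (g u) + norm (g v)" unfolding dist_norm by (rule norm_triangle_ineq4)
      also have "\<dots> \<le> 2 * (real G / 2 ^ i)" using that by simp
      finally show ?thesis using c by (simp add: field_simps)
    qed
    \<comment> \<open>Shells are peeled only while \<open>2 * r \<le> m / 2 ^ k\<close>, the width
      condition of the slab bound with \<open>\<Lambda> = 1 / 2 ^ k\<close>. Since \<open>m\<close>
      and \<open>1 / 2 ^ k\<close> are both of order \<open>1 / 2 ^ i\<close>, it amounts to an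
      upper bound for \<open>4 ^ i\<close>.\<close>
    define I where "I = (LEAST i. 1 / (8 * ?d * 2 ^ p * r) < 4 ^ i)"
    have exI: "\<exists>i. 1 / (8 * ?d * 2 ^ p * r) < 4 ^ i" using real_arch_pow[of 4] by auto
    have I: "1 / (8 * ?d * 2 ^ p * r) < 4 ^ I" unfolding I_def by (rule LeastI_ex[OF exI])
    have ltI: "4 ^ i \<le> 1 / (8 * ?d * 2 ^ p * r)" if "i < I" for i
      using not_less_Least[of i "\<lambda>i. 1 / (8 * ?d * 2 ^ p * r) < 4 ^ i"] that I_def by auto
    have shell: "sum \<nu> (S \<inter> P i) \<le> K3 * r powr \<kappa> * q ^ i" if i: "i < I" for i
    proof -
      define k where "k = i + p"
      define \<rho> where "\<rho> = real G / 2 ^ i"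
      define m where "m = 1 / (4 * ?d * 2 ^ i)"
      have m\<rho>: "m \<le> \<rho> / (4 * ?d)" "\<rho> = 4 * ?d * real G * m"
        using G by (auto simp: m_def \<rho>_def field_simps)
      have m0: "0 < m" "m \<le> 1"
      proof -
        have "1 * 1 \<le> (4 * ?d) * 2 ^ i" using d2 by (intro mult_mono) auto
        then show "m \<le> 1" "0 < m" by (auto simp: m_def field_simps)
      qed
      \<comment> \<open>Expansion turns the small gradient on \<open>P i\<close> into a small
        diameter of \<open>P i\<close>, so the number of cells is bounded independently of
        \<open>i\<close>.\<close>
      have finQ: "finite (cell k ` P i) \<and> card (cell k ` P i) \<le> (2 * L + 1) ^ DIM('b)"
      proof (rule card_cells_box_le)
        fix u v j assume uv: "u \<in> P i" "v \<in> P i" and j: "(j::'b) \<in> Basis"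
        have "\<bar>u \<bullet> j - v \<bullet> j\<bar> \<le> dist u v" using j by (rule coord_diff_le_dist)
        also have "\<dots> \<le> 2 * real G / c / 2 ^ i" using uv by (intro dist_le) (auto simp: P_def)
        also have "\<dots> = (2 * real G * 2 ^ p / c) / 2 ^ k" by (simp add: k_def power_add)
        also have "\<dots> \<le> real L / 2 ^ k" unfolding L_def by (intro divide_right_mono real_nat_ceiling_ge) simp
        finally show "\<bar>u \<bullet> j - v \<bullet> j\<bar> \<le> real L / 2 ^ k" .
      qed
      then have cQ: "real (card (cell k ` P i)) \<le> K2"
      proof -
        have "K2 = real ((2 * L + 1) ^ DIM('b))" by (simp add: K2_def add.commute)
        then show ?thesis using finQ by (simp only: of_nat_le_iff)
      qed
      have one: "sum \<nu> {y \<in> S \<inter> P i. cell k y = Q} \<le> K1 * (1 / 2 ^ k) ^ (DIM('b) - 1) * (2 * r / m) powr \<kappa>"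
        if Q: "Q \<in> cell k ` P i" for Q
      proof -
        obtain u1 where u1: "u1 \<in> P i" "Q = cell k u1" using Q by auto
        obtain b where b: "b \<in> Basis" "norm (g u1) \<le> ?d * \<bar>g u1 \<bullet> b\<bar>" using ex_large_coord by blast
        have gu1: "\<rho> / 2 \<le> norm (g u1)" "norm (g u1) \<le> \<rho>" "u1 \<in> B"
          using u1 by (auto simp: P_def \<rho>_def)
        have close: "dist (g u) (g u1) \<le> \<rho> / (4 * ?d)" if u: "u \<in> Q \<inter> B" for u
        proof -
          have "dist (g u) (g u1) \<le> real G * dist u u1" using ge u gu1 by blast
          also have "\<dots> \<le> real G * (?d / 2 ^ k)" using cell_dist[of u k u1] u u1(2) by (intro mult_left_mono) auto
          also have "\<dots> = \<rho> * (?d / 2 ^ p)" by (simp add: \<rho>_def k_def power_add)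
          also have "\<dots> \<le> \<rho> * (1 / (4 * ?d))"
          proof (rule mult_left_mono)
            show "?d / 2 ^ p \<le> 1 / (4 * ?d)" using p by (simp add: field_simps power2_eq_square)
          qed (simp add: \<rho>_def)
          finally show ?thesis by simp
        qed
        have "sum \<nu> (Y \<inter> {u \<in> Q \<inter> B. \<bar>f u\<bar> \<le> r})
          \<le> K1 * (1 / 2 ^ k) ^ (DIM('b) - 1) * (2 * r / m) powr \<kappa>"
          unfolding K1_def
        proof (rule frostman_slab_le[OF fr \<kappa>(1) _ _ b(1) m0])
          show "convex (Q \<inter> B)" unfolding u1(2) by (intro convex_Int convex_cell B)
          show "(f has_derivative (\<lambda>a. g u \<bullet> a)) (at u)" if "u \<in> Q \<inter> B" for u using f that by blast
          show "m \<le> \<bar>g u \<bullet> b\<bar>" if u: "u \<in> Q \<inter> B" for u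
          proof -
            have "\<bar>g u1 \<bullet> b - g u \<bullet> b\<bar> \<le> \<rho> / (4 * ?d)"
              using coord_diff_le_dist[OF b(1), of "g u1" "g u"] close[OF u] by (simp add: dist_commute)
            moreover have "\<rho> / 2 \<le> ?d * \<bar>g u1 \<bullet> b\<bar>" using gu1 b by linarith
            then have "2 * (\<rho> / (4 * ?d)) \<le> \<bar>g u1 \<bullet> b\<bar>" by (simp add: field_simps)
            ultimately show ?thesis using m\<rho>(1) by linarith
          qed
          show "\<bar>g u \<bullet> j\<bar> \<le> real \<Gamma> * m" if u: "u \<in> Q \<inter> B" and j: "j \<in> Basis" for u j
          proof -
            have "\<bar>g u \<bullet> j\<bar> \<le> norm (g u)" using j by (rule Basis_le_norm)
            also have "\<dots> \<le> norm (g u1) + dist (g u) (g u1)"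
              unfolding dist_norm by (metis norm_triangle_sub)
            also have "\<dots> \<le> \<rho> + \<rho> / (4 * ?d)" using gu1 close[OF u] by linarith
            also have "\<dots> \<le> \<rho> + \<rho>" using divide_left_mono[of 1 "4 * ?d" \<rho>] d2 by (simp add: \<rho>_def)
            also have "\<dots> = real \<Gamma> * m" unfolding m\<rho>(2) by (simp add: \<Gamma>_def)
            finally show ?thesis .
          qed
          show "\<bar>u \<bullet> j - v \<bullet> j\<bar> \<le> 1 / 2 ^ k" if "u \<in> Q \<inter> B" "v \<in> Q \<inter> B" "j \<in> Basis" for u v j
            using that unfolding u1(2) by (metis IntD1 cell_coord cell_eq)
          show "2 * r \<le> m * (1 / 2 ^ k)"
          proof -
            have "(4::real) ^ i = 2 ^ i * 2 ^ i" by (simp add: power_mult_distrib[symmetric])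
            then show ?thesis using ltI[OF i] r0 by (simp add: m_def k_def power_add field_simps)
          qed
        qed (use r in auto)
        moreover have "sum \<nu> {y \<in> S \<inter> P i. cell k y = Q} \<le> sum \<nu> (Y \<inter> {u \<in> Q \<inter> B. \<bar>f u\<bar> \<le> r})"
          using Yfin by (intro sum_mono2) (auto simp: S_def P_def)
        ultimately show ?thesis by linarith
      qed
      have "sum \<nu> (S \<inter> P i) = (\<Sum>Q\<in>cell k ` P i. sum \<nu> {y \<in> S \<inter> P i. cell k y = Q})"
        using finQ Yfin by (intro sum.group[symmetric]) (auto simp: S_def)
      also have "\<dots> \<le> (\<Sum>Q\<in>cell k ` P i. K1 * (1 / 2 ^ k) ^ (DIM('b) - 1) * (2 * r / m) powr \<kappa>)"
        by (intro sum_mono one)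
      also have "\<dots> \<le> K2 * (K1 * (1 / 2 ^ k) ^ (DIM('b) - 1) * (2 * r / m) powr \<kappa>)"
        using cQ K10 by (simp add: mult_right_mono)
      also have "\<dots> \<le> K2 * (K1 * (1 / 2 ^ i) * ((8 * ?d) powr \<kappa> * r powr \<kappa> * (2 ^ i) powr \<kappa>))"
      proof (intro mult_left_mono mult_mono K10 K20)
        have "(1 / 2 ^ k :: real) ^ (DIM('b) - 1) \<le> (1 / 2 ^ k) ^ 1"
          using d2 by (intro power_decreasing) auto
        also have "\<dots> \<le> 1 / 2 ^ i" by (simp add: k_def power_add field_simps)
        finally show "(1 / 2 ^ k :: real) ^ (DIM('b) - 1) \<le> 1 / 2 ^ i" .
        have "2 * r / m = (8 * ?d) * r * 2 ^ i" by (simp add: m_def)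
        then show "(2 * r / m) powr \<kappa> \<le> (8 * ?d) powr \<kappa> * r powr \<kappa> * (2 ^ i) powr \<kappa>"
          using r0 by (simp add: powr_mult)
      qed (use K10 in auto)
      also have "\<dots> = K3 * r powr \<kappa> * ((1 / 2 ^ i) * (2 ^ i) powr \<kappa>)" by (simp add: K3_def)
      also have "(1 / 2 ^ i) * (2 ^ i) powr \<kappa> = q ^ i"
      proof -
        have "(1 / 2 ^ i) * (2 ^ i) powr \<kappa> = 2 powr (- real i) * 2 powr (real i * \<kappa>)"
          by (simp add: powr_minus powr_realpow[symmetric] powr_powr field_simps)
        also have "\<dots> = 2 powr ((\<kappa> - 1) * real i)" by (simp add: powr_add[symmetric] algebra_simps)
        also have "\<dots> = q ^ i" by (simp add: q_def powr_realpow[symmetric] powr_powr)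
        finally show ?thesis .
      qed
      finally show ?thesis .
    qed
    define R where "R = {u \<in> S. norm (g u) \<le> real G / 2 ^ I}"
    have rest: "sum \<nu> R \<le> K5 * r powr \<kappa>"
    proof (cases "R = {}")
      case False
      then obtain y0 where y0: "y0 \<in> R" by auto
      have SB: "S \<subseteq> B" using Y by (auto simp: S_def)
      have "1 / 2 ^ I \<le> sqrt (8 * ?d * 2 ^ p * r)"
      proof (rule real_le_rsqrt)
        have "(4::real) ^ I = 2 ^ I * 2 ^ I" by (simp add: power_mult_distrib[symmetric])
        then show "(1 / 2 ^ I)\<^sup>2 \<le> 8 * ?d * 2 ^ p * r"
          using I r0 by (simp add: power2_eq_square field_simps)
      qed
      then have "2 * real G / c * (1 / 2 ^ I) \<le> 2 * real G / c * sqrt (8 * ?d * 2 ^ p * r)"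
        using c by (intro mult_left_mono) auto
      then have KI: "2 * real G / c / 2 ^ I \<le> K4 * sqrt r" by (simp add: K4_def real_sqrt_mult)
      have sub: "dist y0 y \<le> K4 * sqrt r" if "y \<in> R" for y
      proof -
        have "dist y0 y \<le> 2 * real G / c / 2 ^ I"
          using that y0 SB by (intro dist_le) (auto simp: R_def)
        then show ?thesis using KI by linarith
      qed
      have sr: "sqrt r powr (2 * \<kappa>) = r powr \<kappa>"
        using r0 by (simp add: powr_half_sqrt[symmetric] powr_powr)
      show ?thesis
      proof (cases "K4 * sqrt r \<le> 1")
        case True
        have "r \<le> sqrt r" using r r0 by (simp add: real_le_rsqrt power2_eq_square mult_left_le)
        also have "\<dots> = 1 * sqrt r" by simp
        also have "\<dots> \<le> K4 * sqrt r" using K4 r0 by (intro mult_right_mono) auto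
        finally have N: "1 / 2 ^ N \<le> K4 * sqrt r" using r by linarith
        have "sum \<nu> R \<le> sum \<nu> {y \<in> Y. dist y0 y \<le> K4 * sqrt r}"
          using Yfin sub by (intro sum_mono2) (auto simp: R_def S_def)
        also have "\<dots> \<le> 5 ^ DIM('b) * 2 powr ?\<tau> * (K4 * sqrt r) powr ?\<tau>"
          using \<kappa> N True by (intro frostman_ball_le[OF fr]) auto
        also have "\<dots> = 5 ^ DIM('b) * 2 powr ?\<tau> * K4 powr ?\<tau> * sqrt r powr ?\<tau>"
          using K4 r0 by (simp add: powr_mult)
        also have "\<dots> \<le> 5 ^ DIM('b) * 2 powr ?\<tau> * K4 powr ?\<tau> * sqrt r powr (2 * \<kappa>)"
        proof (intro mult_left_mono)
          \<comment> \<open>As \<open>DIM('b) \<ge> 2\<close> and \<open>\<kappa> < 1\<close>, the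
            exponent \<open>?\<tau>\<close> is at least \<open>1 + \<kappa>\<close>, hence above
            \<open>2 * \<kappa>\<close>, which offsets the square root in the radius.\<close>
          show "sqrt r powr ?\<tau> \<le> sqrt r powr (2 * \<kappa>)"
            using r r0 \<kappa> d2 by (intro powr_mono') auto
        qed auto
        also have "\<dots> \<le> K5 * r powr \<kappa>" unfolding sr K5_def by (intro mult_right_mono) auto
        finally show ?thesis .
      next
        case False
        have "sum \<nu> R \<le> sum \<nu> Y" using Yfin by (intro sum_mono2) (auto simp: R_def S_def)
        also have "\<dots> \<le> 1" by (rule tot)
        also have "\<dots> \<le> (K4 * sqrt r) powr (2 * \<kappa>)" using False \<kappa> by (intro ge_one_powr_ge_zero) auto
        also have "\<dots> = K4 powr (2 * \<kappa>) * r powr \<kappa>" using K4 r0 sr by (simp add: powr_mult)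
        also have "\<dots> \<le> K5 * r powr \<kappa>" unfolding K5_def by (intro mult_right_mono) auto
        finally show ?thesis .
      qed
    qed (use K50 in auto)
    have "S \<subseteq> R \<union> (\<Union>i<I. S \<inter> P i)"
    proof
      fix y assume y: "y \<in> S"
      then have yB: "y \<in> B" using Y by (auto simp: S_def)
      show "y \<in> R \<union> (\<Union>i<I. S \<inter> P i)"
      proof (cases "norm (g y) \<le> real G / 2 ^ I")
        case True
        then show ?thesis using y by (auto simp: R_def)
      next
        case False
        define j where "j = (LEAST j. \<not> norm (g y) \<le> real G / 2 ^ j)"
        have j: "\<not> norm (g y) \<le> real G / 2 ^ j" "j \<le> I"
          unfolding j_def
          by (rule LeastI[of "\<lambda>j. \<not> norm (g y) \<le> real G / 2 ^ j", OF False])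
             (rule Least_le[of "\<lambda>j. \<not> norm (g y) \<le> real G / 2 ^ j", OF False])
        have "j \<noteq> 0" using j(1) gG yB by (auto intro: ccontr)
        then obtain i where i: "j = Suc i" using not0_implies_Suc by blast
        have "norm (g y) \<le> real G / 2 ^ i"
          using not_less_Least[of i "\<lambda>j. \<not> norm (g y) \<le> real G / 2 ^ j"] i j_def by auto
        then have "y \<in> P i" "i < I" using j i yB by (auto simp: P_def)
        then show ?thesis using y by auto
      qed
    qed
    then have "sum \<nu> S \<le> sum \<nu> (R \<union> (\<Union>i<I. S \<inter> P i))"
      using Yfin by (intro sum_mono2) (auto simp: R_def S_def)
    also have "\<dots> \<le> sum \<nu> R + sum \<nu> (\<Union>i<I. S \<inter> P i)"
      using Yfin by (subst sum_Un) (auto simp: R_def S_def intro!: sum_nonneg)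
    also have "sum \<nu> (\<Union>i<I. S \<inter> P i) = (\<Sum>i<I. sum \<nu> (S \<inter> P i))"
    proof (rule sum.UNION_disjoint)
      have "P i \<inter> P j = {}" if "i < j" for i j
      proof -
        have "real G / 2 ^ j \<le> real G / 2 ^ Suc i"
          using that by (intro divide_left_mono power_increasing) auto
        then show ?thesis by (auto simp: P_def)
      qed
      then show "\<forall>i\<in>{..<I}. \<forall>j\<in>{..<I}. i \<noteq> j \<longrightarrow> S \<inter> P i \<inter> (S \<inter> P j) = {}"
        by (metis Int_assoc Int_commute Int_empty_right Int_left_commute linorder_neqE_nat)
    qed (use Yfin in \<open>auto simp: S_def\<close>)
    also have "\<dots> \<le> (\<Sum>i<I. K3 * r powr \<kappa> * q ^ i)" by (intro sum_mono shell) auto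
    also have "\<dots> = K3 * r powr \<kappa> * (\<Sum>i<I. q ^ i)" by (simp add: sum_distrib_left)
    also have "\<dots> \<le> K3 * r powr \<kappa> * (1 / (1 - q))"
    proof (intro mult_left_mono)
      have "(\<Sum>i<I. q ^ i) \<le> (\<Sum>i. q ^ i)" using q by (intro sum_le_suminf summable_geometric) auto
      then show "(\<Sum>i<I. q ^ i) \<le> 1 / (1 - q)" using q suminf_geometric[of q] by simp
    qed (use K30 in auto)
    also have "sum \<nu> R + K3 * r powr \<kappa> * (1 / (1 - q)) \<le> C * r powr \<kappa>"
      using rest by (simp add: C_def algebra_simps) (use powr_ge_zero[of r \<kappa>] in linarith)
    finally show ?thesis by (simp add: S_def)
  qed
  then show ?thesis using C1 by blast
qed

subsection \<open>Hypersurfaces of the sphere with sectional curvature greater than one\<close>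

text \<open>The orthogonal complement of \<open>T\<close> has dimension two and is spanned by the
  orthonormal pair \<open>z\<close>, \<open>e\<close>. In the application \<open>z\<close> is the
  position vector and \<open>e\<close> the unit normal of the hypersurface within the
  sphere.\<close>

lemma normal_part_eq:
  fixes T :: "'a::euclidean_space set"
  assumes T: "subspace T" "dim T + 2 = DIM('a)"
    and z: "norm z = 1" "\<And>t. t \<in> T \<Longrightarrow> z \<bullet> t = 0"
    and e: "norm e = 1" "\<And>t. t \<in> T \<Longrightarrow> e \<bullet> t = 0" and ze: "z \<bullet> e = 0"
  shows "normal_part T w = (w \<bullet> z) *\<^sub>R z + (w \<bullet> e) *\<^sub>R e"
proof -
  define N where "N = {y. \<forall>t\<in>T. orthogonal t y}"
  have zz: "z \<bullet> z = 1" "e \<bullet> e = 1" using z e by (simp_all add: norm_eq_sqrt_inner)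
  have "dim {y \<in> UNIV. \<forall>x\<in>T. orthogonal x y} + dim T = dim (UNIV :: 'a set)"
    using T by (intro dim_subspace_orthogonal_to_vectors) auto
  then have dimN: "dim N = 2" using T(2) by (simp add: N_def dim_UNIV)
  have sN: "subspace N" unfolding N_def
    by (auto simp: subspace_def orthogonal_def inner_add_right)
  have zeN: "{z, e} \<subseteq> N" using z e by (auto simp: N_def orthogonal_def inner_commute)
  have "z \<noteq> e" using ze zz by auto
  moreover have "independent {z, e}"
    using ze zz by (intro pairwise_orthogonal_independent)
      (auto simp: pairwise_def orthogonal_def inner_commute)
  ultimately have "dim (span {z, e}) = 2" using dim_eq_card_independent[of "{z, e}"] by (simp add: dim_span)
  then have spanN: "span {z, e} = N"
    using zeN dimN sN by (intro subspace_dim_equal span_minimal) auto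
  obtain y n where yn: "y \<in> span T" "\<And>v. v \<in> span T \<Longrightarrow> orthogonal n v" "w = y + n"
    using orthogonal_subspace_decomp_exists[of T w] by blast
  have yT: "y \<in> T" using yn(1) T by (metis span_eq_iff)
  have nN: "n \<in> N" using yn(2) span_base by (auto simp: N_def orthogonal_commute)
  then obtain \<alpha> \<beta> where \<alpha>\<beta>: "n = \<alpha> *\<^sub>R z + \<beta> *\<^sub>R e"
    unfolding spanN[symmetric] by (auto simp: span_insert span_singleton algebra_simps)
  have "w \<bullet> z = n \<bullet> z" "w \<bullet> e = n \<bullet> e"
    using yn(3) z(2)[OF yT] e(2)[OF yT] by (simp_all add: inner_add_left inner_commute[of y])
  moreover have "n \<bullet> z = \<alpha>" "n \<bullet> e = \<beta>"
    using zz ze by (simp_all add: \<alpha>\<beta> inner_add_left inner_commute[of e z])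
  ultimately have n: "n = (w \<bullet> z) *\<^sub>R z + (w \<bullet> e) *\<^sub>R e"
    using \<alpha>\<beta> by simp
  have "normal_part T w = n"
    unfolding normal_part_def
  proof (rule the_equality)
    show "(\<forall>t\<in>T. n \<bullet> t = 0) \<and> w - n \<in> T"
      using nN yn(3) yT by (auto simp: N_def orthogonal_def inner_commute)
    fix v assume v: "(\<forall>t\<in>T. v \<bullet> t = 0) \<and> w - v \<in> T"
    have "w - n = y" using yn(3) by simp
    then have "(w - v) - (w - n) \<in> T" using subspace_diff[OF T(1), of "w - v" y] v yT by simp
    then have "(n - v) \<in> T" by simp
    moreover have "(n - v) \<bullet> t = 0" if "t \<in> T" for t
      using nN v that by (auto simp: N_def orthogonal_def inner_commute inner_diff_right)
    ultimately have "(n - v) \<bullet> (n - v) = 0" by blast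
    then show "v = n" by simp
  qed
  then show ?thesis using n by simp
qed

lemma C2_chartD:
  assumes "C2_chart M V \<phi> D D2"
  shows "open V" "\<phi> ` V \<subseteq> M"
    "\<And>u. u \<in> V \<Longrightarrow> (\<phi> has_derivative blinfun_apply (D u)) (at u)"
    "\<And>u. u \<in> V \<Longrightarrow> (D has_derivative blinfun_apply (D2 u)) (at u)"
    "\<And>u. u \<in> V \<Longrightarrow> inj (blinfun_apply (D u))"
    "continuous_on V D2"
  using assms unfolding C2_chart_def by auto

lemma has_derivative_const_on_zero:
  assumes "open V" "u \<in> V" "(f has_derivative f') (at u)" "\<And>v. v \<in> V \<Longrightarrow> f v = c"
  shows "f' a = 0"
proof -
  have "((\<lambda>_. c) has_derivative f') (at u)"
    by (rule has_derivative_transform_within_open[OF assms(3,1,2)]) (rule assms(4))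
  then have "f' = (\<lambda>_. 0)" using has_derivative_unique has_derivative_const by blast
  then show ?thesis by simp
qed

text \<open>Differentiate \<open>\<phi> u \<bullet> \<phi> u = 1\<close>, then
  \<open>\<phi> u \<bullet> D u b = 0\<close>. The last identity is the second fundamental form of
  the unit sphere, the source of the curvature one to be subtracted.\<close>

lemma chart_sphere_derivatives:
  assumes ch: "C2_chart M V \<phi> D D2" and M: "M \<subseteq> sphere 0 1" and u: "u \<in> V"
  shows "norm (\<phi> u) = 1" "\<phi> u \<bullet> D u a = 0" "\<phi> u \<bullet> D2 u a b = - (D u a \<bullet> D u b)"
proof -
  note ch = C2_chartD[OF ch]
  have n1: "norm (\<phi> v) = 1" if "v \<in> V" for v 
  proof -
    have "\<phi> v \<in> sphere 0 1" using ch(2) M that by blast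
    then show ?thesis by simp
  qed
  then show "norm (\<phi> u) = 1" using u .
  have zero: "\<phi> v \<bullet> D v a = 0" if v: "v \<in> V" for v a
  proof -
    have "((\<lambda>v. \<phi> v \<bullet> \<phi> v) has_derivative (\<lambda>a. \<phi> v \<bullet> D v a + D v a \<bullet> \<phi> v)) (at v)"
      by (rule has_derivative_inner[OF ch(3)[OF v] ch(3)[OF v]])
    moreover have "\<phi> w \<bullet> \<phi> w = 1" if "w \<in> V" for w
      using n1[OF that] by (simp add: norm_eq_sqrt_inner)
    ultimately have "\<phi> v \<bullet> D v a + D v a \<bullet> \<phi> v = 0"
      by (rule has_derivative_const_on_zero[OF ch(1) v])
    then show ?thesis by (simp add: inner_commute)
  qed
  then show "\<phi> u \<bullet> D u a = 0" using u .
  have "((\<lambda>v. D v b) has_derivative (\<lambda>a. D2 u a b)) (at u)"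
    by (rule bounded_linear.has_derivative[OF blinfun.bounded_linear_left ch(4)[OF u]])
  then have "((\<lambda>v. \<phi> v \<bullet> D v b) has_derivative (\<lambda>a. \<phi> u \<bullet> D2 u a b + D u a \<bullet> D u b)) (at u)"
    by (rule has_derivative_inner[OF ch(3)[OF u]])
  then have "\<phi> u \<bullet> D2 u a b + D u a \<bullet> D u b = 0"
    by (rule has_derivative_const_on_zero[OF ch(1) u]) (rule zero)
  then show "\<phi> u \<bullet> D2 u a b = - (D u a \<bullet> D u b)" by simp
qed

text \<open>In the sphere the Gauss equation reads: sectional curvature minus one is, up to a positive
  factor, the minor of the second fundamental form in the direction of the unit normal.\<close>

lemma second_fundamental_minor_pos:
  fixes \<phi> :: "'b::euclidean_space \<Rightarrow> 'a::euclidean_space"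
  assumes ch: "C2_chart M V \<phi> D D2" and M: "M \<subseteq> sphere 0 1" and u: "u \<in> V"
    and dims: "DIM('b) + 2 = DIM('a)"
    and e: "norm e = 1" "\<phi> u \<bullet> e = 0" "\<And>a. D u a \<bullet> e = 0"
    and K: "sectional_curvature D D2 u a b > 1"
  shows "(D2 u a b \<bullet> e)\<^sup>2 < (D2 u a a \<bullet> e) * (D2 u b b \<bullet> e)"
proof -
  let ?T = "range (blinfun_apply (D u))"
  note S = chart_sphere_derivatives[OF ch M u]
  have lin: "linear (blinfun_apply (D u))" using blinfun.bounded_linear_right bounded_linear.linear by blast
  have sub: "subspace ?T" using lin linear_subspace_image subspace_UNIV by blast
  have "dim ?T = DIM('b)" using dim_image_eq[OF lin, of UNIV] C2_chartD(5)[OF ch u] by (simp add: dim_UNIV)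
  then have np: "normal_part ?T w = (w \<bullet> \<phi> u) *\<^sub>R \<phi> u + (w \<bullet> e) *\<^sub>R e" for w
    using sub dims e S by (intro normal_part_eq) (auto simp: inner_commute)
  have zz: "\<phi> u \<bullet> \<phi> u = 1" "e \<bullet> e = 1" using S e by (simp_all add: norm_eq_sqrt_inner)
  have II: "normal_part ?T (D2 u x y) = (- (D u x \<bullet> D u y)) *\<^sub>R \<phi> u + (D2 u x y \<bullet> e) *\<^sub>R e" for x y
    unfolding np using S(3)[of x y] by (simp add: inner_commute)
  define num where "num = normal_part ?T (D2 u a a) \<bullet> normal_part ?T (D2 u b b)
      - (norm (normal_part ?T (D2 u a b)))\<^sup>2"
  define den where "den = (norm (D u a))\<^sup>2 * (norm (D u b))\<^sup>2 - (D u a \<bullet> D u b)\<^sup>2"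
  have K': "num / den > 1" using K by (simp add: sectional_curvature_def Let_def num_def den_def)
  have "0 \<le> den" using Cauchy_Schwarz_ineq[of "D u a" "D u b"]
    by (simp add: den_def power2_norm_eq_inner)
  \<comment> \<open>In HOL a quotient with \<open>den = 0\<close> is zero and cannot exceed one, so
    \<open>den\<close> is positive here.\<close>
  then have "den < num" using K' by (cases "den = 0") (auto simp: field_simps)
  moreover have "num = (norm (D u a))\<^sup>2 * (norm (D u b))\<^sup>2 + (D2 u a a \<bullet> e) * (D2 u b b \<bullet> e)
      - ((D u a \<bullet> D u b)\<^sup>2 + (D2 u a b \<bullet> e)\<^sup>2)"
  proof -
    have inner: "(p *\<^sub>R \<phi> u + q *\<^sub>R e) \<bullet> (p' *\<^sub>R \<phi> u + q' *\<^sub>R e) = p * p' + q * q'" for p q p' q' :: real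
      using zz e(2) by (simp add: inner_add_left inner_add_right inner_commute)
    show ?thesis
      unfolding num_def II power2_norm_eq_inner inner by (simp add: power2_eq_square)
  qed
  ultimately show ?thesis by (simp add: den_def)
qed

text \<open>A positive minor forces \<open>h a a\<close> and \<open>h b b\<close> to have the same
  sign. Comparison with one fixed \<open>a0\<close> settles all directions off its line, and
  homogeneity settles the line itself; a second direction, available in dimension two, shows that
  \<open>h a0 a0\<close> is nonzero.\<close>

lemma definite_of_positive_minors:
  fixes h :: "'b::euclidean_space \<Rightarrow> 'b \<Rightarrow> real"
  assumes d: "2 \<le> DIM('b)" and hom: "\<And>c a. h (c *\<^sub>R a) (c *\<^sub>R a) = c\<^sup>2 * h a a"
    and minors: "\<And>a b. independent {a, b} \<Longrightarrow> a \<noteq> b \<Longrightarrow> (h a b)\<^sup>2 < h a a * h b b"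
  shows "\<exists>\<sigma>\<in>{1, -1}. \<forall>a. a \<noteq> 0 \<longrightarrow> 0 < \<sigma> * h a a"
proof -
  obtain a0 :: 'b where a0: "a0 \<in> Basis" using nonempty_Basis by blast
  then have a00: "a0 \<noteq> 0" by auto
  have pos: "0 < h a0 a0 * h a a" if "a \<notin> span {a0}" for a
  proof -
    have "independent {a, a0}" using that a00 by (intro independent_insertI independent_empty) auto
    moreover have "a \<noteq> a0" using that span_base by blast
    ultimately have "(h a a0)\<^sup>2 < h a a * h a0 a0" by (rule minors)
    then have "0 < h a a * h a0 a0" using zero_le_power2[of "h a a0"] by linarith
    then show ?thesis by (simp add: mult.commute)
  qed
  have "dim {a0} < DIM('b)" using dim_le_card[of "{a0}" "{a0}"] d by (simp add: span_superset)
  then have "span {a0} \<noteq> UNIV" by (metis dim_UNIV dim_span less_irrefl)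
  then obtain b where "b \<notin> span {a0}" by blast
  then have h0: "h a0 a0 \<noteq> 0" using pos by force
  define \<sigma> where "\<sigma> = sgn (h a0 a0)"
  have "0 < \<sigma> * h a a" if "a \<noteq> 0" for a
  proof (cases "a \<in> span {a0}")
    case True
    then obtain c where c: "a = c *\<^sub>R a0" by (auto simp: span_singleton)
    then have "\<sigma> * h a a = c\<^sup>2 * \<bar>h a0 a0\<bar>" unfolding \<sigma>_def c hom by (simp add: abs_sgn)
    then show ?thesis using c that h0 by simp
  next
    case False
    then show ?thesis using pos[OF False] h0 by (auto simp: \<sigma>_def sgn_if zero_less_mult_iff split: if_splits)
  qed
  moreover have "\<sigma> \<in> {1, -1}" using h0 by (auto simp: \<sigma>_def sgn_if)
  ultimately show ?thesis by blast
qed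

text \<open>Minimum over the unit sphere, extended by homogeneity of degree two.\<close>

lemma uniformly_definite:
  fixes A :: "'b::euclidean_space \<Rightarrow>\<^sub>L ('b \<Rightarrow>\<^sub>L 'a::euclidean_space)"
  assumes "\<And>a. a \<noteq> 0 \<Longrightarrow> 0 < \<sigma> * (A a a \<bullet> e)"
  shows "\<exists>m>0. \<forall>a. m * (norm a)\<^sup>2 \<le> \<sigma> * (A a a \<bullet> e)"
proof -
  have "continuous_on (sphere 0 1) (\<lambda>a. \<sigma> * (A a a \<bullet> e))"
    by (intro continuous_intros)
  moreover obtain b :: 'b where "b \<in> Basis" using nonempty_Basis by blast
  then have "sphere (0::'b) 1 \<noteq> {}" by (auto intro!: exI[of _ b])
  ultimately obtain a0 where a0: "a0 \<in> sphere 0 1"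
    "\<And>a. a \<in> sphere 0 1 \<Longrightarrow> \<sigma> * (A a0 a0 \<bullet> e) \<le> \<sigma> * (A a a \<bullet> e)"
    using continuous_attains_inf[OF compact_sphere] by blast
  let ?m = "\<sigma> * (A a0 a0 \<bullet> e)"
  have "?m * (norm a)\<^sup>2 \<le> \<sigma> * (A a a \<bullet> e)" for a
  proof (cases "a = 0")
    case False
    define b where "b = a /\<^sub>R norm a"
    have ab: "a = norm a *\<^sub>R b" using False by (simp add: b_def)
    have "b \<in> sphere 0 1" using False by (simp add: b_def)
    then have "?m * (norm a)\<^sup>2 \<le> \<sigma> * (A b b \<bullet> e) * (norm a)\<^sup>2" using a0(2) by (intro mult_right_mono) auto
    also have "\<dots> = \<sigma> * (A (norm a *\<^sub>R b) (norm a *\<^sub>R b) \<bullet> e)"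
      by (simp add: blinfun.scaleR_left blinfun.scaleR_right power2_eq_square)
    finally show ?thesis using ab by simp
  qed simp
  moreover have "0 < ?m" using a0(1) by (intro assms) auto
  ultimately show ?thesis by blast
qed

lemma inner_bilinear_le:
  fixes A :: "'b::euclidean_space \<Rightarrow>\<^sub>L ('b \<Rightarrow>\<^sub>L 'a::euclidean_space)"
  shows "\<bar>A a a \<bullet> w\<bar> \<le> norm A * norm w * (norm a)\<^sup>2"
proof -
  have "norm (A a a) \<le> norm (A a) * norm a" by (rule norm_blinfun)
  also have "\<dots> \<le> norm A * norm a * norm a" by (intro mult_right_mono norm_blinfun) simp
  finally have "norm (A a a) * norm w \<le> norm A * norm a * norm a * norm w" by (rule mult_right_mono) simp
  then show ?thesis using Cauchy_Schwarz_ineq2[of "A a a" w] by (simp add: power2_eq_square mult_ac)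
qed

text \<open>If \<open>\<phi> \<bullet> e\<close> and its gradient vanish at \<open>u\<close>, then \<open>e\<close> is the unit normal of the hypersurface in
  the sphere. Compactness of the set of unit vectors \<open>e\<close> makes the alternatives quantitative.\<close>

lemma trichotomy_at_point:
  fixes \<phi> :: "'b::euclidean_space \<Rightarrow> 'a::euclidean_space"
  assumes ch: "C2_chart M V \<phi> D D2" and M: "M \<subseteq> sphere 0 1" and u: "u \<in> V"
    and d: "2 \<le> DIM('b)" and dims: "DIM('b) + 2 = DIM('a)"
    and K: "\<And>a b. independent {a, b} \<Longrightarrow> a \<noteq> b \<Longrightarrow> sectional_curvature D D2 u a b > 1"
  shows "\<exists>c>0. \<forall>e. norm e = 1 \<longrightarrow> c \<le> \<bar>\<phi> u \<bullet> e\<bar> \<or> (\<exists>b\<in>Basis. c \<le> \<bar>D u b \<bullet> e\<bar>) \<or>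
    (\<exists>\<sigma>\<in>{1, -1}. \<forall>a. c * (norm a)\<^sup>2 \<le> \<sigma> * (D2 u a a \<bullet> e))"
proof (rule ccontr)
  assume "\<not> ?thesis"
  then have neg: "\<exists>e. norm e = 1 \<and> \<bar>\<phi> u \<bullet> e\<bar> < c \<and> (\<forall>b\<in>Basis. \<bar>D u b \<bullet> e\<bar> < c) \<and>
    (\<forall>\<sigma>\<in>{1, -1}. \<exists>a. \<sigma> * (D2 u a a \<bullet> e) < c * (norm a)\<^sup>2)" if "c > 0" for c
    using that by (meson not_le)
  define cn where "cn = (\<lambda>n. inverse (real (Suc n)))"
  have cn: "cn n > 0" for n by (simp add: cn_def)
  have cn0: "cn \<longlonglongrightarrow> 0" unfolding cn_def by (rule LIMSEQ_inverse_real_of_nat)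
  obtain E where E: "\<And>n. norm (E n) = 1" "\<And>n. \<bar>\<phi> u \<bullet> E n\<bar> < cn n"
    "\<And>n b. b \<in> Basis \<Longrightarrow> \<bar>D u b \<bullet> E n\<bar> < cn n"
    "\<And>n \<sigma>. \<sigma> \<in> {1, -1} \<Longrightarrow> \<exists>a. \<sigma> * (D2 u a a \<bullet> E n) < cn n * (norm a)\<^sup>2"
    using neg[OF cn] by metis
  have "\<forall>n. E n \<in> sphere 0 1" using E(1) by simp
  \<comment> \<open>The limit \<open>e\<close> is orthogonal to the position and to the tangent
    space, so the form at \<open>e\<close> is definite with some margin \<open>m\<close>. The margin
    exceeds the error of replacing \<open>e\<close> by \<open>E (r n)\<close> for large
    \<open>n\<close>, contradicting the choice of \<open>E\<close>.\<close>
  then obtain e r where er: "e \<in> sphere 0 1" "strict_mono r" "(E \<circ> r) \<longlonglongrightarrow> e"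
    using compact_sphere[of "0::'a" 1] unfolding compact_def by meson
  have lim: "(\<lambda>n. E (r n)) \<longlonglongrightarrow> e" using er(3) by (simp add: o_def)
  have cr: "(\<lambda>n. cn (r n)) \<longlonglongrightarrow> 0" using LIMSEQ_subseq_LIMSEQ[OF cn0 er(2)] by (simp add: o_def)
  have zero: "v \<bullet> e = 0" if "\<And>n. \<bar>v \<bullet> E n\<bar> < cn n" for v
  proof -
    have "(\<lambda>n. v \<bullet> E (r n)) \<longlonglongrightarrow> 0"
      by (rule Lim_null_comparison[OF _ cr]) (use that in \<open>auto intro!: always_eventually less_imp_le\<close>)
    moreover have "(\<lambda>n. v \<bullet> E (r n)) \<longlonglongrightarrow> v \<bullet> e" by (intro tendsto_intros lim)
    ultimately show ?thesis using LIMSEQ_unique by blast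
  qed
  have e1: "norm e = 1" using er(1) by simp
  have e2: "\<phi> u \<bullet> e = 0" using zero E(2) by blast
  have e3: "D u a \<bullet> e = 0" for a
  proof -
    have "D u a = D u (\<Sum>b\<in>Basis. (a \<bullet> b) *\<^sub>R b)" by (simp add: euclidean_representation)
    also have "\<dots> = (\<Sum>b\<in>Basis. (a \<bullet> b) *\<^sub>R D u b)" by (simp add: blinfun.sum_right blinfun.scaleR_right)
    finally show ?thesis using zero E(3) by (simp add: inner_sum_left)
  qed
  have "\<exists>\<sigma>\<in>{1, -1}. \<forall>a. a \<noteq> 0 \<longrightarrow> 0 < \<sigma> * (D2 u a a \<bullet> e)"
  proof (rule definite_of_positive_minors[OF d, where h = "\<lambda>a b. D2 u a b \<bullet> e"])
    show "D2 u (c *\<^sub>R a) (c *\<^sub>R a) \<bullet> e = c\<^sup>2 * (D2 u a a \<bullet> e)" for c a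
      by (simp add: blinfun.scaleR_left blinfun.scaleR_right power2_eq_square)
    show "(D2 u a b \<bullet> e)\<^sup>2 < (D2 u a a \<bullet> e) * (D2 u b b \<bullet> e)" if "independent {a, b}" "a \<noteq> b" for a b
      by (rule second_fundamental_minor_pos[OF ch M u dims e1 e2 e3 K[OF that]])
  qed
  then obtain \<sigma> where \<sigma>: "\<sigma> \<in> {1, -1}" "\<And>a. a \<noteq> 0 \<Longrightarrow> 0 < \<sigma> * (D2 u a a \<bullet> e)" by blast
  obtain m where m: "m > 0" "\<And>a. m * (norm a)\<^sup>2 \<le> \<sigma> * (D2 u a a \<bullet> e)"
    using uniformly_definite[OF \<sigma>(2)] by blast
  have "(\<lambda>n. cn (r n) + norm (D2 u) * norm (E (r n) - e)) \<longlonglongrightarrow> 0 + norm (D2 u) * norm (e - e)"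
    by (intro tendsto_intros cr lim)
  then have "eventually (\<lambda>n. cn (r n) + norm (D2 u) * norm (E (r n) - e) < m) sequentially"
    using m(1) by (auto dest: order_tendstoD(2))
  then obtain n where n: "cn (r n) + norm (D2 u) * norm (E (r n) - e) < m"
    by (auto simp: eventually_sequentially)
  obtain a where a: "\<sigma> * (D2 u a a \<bullet> E (r n)) < cn (r n) * (norm a)\<^sup>2" using E(4)[OF \<sigma>(1)] by blast
  have "\<sigma> * (D2 u a a \<bullet> e) - \<sigma> * (D2 u a a \<bullet> E (r n)) = - \<sigma> * (D2 u a a \<bullet> (E (r n) - e))"
    by (simp add: inner_diff_right algebra_simps)
  also have "\<dots> \<le> \<bar>D2 u a a \<bullet> (E (r n) - e)\<bar>" using \<sigma>(1) by auto
  also have "\<dots> \<le> norm (D2 u) * norm (E (r n) - e) * (norm a)\<^sup>2" by (rule inner_bilinear_le)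
  finally have "m * (norm a)\<^sup>2 < (cn (r n) + norm (D2 u) * norm (E (r n) - e)) * (norm a)\<^sup>2"
    using a m(2)[of a] by (simp add: distrib_right)
  also have "\<dots> \<le> m * (norm a)\<^sup>2" using n by (intro mult_right_mono) auto
  finally show False by simp
qed

text \<open>Continuity at \<open>u0\<close> preserves each alternative with at most half the
  constant, on a ball that does not depend on \<open>e\<close>. For each \<open>e\<close> a single
  alternative then holds on the whole ball and can be treated by a single estimate. The sign of the
  form is absorbed in the absolute value, and \<open>R \<le> 1 / 2\<close> keeps coordinate
  differences below one.\<close>

lemma trichotomy_near_point:
  fixes \<phi> :: "'b::euclidean_space \<Rightarrow> 'a::euclidean_space"
  assumes ch: "C2_chart M V \<phi> D D2" and M: "M \<subseteq> sphere 0 1" and u0: "u0 \<in> V"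
    and d: "2 \<le> DIM('b)" and dims: "DIM('b) + 2 = DIM('a)"
    and K: "\<And>a b. independent {a, b} \<Longrightarrow> a \<noteq> b \<Longrightarrow> sectional_curvature D D2 u0 a b > 1"
  shows "\<exists>R>0. \<exists>c>0. \<exists>G. R \<le> 1 / 2 \<and> c \<le> 1 \<and> ball u0 R \<subseteq> V \<and>
    (\<forall>u\<in>ball u0 R. norm (D u) \<le> G \<and> norm (D2 u) \<le> G) \<and>
    (\<forall>e. norm e = 1 \<longrightarrow> (\<forall>u\<in>ball u0 R. c \<le> \<bar>\<phi> u \<bullet> e\<bar>) \<or>
      (\<exists>b\<in>Basis. \<forall>u\<in>ball u0 R. c \<le> \<bar>D u b \<bullet> e\<bar>) \<or>
      (\<forall>u\<in>ball u0 R. \<forall>a. c * (norm a)\<^sup>2 \<le> \<bar>D2 u a a \<bullet> e\<bar>))"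
proof -
  note C = C2_chartD[OF ch]
  obtain c0 where c0: "c0 > 0" and tri: "\<And>e. norm e = 1 \<Longrightarrow> c0 \<le> \<bar>\<phi> u0 \<bullet> e\<bar> \<or>
      (\<exists>b\<in>Basis. c0 \<le> \<bar>D u0 b \<bullet> e\<bar>) \<or> (\<exists>\<sigma>\<in>{1, -1}. \<forall>a. c0 * (norm a)\<^sup>2 \<le> \<sigma> * (D2 u0 a a \<bullet> e))"
    using trichotomy_at_point[OF ch M u0 d dims K] by blast
  define c where "c = min 1 (c0 / 2)"
  have c: "0 < c" "c \<le> 1" "2 * c \<le> c0" using c0 by (auto simp: c_def)
  have "isCont \<phi> u0" "isCont D u0"
    using C(3,4)[OF u0] has_derivative_continuous by blast+
  moreover have "isCont D2 u0" using C(6,1) u0 by (simp add: continuous_on_eq_continuous_at)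
  ultimately have "eventually (\<lambda>u. dist (\<phi> u) (\<phi> u0) < c) (nhds u0)"
    "eventually (\<lambda>u. dist (D u) (D u0) < c) (nhds u0)"
    "eventually (\<lambda>u. dist (D2 u) (D2 u0) < c) (nhds u0)"
    using c(1) by (auto simp: isCont_def tendsto_at_iff_tendsto_nhds intro: tendstoD)
  moreover have "eventually (\<lambda>u. u \<in> V) (nhds u0)" using C(1) u0 by (rule eventually_nhds_in_open)
  ultimately have "eventually (\<lambda>u. dist (\<phi> u) (\<phi> u0) < c \<and> dist (D u) (D u0) < c \<and>
      dist (D2 u) (D2 u0) < c \<and> u \<in> V) (nhds u0)"
    by eventually_elim simp
  then obtain R0 where R0: "R0 > 0" "\<And>u. dist u u0 < R0 \<Longrightarrow> dist (\<phi> u) (\<phi> u0) < c \<and> dist (D u) (D u0) < c \<and>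
      dist (D2 u) (D2 u0) < c \<and> u \<in> V" by (auto simp: eventually_nhds_metric)
  define R where "R = min R0 (1 / 2)"
  have R: "0 < R" "R \<le> 1 / 2" using R0 by (auto simp: R_def)
  have near: "norm (\<phi> u - \<phi> u0) \<le> c" "norm (D u - D u0) \<le> c" "norm (D2 u - D2 u0) \<le> c" "u \<in> V"
    if "u \<in> ball u0 R" for u
    using R0(2)[of u] that by (auto simp: R_def dist_norm norm_minus_commute less_imp_le)
  define G where "G = c + norm (D u0) + norm (D2 u0)"
  have G: "norm (D u) \<le> G \<and> norm (D2 u) \<le> G" if "u \<in> ball u0 R" for u
    using near[OF that] norm_triangle_sub[of "D u" "D u0"] norm_triangle_sub[of "D2 u" "D2 u0"]
      norm_ge_zero[of "D u0"] norm_ge_zero[of "D2 u0"] unfolding G_def by linarith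
  have "(\<forall>u\<in>ball u0 R. c \<le> \<bar>\<phi> u \<bullet> e\<bar>) \<or> (\<exists>b\<in>Basis. \<forall>u\<in>ball u0 R. c \<le> \<bar>D u b \<bullet> e\<bar>) \<or>
      (\<forall>u\<in>ball u0 R. \<forall>a. c * (norm a)\<^sup>2 \<le> \<bar>D2 u a a \<bullet> e\<bar>)" if e: "norm e = 1" for e
    using tri[OF e]
  proof (elim disjE bexE)
    assume *: "c0 \<le> \<bar>\<phi> u0 \<bullet> e\<bar>"
    have "c \<le> \<bar>\<phi> u \<bullet> e\<bar>" if u: "u \<in> ball u0 R" for u
    proof -
      have "\<bar>(\<phi> u - \<phi> u0) \<bullet> e\<bar> \<le> c"
        using Cauchy_Schwarz_ineq2[of "\<phi> u - \<phi> u0" e] near(1)[OF u] e by simp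
      then show ?thesis using * c unfolding inner_diff_left by linarith
    qed
    then show ?thesis by blast
  next
    fix b :: 'b assume b: "b \<in> Basis" and *: "c0 \<le> \<bar>D u0 b \<bullet> e\<bar>"
    have "c \<le> \<bar>D u b \<bullet> e\<bar>" if u: "u \<in> ball u0 R" for u
    proof -
      have "\<bar>(D u - D u0) b \<bullet> e\<bar> \<le> norm ((D u - D u0) b)"
        using Cauchy_Schwarz_ineq2[of "(D u - D u0) b" e] e by simp
      also have "\<dots> \<le> norm (D u - D u0) * norm b" by (rule norm_blinfun)
      also have "\<dots> \<le> c" using near(2)[OF u] b by simp
      finally show ?thesis using * c unfolding blinfun.diff_left inner_diff_left by linarith
    qed
    then show ?thesis using b by blast
  next
    fix \<sigma> :: real assume \<sigma>: "\<sigma> \<in> {1, -1}" and *: "\<forall>a. c0 * (norm a)\<^sup>2 \<le> \<sigma> * (D2 u0 a a \<bullet> e)"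
    have "c * (norm a)\<^sup>2 \<le> \<bar>D2 u a a \<bullet> e\<bar>" if u: "u \<in> ball u0 R" for u a
    proof -
      have "\<bar>(D2 u - D2 u0) a a \<bullet> e\<bar> \<le> norm (D2 u - D2 u0) * norm e * (norm a)\<^sup>2"
        by (rule inner_bilinear_le)
      also have "\<dots> \<le> c * (norm a)\<^sup>2" using near(3)[OF u] e by (intro mult_right_mono) auto
      finally have "\<bar>D2 u0 a a \<bullet> e\<bar> - c * (norm a)\<^sup>2 \<le> \<bar>D2 u a a \<bullet> e\<bar>"
        unfolding blinfun.diff_left inner_diff_left by linarith
      moreover have "2 * c * (norm a)\<^sup>2 \<le> c0 * (norm a)\<^sup>2" using c by (intro mult_right_mono) auto
      moreover have "c0 * (norm a)\<^sup>2 \<le> \<bar>D2 u0 a a \<bullet> e\<bar>" using *[rule_format, of a] \<sigma> by auto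
      ultimately show ?thesis by linarith
    qed
    then show ?thesis by blast
  qed
  then have tri': "\<forall>e. norm e = 1 \<longrightarrow> (\<forall>u\<in>ball u0 R. c \<le> \<bar>\<phi> u \<bullet> e\<bar>) \<or>
      (\<exists>b\<in>Basis. \<forall>u\<in>ball u0 R. c \<le> \<bar>D u b \<bullet> e\<bar>) \<or>
      (\<forall>u\<in>ball u0 R. \<forall>a. c * (norm a)\<^sup>2 \<le> \<bar>D2 u a a \<bullet> e\<bar>)" by blast
  show ?thesis
  proof (rule exI[of _ R], rule conjI[OF R(1)], rule exI[of _ c], rule conjI[OF c(1)], rule exI[of _ G],
      intro conjI)
    show "ball u0 R \<subseteq> V" using near(4) by blast
    show "\<forall>u\<in>ball u0 R. norm (D u) \<le> G \<and> norm (D2 u) \<le> G" using G by blast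
  qed (fact R c tri')+
qed

section \<open>Frostman mass near the zero set of a linear functional in a chart\<close>

lemma norm_representer_le:
  fixes A :: "'b::euclidean_space \<Rightarrow>\<^sub>L 'a::euclidean_space"
  assumes "\<And>x. w \<bullet> x = A x \<bullet> e" "norm e = 1"
  shows "norm w \<le> norm A"
proof (cases "w = 0")
  case False
  have "norm w * norm w = A w \<bullet> e" using assms(1)[of w] by (simp add: power2_norm_eq_inner flip: power2_eq_square)
  also have "\<dots> \<le> norm (A w)" using norm_cauchy_schwarz[of "A w" e] assms(2) by simp
  also have "\<dots> \<le> norm A * norm w" by (rule norm_blinfun)
  finally show ?thesis using False by simp
qed simp

text \<open>This is the transversality condition behind Kaufman's argument, with one constant for
  all directions, scales and measures. Under the first alternative of \<open>tri\<close> the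
  sublevel set is empty for \<open>r < c\<close>; the other two are the transversal and the
  expanding-gradient bounds.\<close>

lemma frostman_chart_level_le:
  fixes \<phi> :: "'b::euclidean_space \<Rightarrow> 'a::euclidean_space"
  assumes ch: "C2_chart M V \<phi> D D2" and d: "2 \<le> DIM('b)" and B: "ball u0 R \<subseteq> V" "R \<le> 1 / 2"
    and c: "0 < c" "c \<le> 1" and \<kappa>: "0 < \<kappa>" "\<kappa> < 1"
    and G: "\<And>u. u \<in> ball u0 R \<Longrightarrow> norm (D u) \<le> G \<and> norm (D2 u) \<le> G"
    and tri: "\<And>e. norm e = 1 \<Longrightarrow> (\<forall>u\<in>ball u0 R. c \<le> \<bar>\<phi> u \<bullet> e\<bar>) \<or>
      (\<exists>b\<in>Basis. \<forall>u\<in>ball u0 R. c \<le> \<bar>D u b \<bullet> e\<bar>) \<or>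
      (\<forall>u\<in>ball u0 R. \<forall>a. c * (norm a)\<^sup>2 \<le> \<bar>D2 u a a \<bullet> e\<bar>)"
  shows "\<exists>C\<ge>1. \<forall>Y \<nu> N r e. frostman (real (DIM('b) - 1) + \<kappa>) N Y \<nu> \<longrightarrow> sum \<nu> Y \<le> 1 \<longrightarrow>
    Y \<subseteq> ball u0 R \<longrightarrow> norm e = 1 \<longrightarrow> 1 / 2 ^ N \<le> r \<longrightarrow> r \<le> 1 \<longrightarrow>
    sum \<nu> {y \<in> Y. \<bar>\<phi> y \<bullet> e\<bar> \<le> r} \<le> C * r powr \<kappa>"
proof -
  let ?B = "ball u0 R"
  note Ch = C2_chartD[OF ch]
  \<comment> \<open>The gradient of \<open>u \<mapsto> \<phi> u \<bullet> e\<close>, as a vector in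
    parameter space.\<close>
  define g where "g = (\<lambda>e u. adjoint (blinfun_apply (D u)) e)"
  have lin: "linear (blinfun_apply (D u))" for u using blinfun.bounded_linear_right bounded_linear.linear by blast
  have g: "g e u \<bullet> a = D u a \<bullet> e" for e u a
    using adjoint_works[OF lin, of a u e] by (simp add: g_def inner_commute)
  define G' where "G' = Suc (nat \<lceil>G\<rceil>)"
  have G': "norm (D u) \<le> real G' \<and> norm (D2 u) \<le> real G'" if "u \<in> ?B" for u
    using G[OF that] unfolding G'_def by linarith
  define \<Gamma> where "\<Gamma> = nat \<lceil>real G' / c\<rceil>"
  have \<Gamma>: "real G' \<le> real \<Gamma> * c"
  proof -
    have "real G' / c \<le> real \<Gamma>" unfolding \<Gamma>_def by linarith
    then show ?thesis using c by (simp add: field_simps)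
  qed
  obtain C3 where C3: "C3 \<ge> 1" "\<And>(B :: 'b set) f g Y \<nu> N r.
    frostman (real (DIM('b) - 1) + \<kappa>) N Y \<nu> \<Longrightarrow> sum \<nu> Y \<le> 1 \<Longrightarrow> Y \<subseteq> B \<Longrightarrow> convex B \<Longrightarrow>
    (\<forall>u\<in>B. (f has_derivative (\<lambda>a. g u \<bullet> a)) (at u)) \<Longrightarrow> (\<forall>u\<in>B. norm (g u) \<le> real G') \<Longrightarrow>
    (\<forall>u\<in>B. \<forall>v\<in>B. c * dist u v \<le> dist (g u) (g v) \<and> dist (g u) (g v) \<le> real G' * dist u v) \<Longrightarrow>
    1 / 2 ^ N \<le> r \<Longrightarrow> r \<le> 1 \<Longrightarrow> sum \<nu> {y \<in> Y. \<bar>f y\<bar> \<le> r} \<le> C3 * r powr \<kappa>"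
    using frostman_expanding_gradient_le[where 'b = 'b, OF c \<kappa> _ d, of G'] by (auto simp: G'_def)
  define C2 where "C2 = 5 ^ (DIM('b) - 1) * real (2 * (2 + DIM('b) * \<Gamma>) + 1) * (2 / c) powr \<kappa>"
  define C1 where "C1 = (1 / c) powr \<kappa>"
  define C where "C = C1 + C2 + C3"
  have C10: "0 \<le> C1" and C20: "0 \<le> C2" by (simp_all add: C1_def C2_def)
  have "sum \<nu> {y \<in> Y. \<bar>\<phi> y \<bullet> e\<bar> \<le> r} \<le> C * r powr \<kappa>"
    if fr: "frostman (real (DIM('b) - 1) + \<kappa>) N Y \<nu>" and tot: "sum \<nu> Y \<le> 1" and Y: "Y \<subseteq> ?B"
      and e: "norm e = 1" and r: "1 / 2 ^ N \<le> r" "r \<le> 1" for Y \<nu> N r e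
  proof -
    have le: "x * r powr \<kappa> \<le> C * r powr \<kappa>" if "x = C1 \<or> x = C2 \<or> x = C3" for x
      using that C10 C20 C3(1) by (intro mult_right_mono) (auto simp: C_def)
    have der: "((\<lambda>u. \<phi> u \<bullet> e) has_derivative (\<lambda>a. g e u \<bullet> a)) (at u)" if "u \<in> ?B" for u
      unfolding g using that B Ch(3) by (intro has_derivative_inner_left) auto
    have diff: "(g e u - g e v) \<bullet> x = (D u - D v) x \<bullet> e" for u v x
      by (simp add: inner_diff_left g blinfun.diff_left)
    show ?thesis using tri[OF e]
    proof (elim disjE bexE)
      assume *: "\<forall>u\<in>?B. c \<le> \<bar>\<phi> u \<bullet> e\<bar>"
      have "sum \<nu> {y \<in> Y. \<bar>\<phi> y \<bullet> e\<bar> \<le> r} \<le> C1 * r powr \<kappa>"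
      proof (cases "c \<le> r")
        case True
        have "sum \<nu> {y \<in> Y. \<bar>\<phi> y \<bullet> e\<bar> \<le> r} \<le> sum \<nu> Y"
          using fr by (intro sum_mono2) (auto simp: frostman_def)
        also have "\<dots> \<le> 1" by (rule tot)
        also have "\<dots> \<le> (r / c) powr \<kappa>" using True c \<kappa> by (intro ge_one_powr_ge_zero) auto
        also have "\<dots> = C1 * r powr \<kappa>" using True c by (simp add: C1_def powr_divide)
        finally show ?thesis .
      next
        case False
        then have empty: "{y \<in> Y. \<bar>\<phi> y \<bullet> e\<bar> \<le> r} = {}" using * Y by force
        show ?thesis unfolding empty using C10 by simp
      qed
      then show ?thesis using le[of C1] by linarith
    next
      fix b :: 'b assume b: "b \<in> Basis" and *: "\<forall>u\<in>?B. c \<le> \<bar>D u b \<bullet> e\<bar>"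
      have "sum \<nu> {y \<in> Y. \<bar>\<phi> y \<bullet> e\<bar> \<le> r} \<le> C2 * r powr \<kappa>"
        unfolding C2_def
      proof (rule frostman_transversal_le[OF fr \<kappa>(1) tot Y convex_ball der b c _ _ _ r(1)])
        show "c \<le> \<bar>g e u \<bullet> b\<bar>" if "u \<in> ?B" for u using * that by (simp add: g)
        show "\<bar>g e u \<bullet> i\<bar> \<le> real \<Gamma> * c" if "u \<in> ?B" "i \<in> Basis" for u i
        proof -
          have "\<bar>g e u \<bullet> i\<bar> \<le> norm (g e u)" using that by (intro Basis_le_norm)
          also have "\<dots> \<le> norm (D u)" using g e by (rule norm_representer_le)
          finally show ?thesis using G'[OF that(1)] \<Gamma> by linarith
        qed
        show "\<bar>u \<bullet> i - v \<bullet> i\<bar> \<le> 1" if "u \<in> ?B" "v \<in> ?B" "i \<in> Basis" for u v i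
        proof -
          have "dist u v \<le> 2 * R" using that dist_triangle3[of u v u0] by auto
          then show ?thesis using coord_diff_le_dist[OF that(3), of u v] B(2) by linarith
        qed
      qed
      then show ?thesis using le[of C2] by linarith
    next
      assume *: "\<forall>u\<in>?B. \<forall>a. c * (norm a)\<^sup>2 \<le> \<bar>D2 u a a \<bullet> e\<bar>"
      have "sum \<nu> {y \<in> Y. \<bar>\<phi> y \<bullet> e\<bar> \<le> r} \<le> C3 * r powr \<kappa>"
      proof (rule C3(2)[OF fr tot Y convex_ball _ _ _ r])
        show "\<forall>u\<in>?B. ((\<lambda>u. \<phi> u \<bullet> e) has_derivative (\<lambda>a. g e u \<bullet> a)) (at u)" using der by blast
        show "\<forall>u\<in>?B. norm (g e u) \<le> real G'"
          using norm_representer_le[OF g e] G' by (meson order_trans)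
        show "\<forall>u\<in>?B. \<forall>v\<in>?B. c * dist u v \<le> dist (g e u) (g e v) \<and> dist (g e u) (g e v) \<le> real G' * dist u v"
        proof (intro ballI conjI)
          fix u v assume uv: "u \<in> ?B" "v \<in> ?B"
          have "norm (D u - D v) \<le> real G' * norm (u - v)"
          proof (rule differentiable_bound[OF convex_ball _ _ uv(1,2)])
            show "(D has_derivative blinfun_apply (D2 x)) (at x within ?B)" if "x \<in> ?B" for x
              using Ch(4)[OF subsetD[OF B(1) that]] by (rule has_derivative_at_withinI)
            show "onorm (blinfun_apply (D2 x)) \<le> real G'" if "x \<in> ?B" for x
              using G'[OF that] by (simp add: norm_blinfun.rep_eq)
          qed
          moreover have "norm (g e u - g e v) \<le> norm (D u - D v)" using diff e by (rule norm_representer_le)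
          ultimately show "dist (g e u) (g e v) \<le> real G' * dist u v" unfolding dist_norm by linarith
          \<comment> \<open>Applied to \<open>v \<mapsto> D v w \<bullet> e\<close> with
            \<open>w\<close> the displacement itself, the mean value theorem yields the quadratic
            form at one point. Its lower bound becomes expansion of the gradient by Cauchy-Schwarz,
            whatever the sign of the form.\<close>
          define w where "w = u - v"
          have "\<exists>x\<in>?B. D u w \<bullet> e - D v w \<bullet> e = D2 x (u - v) w \<bullet> e"
          proof (rule convex_mvt[OF convex_ball _ uv(2,1)])
            fix x assume x: "x \<in> ?B"
            then have "((\<lambda>v. D v w) has_derivative (\<lambda>a. D2 x a w)) (at x)"
              using bounded_linear.has_derivative[OF blinfun.bounded_linear_left Ch(4)[OF subsetD[OF B(1)]]] by blast
            then show "((\<lambda>v. D v w \<bullet> e) has_derivative (\<lambda>a. D2 x a w \<bullet> e)) (at x)"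
              by (rule has_derivative_inner_left)
          qed
          then obtain x where x: "x \<in> ?B" "D u w \<bullet> e - D v w \<bullet> e = D2 x w w \<bullet> e" by (auto simp: w_def)
          then have "c * (norm w)\<^sup>2 \<le> \<bar>(g e u - g e v) \<bullet> w\<bar>"
            using * unfolding inner_diff_left g by simp
          also have "\<dots> \<le> norm (g e u - g e v) * norm w" by (rule Cauchy_Schwarz_ineq2)
          finally have "(c * norm w) * norm w \<le> norm (g e u - g e v) * norm w"
            by (simp add: power2_eq_square mult.assoc)
          then have "c * norm w \<le> norm (g e u - g e v)" by (cases "w = 0") auto
          then show "c * dist u v \<le> dist (g e u) (g e v)" by (simp add: w_def dist_norm)
        qed
      qed
      then show ?thesis using le[of C3] by linarith
    qed
  qed
  moreover have "1 \<le> C" using C10 C20 C3(1) by (simp add: C_def)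
  ultimately show ?thesis by blast
qed

subsection \<open>The exceptional set\<close>

text \<open>Averaging the projected kernel over the parameters returns the kernel in space. Pulling
  out \<open>norm h\<close> leaves a unit vector and the scale \<open>\<delta> / norm h\<close>,
  which is no finer than \<open>\<delta>\<close> because \<open>norm h \<le> 1\<close>, so
  \<open>level\<close> applies.\<close>

lemma frostman_projection_potential_le:
  fixes \<phi> :: "'b::euclidean_space \<Rightarrow> 'a::euclidean_space"
  assumes s: "0 < s" "s < \<kappa>" and C: "1 \<le> C" and fr: "frostman \<tau> N Y \<nu>" and tot: "sum \<nu> Y \<le> 1"
    and level: "\<And>r e. norm e = 1 \<Longrightarrow> 1 / 2 ^ N \<le> r \<Longrightarrow> r \<le> 1 \<Longrightarrow>
      sum \<nu> {y \<in> Y. \<bar>\<phi> y \<bullet> e\<bar> \<le> r} \<le> C * r powr \<kappa>"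
    and h: "norm h \<le> 1"
  shows "(\<Sum>y\<in>Y. \<nu> y * (\<bar>\<phi> y \<bullet> h\<bar> + 1 / 2 ^ N) powr (- s))
    \<le> 2 powr s * (C * (1 + 2 powr s / (1 - 2 powr (s - \<kappa>)))) * (norm h + 1 / 2 ^ N) powr (- s)"
proof -
  define \<delta> where "\<delta> = (1 / 2 ^ N :: real)"
  define K where "K = C * (1 + 2 powr s / (1 - 2 powr (s - \<kappa>)))"
  have \<delta>: "0 < \<delta>" by (simp add: \<delta>_def)
  have Y: "finite Y" "\<And>y. 0 \<le> \<nu> y" using fr by (auto simp: frostman_def)
  have "2 powr (s - \<kappa>) < 2 powr 0" using s by (intro powr_less_mono) auto
  then have "0 \<le> 2 powr s / (1 - 2 powr (s - \<kappa>))" by simp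
  then have "1 * 1 \<le> K" unfolding K_def using C by (intro mult_mono) auto
  then have K: "1 \<le> K" by simp
  have double: "x powr (- s) \<le> 2 powr s * (norm h + \<delta>) powr (- s)"
    if "0 < x" "norm h + \<delta> \<le> 2 * x" for x
  proof -
    have "(2 * x) powr (- s) \<le> (norm h + \<delta>) powr (- s)"
      using that s \<delta> by (intro powr_mono2') (auto intro: add_nonneg_pos)
    then have "2 powr s * (2 powr (- s) * x powr (- s)) \<le> 2 powr s * (norm h + \<delta>) powr (- s)"
      using that by (intro mult_left_mono) (auto simp: powr_mult)
    moreover have "2 powr s * (2 powr (- s) * x powr (- s)) = x powr (- s)"
      unfolding mult.assoc[symmetric] powr_add[symmetric] by simp
    ultimately show ?thesis by simp
  qed
  have "(\<Sum>y\<in>Y. \<nu> y * (\<bar>\<phi> y \<bullet> h\<bar> + \<delta>) powr (- s)) \<le> K * (2 powr s * (norm h + \<delta>) powr (- s))"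
  \<comment> \<open>Below the resolution the crude bound \<open>\<delta> powr (- s)\<close> is
    already comparable with the right-hand side.\<close>
  proof (cases "norm h \<le> \<delta>")
    case True
    have "(\<Sum>y\<in>Y. \<nu> y * (\<bar>\<phi> y \<bullet> h\<bar> + \<delta>) powr (- s)) \<le> (\<Sum>y\<in>Y. \<nu> y * \<delta> powr (- s))"
      using Y s \<delta> by (intro sum_mono mult_left_mono powr_mono2') auto
    also have "\<dots> = sum \<nu> Y * \<delta> powr (- s)" by (simp add: sum_distrib_right)
    also have "\<dots> \<le> K * \<delta> powr (- s)" using tot K by (intro mult_right_mono) auto
    also have "\<dots> \<le> K * (2 powr s * (norm h + \<delta>) powr (- s))"
      using True \<delta> K by (intro mult_left_mono double) auto
    finally show ?thesis .
  next
    case False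
    then have h0: "0 < norm h" using \<delta> by linarith
    define e where "e = h /\<^sub>R norm h"
    have e: "norm e = 1" using h0 by (simp add: e_def)
    have he: "\<phi> y \<bullet> h = norm h * (\<phi> y \<bullet> e)" for y using h0 by (simp add: e_def)
    have "\<delta> * norm h \<le> \<delta> * 1" using h \<delta> by (intro mult_left_mono) auto
    then have \<delta>h: "0 < \<delta> / norm h" "\<delta> / norm h \<le> 1" "\<delta> \<le> \<delta> / norm h"
      using False h0 \<delta> by (auto simp: field_simps)
    have "\<bar>\<phi> y \<bullet> h\<bar> + \<delta> = norm h * (\<bar>\<phi> y \<bullet> e\<bar> + \<delta> / norm h)" for y
      using h0 by (simp add: he abs_mult distrib_left)
    then have "(\<Sum>y\<in>Y. \<nu> y * (\<bar>\<phi> y \<bullet> h\<bar> + \<delta>) powr (- s))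
        = (\<Sum>y\<in>Y. norm h powr (- s) * (\<nu> y * (\<bar>\<phi> y \<bullet> e\<bar> + \<delta> / norm h) powr (- s)))"
      using h0 \<delta> by (simp add: powr_mult mult_ac)
    also have "\<dots> = norm h powr (- s) * (\<Sum>y\<in>Y. \<nu> y * (\<bar>\<phi> y \<bullet> e\<bar> + \<delta> / norm h) powr (- s))"
      by (simp add: sum_distrib_left)
    also have "\<dots> \<le> norm h powr (- s) * K"
      unfolding K_def
    proof (intro mult_left_mono layer_sum_le[OF s _ \<delta>h(1,2) Y])
      show "sum \<nu> {y \<in> Y. \<bar>\<phi> y \<bullet> e\<bar> \<le> r} \<le> C * r powr \<kappa>" if "\<delta> / norm h \<le> r" "r \<le> 1" for r
        using that \<delta>h(3) by (intro level[OF e]) (auto simp: \<delta>_def)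
    qed (use tot C in auto)
    also have "\<dots> \<le> (2 powr s * (norm h + \<delta>) powr (- s)) * K"
      using h0 False K by (intro mult_right_mono double) auto
    finally show ?thesis by (simp add: mult_ac)
  qed
  then show ?thesis by (simp add: \<delta>_def K_def mult_ac)
qed

text \<open>Compactness makes the cover finite and so bounds its levels; the bound \<open>m\<close>
  is what permits one resolution for many parameters.\<close>

lemma finite_fat_cover:
  fixes S :: "'a::euclidean_space set"
  assumes "compact S" "content s S = 0" "0 < \<eta>"
  shows "\<exists>m. \<exists>U. finite U \<and> U \<subseteq> cells \<and> (\<forall>q\<in>U. fst q \<le> m) \<and> S \<subseteq> (\<Union>(k, Q)\<in>U. fat k Q) \<and>
    (\<Sum>q\<in>U. 2 powr (- s * real (fst q))) \<le> \<eta>"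
proof -
  have "content s S < ennreal \<eta>" using assms by simp
  from content_less_D[OF this] obtain U where U: "U \<subseteq> cells" "S \<subseteq> \<Union>(snd ` U)"
    "emeasure (cell_weight s) U < ennreal \<eta>" by auto
  have cov: "S \<subseteq> (\<Union>q\<in>U. fat (fst q) (snd q))"
  proof
    fix x assume "x \<in> S"
    then obtain q where "q \<in> U" "x \<in> snd q" using U(2) by auto
    then show "x \<in> (\<Union>q\<in>U. fat (fst q) (snd q))" using subset_fat by blast
  qed
  obtain F where F: "F \<subseteq> U" "finite F" "S \<subseteq> (\<Union>q\<in>F. fat (fst q) (snd q))"
    by (rule compactE_image[OF assms(1) open_fat cov])
  have "emeasure (cell_weight s) F \<le> emeasure (cell_weight s) U" using F(1) by (intro emeasure_mono) auto
  also have "\<dots> \<le> ennreal \<eta>" using U(3) by (rule less_imp_le)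
  finally have "ennreal (\<Sum>q\<in>F. 2 powr (- s * real (fst q))) \<le> ennreal \<eta>"
    unfolding emeasure_cell_weight_finite[OF F(2)] .
  then have "(\<Sum>q\<in>F. 2 powr (- s * real (fst q))) \<le> \<eta>" using assms(3) by (simp add: ennreal_le_iff)
  moreover have "\<forall>q\<in>F. fst q \<le> Max (insert 0 (fst ` F))" using F(2) by simp
  moreover have "S \<subseteq> (\<Union>(k, Q)\<in>F. fat k Q)" using F(3) by (simp add: case_prod_unfold)
  moreover have "F \<subseteq> cells" using F(1) U(1) by (rule order_trans)
  ultimately show ?thesis using F(2)
    by (intro exI[of _ "Max (insert 0 (fst ` F))"] exI[of _ F]) (intro conjI)
qed

lemma content_restrict_small_cell:
  fixes A :: "'a::euclidean_space set"
  assumes "content t A \<noteq> 0"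
  shows "\<exists>k x. content t (A \<inter> cell k x) \<noteq> 0 \<and> (\<forall>u\<in>cell k x. \<forall>v\<in>cell k x. dist u v \<le> 1)"
proof -
  obtain k where k: "real DIM('a) < 2 ^ k" using real_arch_pow[of 2 "real DIM('a)"] by auto
  obtain x where x: "content t (A \<inter> cell k x) \<noteq> 0" using content_restrict_cell[OF assms] by blast
  have "dist u v \<le> 1" if "u \<in> cell k x" "v \<in> cell k x" for u v
  proof -
    have "dist u v \<le> real DIM('a) / 2 ^ k" using that cell_dist cell_eq by blast
    also have "\<dots> \<le> 1" using k by simp
    finally show ?thesis .
  qed
  then show ?thesis using x by blast
qed

lemma mass_le_one:
  assumes "ennreal c \<le> content t A" "A \<subseteq> cell k x" "0 \<le> t"
  shows "c \<le> 1"
proof -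
  have "ennreal c \<le> ennreal (2 powr (- t * real k))" using assms content_cell_le order_trans by blast
  then have "c \<le> 2 powr (- t * real k)" by simp
  also have "\<dots> \<le> 2 powr 0" using assms by (intro powr_mono) auto
  finally show ?thesis by simp
qed

text \<open>The order of choices matters: the masses \<open>cn\<close>, \<open>cm\<close> and the
  kernel constants \<open>P\<close>, \<open>P'\<close> come first, then \<open>\<eta>\<close>, then
  the level \<open>m\<close>, then the resolution \<open>N\<close>. Since nothing before
  \<open>N\<close> depends on \<open>N\<close>, the energies forced by \<open>\<eta>\<close> exceed
  the average that the kernel bounds allow.\<close>

lemma exceptional_parameters_null:
  fixes \<phi> :: "'b::euclidean_space \<Rightarrow> 'a::euclidean_space"
  assumes s: "0 < s" "s < \<kappa>" "s < t" and C: "1 \<le> C"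
    and level: "\<And>Y \<nu> N r e. frostman (real (DIM('b) - 1) + \<kappa>) N Y \<nu> \<Longrightarrow> sum \<nu> Y \<le> 1 \<Longrightarrow>
      Y \<subseteq> B \<Longrightarrow> norm e = 1 \<Longrightarrow> 1 / 2 ^ N \<le> r \<Longrightarrow> r \<le> 1 \<Longrightarrow>
      sum \<nu> {y \<in> Y. \<bar>\<phi> y \<bullet> e\<bar> \<le> r} \<le> C * r powr \<kappa>"
    and K: "compact K" "content t K \<noteq> 0"
  shows "content (real (DIM('b) - 1) + \<kappa>) {u \<in> B. content s ((\<lambda>w. w \<bullet> \<phi> u) ` K) = 0} = 0"
    (is "content ?\<tau> ?A = 0")
proof (rule ccontr)
  assume "content ?\<tau> ?A \<noteq> 0"
  then obtain x0 where "content ?\<tau> (?A \<inter> cell 0 x0) \<noteq> 0" using content_restrict_cell by blast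
  then obtain cn where cn: "0 < cn" "ennreal cn < content ?\<tau> (?A \<inter> cell 0 x0)"
    using ennreal_between_content by blast
  \<comment> \<open>Differences of points of this cell have norm at most one, as the kernel estimate
    requires.\<close>
  obtain k z where kz: "content t (K \<inter> cell k z) \<noteq> 0"
    "\<And>u v. u \<in> cell k z \<Longrightarrow> v \<in> cell k z \<Longrightarrow> dist u v \<le> 1"
    using content_restrict_small_cell[OF K(2)] by blast
  obtain cm where cm: "0 < cm" "ennreal cm < content t (K \<inter> cell k z)"
    using ennreal_between_content[OF kz(1)] by blast
  have cm1: "cm \<le> 1" using cm s by (intro mass_le_one[of cm t "K \<inter> cell k z" k z]) auto
  have \<tau>0: "0 \<le> ?\<tau>" using s by simp
  define P where "P = 2 powr s * (C * (1 + 2 powr s / (1 - 2 powr (s - \<kappa>))))"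
  define P' where "P' = 5 ^ DIM('a) * 2 powr t * (1 + 2 powr s / (1 - 2 powr (s - t)))"
  have P0: "0 \<le> P"
  proof -
    have "2 powr (s - \<kappa>) < 2 powr 0" using s by (intro powr_less_mono) auto
    then show ?thesis unfolding P_def using C by simp
  qed
  have P'0: "0 \<le> P'"
  proof -
    have "2 powr (s - t) < 2 powr 0" using s by (intro powr_less_mono) auto
    then show ?thesis unfolding P'_def by simp
  qed
  \<comment> \<open>Chosen so that the final chain ends in half of its starting value; the
    \<open>+ 1\<close> keeps the denominator positive.\<close>
  define \<eta> where "\<eta> = cn * cm\<^sup>2 / (2 * 4 powr s * (P * P' + 1))"
  have \<eta>: "0 < \<eta>" unfolding \<eta>_def using cn cm P0 P'0 by (intro divide_pos_pos mult_pos_pos add_nonneg_pos) auto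
  define good where "good = (\<lambda>m u. \<exists>U. finite U \<and> U \<subseteq> cells \<and> (\<forall>q\<in>U. fst q \<le> m) \<and>
    (\<lambda>w. w \<bullet> \<phi> u) ` K \<subseteq> (\<Union>(k, Q)\<in>U. fat k Q) \<and> (\<Sum>q\<in>U. 2 powr (- s * real (fst q))) \<le> \<eta>)"
  define Am where "Am = (\<lambda>m. {u \<in> ?A \<inter> cell 0 x0. good m u})"
  have "\<exists>m. good m u" if u: "u \<in> ?A" for u
    unfolding good_def
  proof (rule finite_fat_cover[OF _ _ \<eta>])
    show "compact ((\<lambda>w. w \<bullet> \<phi> u) ` K)" using K(1) by (intro compact_continuous_image continuous_intros)
  qed (use u in simp)
  then have UA: "(\<Union>m. Am m) = ?A \<inter> cell 0 x0" unfolding Am_def by blast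
  have "incseq Am"
  proof (rule incseq_SucI, unfold Am_def good_def, safe)
    fix u m U
    assume "finite U" "U \<subseteq> cells" "\<forall>q\<in>U. fst q \<le> m" "(\<lambda>w. w \<bullet> \<phi> u) ` K \<subseteq> (\<Union>(k, Q)\<in>U. fat k Q)"
      "(\<Sum>q\<in>U. 2 powr (- s * real (fst q))) \<le> \<eta>"
    then show "\<exists>U. finite U \<and> U \<subseteq> cells \<and> (\<forall>q\<in>U. fst q \<le> Suc m) \<and>
      (\<lambda>w. w \<bullet> \<phi> u) ` K \<subseteq> (\<Union>(k, Q)\<in>U. fat k Q) \<and> (\<Sum>q\<in>U. 2 powr (- s * real (fst q))) \<le> \<eta>"
      by (intro exI[of _ U]) (simp add: le_SucI)
  qed
  \<comment> \<open>Here continuity along increasing unions is applied to sets of unknown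
    measurability: one level bound \<open>m\<close> serves a part of content still above
    \<open>cn\<close>.\<close>
  then obtain m where m: "ennreal cn < content ?\<tau> (Am m)"
    using content_incseq_gt[of Am cn ?\<tau>] cn(2) unfolding UA by blast
  \<comment> \<open>The resolution has to reach the finest covering cells, of level up to
    \<open>m\<close>, and the cell of level \<open>k\<close> from which \<open>\<mu>\<close> is
    built.\<close>
  define N where "N = max m k"
  obtain Y \<nu> where Y: "Y \<subseteq> Am m" "frostman ?\<tau> N Y \<nu>" "sum \<nu> Y = cn"
    using frostman_exists[OF \<tau>0 _ _ _ less_imp_le[OF m], of 0 N x0] cn by (auto simp: Am_def)
  obtain X \<mu> where X: "X \<subseteq> K \<inter> cell k z" "frostman t N X \<mu>" "sum \<mu> X = cm"
    using frostman_exists[OF _ _ _ _ less_imp_le[OF cm(2)], of k N z] cm s by (auto simp: N_def)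
  have cn1: "cn \<le> 1" using m \<tau>0 by (intro mass_le_one[of cn ?\<tau> "Am m" 0 x0]) (auto simp: Am_def)
  have finY: "finite Y" "\<And>y. 0 \<le> \<nu> y" and finX: "finite X" "\<And>x. 0 \<le> \<mu> x"
    using X(2) Y(2) by (auto simp: frostman_def)
  have YB: "Y \<subseteq> B" using Y(1) by (auto simp: Am_def)
  define En where "En = (\<lambda>y. \<Sum>x\<in>X. \<Sum>x'\<in>X. \<mu> x * \<mu> x' * (\<bar>\<phi> y \<bullet> (x - x')\<bar> + 1 / 2 ^ N) powr (- s))"
  have lower: "cm\<^sup>2 \<le> 4 powr s * \<eta> * En y" if y: "y \<in> Y" for y
  proof -
    have "good m y" using y Y(1) by (auto simp: Am_def)
    then obtain U where U: "finite U" "U \<subseteq> cells" "\<forall>q\<in>U. fst q \<le> m"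
      "(\<lambda>w. w \<bullet> \<phi> y) ` K \<subseteq> (\<Union>(k, Q)\<in>U. fat k Q)" "(\<Sum>q\<in>U. 2 powr (- s * real (fst q))) \<le> \<eta>"
      unfolding good_def by (elim exE conjE)
    have "(sum \<mu> X)\<^sup>2 \<le> 4 powr s * \<eta> *
      (\<Sum>x\<in>X. \<Sum>x'\<in>X. \<mu> x * \<mu> x' * (\<bar>x \<bullet> \<phi> y - x' \<bullet> \<phi> y\<bar> + 1 / 2 ^ N) powr (- s))"
    proof (rule energy_lower_bound[OF finX s(1) U(1,2) _ _ U(5)])
      show "fst q \<le> N" if "q \<in> U" for q using U(3) that by (auto simp: N_def intro: max.coboundedI1)
      have "(\<lambda>w. w \<bullet> \<phi> y) ` X \<subseteq> (\<lambda>w. w \<bullet> \<phi> y) ` K" using X(1) by (intro image_mono) auto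
      then show "(\<lambda>w. w \<bullet> \<phi> y) ` X \<subseteq> (\<Union>(k, Q)\<in>U. fat k Q)" using U(4) by (rule order_trans)
    qed
    then show ?thesis unfolding X(3) En_def by (simp add: inner_diff_right inner_commute)
  qed
  have upper: "(\<Sum>y\<in>Y. \<nu> y * En y) \<le> P * P'"
  proof -
    have "(\<Sum>y\<in>Y. \<nu> y * En y) = (\<Sum>y\<in>Y. \<Sum>x\<in>X. \<Sum>x'\<in>X.
        \<mu> x * \<mu> x' * (\<nu> y * (\<bar>\<phi> y \<bullet> (x - x')\<bar> + 1 / 2 ^ N) powr (- s)))"
      by (simp add: En_def sum_distrib_left mult_ac)
    also have "\<dots> = (\<Sum>x\<in>X. \<Sum>y\<in>Y. \<Sum>x'\<in>X.
        \<mu> x * \<mu> x' * (\<nu> y * (\<bar>\<phi> y \<bullet> (x - x')\<bar> + 1 / 2 ^ N) powr (- s)))" by (rule sum.swap)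
    also have "\<dots> = (\<Sum>x\<in>X. \<Sum>x'\<in>X. \<Sum>y\<in>Y.
        \<mu> x * \<mu> x' * (\<nu> y * (\<bar>\<phi> y \<bullet> (x - x')\<bar> + 1 / 2 ^ N) powr (- s)))"
      by (intro sum.cong refl sum.swap)
    also have "\<dots> \<le> (\<Sum>x\<in>X. \<Sum>x'\<in>X. \<mu> x * \<mu> x' * (P * (dist x x' + 1 / 2 ^ N) powr (- s)))"
    proof (intro sum_mono)
      fix x x' assume x: "x \<in> X" "x' \<in> X"
      have "(\<Sum>y\<in>Y. \<nu> y * (\<bar>\<phi> y \<bullet> (x - x')\<bar> + 1 / 2 ^ N) powr (- s))
          \<le> P * (norm (x - x') + 1 / 2 ^ N) powr (- s)"
        unfolding P_def
      proof (rule frostman_projection_potential_le[OF s(1,2) C Y(2)])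
        show "sum \<nu> Y \<le> 1" using Y(3) cn1 by simp
        then show "sum \<nu> {y \<in> Y. \<bar>\<phi> y \<bullet> e\<bar> \<le> r} \<le> C * r powr \<kappa>"
          if "norm e = 1" "1 / 2 ^ N \<le> r" "r \<le> 1" for r e
          using level[OF Y(2) _ YB that] by blast
        show "norm (x - x') \<le> 1" using kz(2)[of x x'] x X(1) by (auto simp: dist_norm)
      qed
      then show "(\<Sum>y\<in>Y. \<mu> x * \<mu> x' * (\<nu> y * (\<bar>\<phi> y \<bullet> (x - x')\<bar> + 1 / 2 ^ N) powr (- s)))
          \<le> \<mu> x * \<mu> x' * (P * (dist x x' + 1 / 2 ^ N) powr (- s))"
        using finX(2) unfolding sum_distrib_left[symmetric] dist_norm by (intro mult_left_mono) auto
    qed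
    also have "\<dots> = (\<Sum>x\<in>X. \<mu> x * P * (\<Sum>x'\<in>X. \<mu> x' * (dist x x' + 1 / 2 ^ N) powr (- s)))"
      by (simp add: sum_distrib_left mult_ac)
    also have "\<dots> \<le> (\<Sum>x\<in>X. \<mu> x * P * P')"
      unfolding P'_def using finX(2) P0 X(3) cm1
      by (intro sum_mono mult_left_mono frostman_potential_le[OF X(2) s(1,3)]) auto
    also have "\<dots> = cm * (P * P')" using X(3) by (simp add: sum_distrib_right[symmetric] mult.assoc)
    also have "\<dots> \<le> 1 * (P * P')" using cm1 P0 P'0 by (intro mult_right_mono) auto
    finally show ?thesis by simp
  qed
  have "cn * cm\<^sup>2 = (\<Sum>y\<in>Y. \<nu> y * cm\<^sup>2)" unfolding sum_distrib_right[symmetric] Y(3) by simp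
  also have "\<dots> \<le> (\<Sum>y\<in>Y. \<nu> y * (4 powr s * \<eta> * En y))"
    using finY(2) by (intro sum_mono mult_left_mono lower) auto
  also have "\<dots> = 4 powr s * \<eta> * (\<Sum>y\<in>Y. \<nu> y * En y)" by (simp add: sum_distrib_left mult_ac)
  also have "\<dots> \<le> 4 powr s * \<eta> * (P * P')" using upper \<eta> by (intro mult_left_mono) auto
  also have "\<dots> \<le> 4 powr s * \<eta> * (P * P' + 1)" using \<eta> by (intro mult_left_mono) auto
  also have "\<dots> = cn * cm\<^sup>2 / 2"
  proof -
    have "P * P' + 1 \<noteq> 0" using P0 P'0 mult_nonneg_nonneg[of P P'] by linarith
    moreover have "4 powr s * (cn * cm\<^sup>2 / (2 * 4 powr s * q)) * q = cn * cm\<^sup>2 / 2" if "q \<noteq> 0" for q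
      using that by simp
    ultimately show ?thesis unfolding \<eta>_def by blast
  qed
  finally show False using mult_pos_pos[OF cn(1) zero_less_power[OF cm(1), of 2]] by linarith
qed

section \<open>From chart parameters back to the hypersurface\<close>

lemma lipschitz_of_chart:
  assumes ch: "C2_chart M V \<phi> D D2" and B: "ball u0 R \<subseteq> V"
    and G: "\<And>u. u \<in> ball u0 R \<Longrightarrow> norm (D u) \<le> G" and uv: "u \<in> ball u0 R" "v \<in> ball u0 R"
  shows "dist (\<phi> u) (\<phi> v) \<le> G * dist u v"
proof -
  have "norm (\<phi> u - \<phi> v) \<le> G * norm (u - v)"
  proof (rule differentiable_bound[OF convex_ball _ _ uv])
    show "(\<phi> has_derivative blinfun_apply (D x)) (at x within ball u0 R)" if "x \<in> ball u0 R" for x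
      using C2_chartD(3)[OF ch subsetD[OF B that]] by (rule has_derivative_at_withinI)
    show "onorm (blinfun_apply (D x)) \<le> G" if "x \<in> ball u0 R" for x
      using G[OF that] by (simp add: norm_blinfun.rep_eq)
  qed
  then show ?thesis by (simp add: dist_norm)
qed

text \<open>The inverse of a chart is continuous on the image, so a small chart ball still covers a
  full relative neighbourhood, as localisation by open sets requires.\<close>

lemma chart_image_open:
  assumes ch: "C2_chart M V \<phi> D D2" and B: "open B" "B \<subseteq> V"
  shows "\<exists>W. open W \<and> \<phi> ` B = M \<inter> W"
proof -
  obtain W where W: "open W" "\<phi> ` V = M \<inter> W" using ch by (auto simp: C2_chart_def)
  have inj: "inj_on \<phi> V" and cont: "continuous_on (\<phi> ` V) (inv_into V \<phi>)"
    using ch by (auto simp: C2_chart_def)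
  obtain W' where W': "open W'" "W' \<inter> \<phi> ` V = inv_into V \<phi> -` B \<inter> \<phi> ` V"
    using cont B(1) unfolding continuous_on_open_invariant by blast
  have "\<phi> ` B = inv_into V \<phi> -` B \<inter> \<phi> ` V"
    using inj B(2) by (auto simp: inv_into_f_f subset_iff)
  then have "\<phi> ` B = M \<inter> (W \<inter> W')" using W' W by auto
  then show ?thesis using W W' by blast
qed

text \<open>Nullity is proved in a chart ball around each point and globalised by the Lindelof
  property. Testing with a compact subset \<open>K\<close> of \<open>Z\<close> only enlarges the
  exceptional set.\<close>

lemma exceptional_set_null:
  fixes \<Sigma> Z :: "'a::euclidean_space set"
  assumes dims: "DIM('a) \<ge> 4" "DIM('b::euclidean_space) + 2 = DIM('a)"
    and \<Sigma>: "\<Sigma> \<subseteq> sphere 0 1" "C2_submanifold TYPE('b) \<Sigma>" "sectional_curvature_gt1 TYPE('b) \<Sigma>"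
    and Z: "analytic_set Z" "hausdorff_measure t Z \<noteq> 0"
    and s: "0 < s" "s < t" "s < \<kappa>" "\<kappa> < 1"
  shows "content (real DIM('a) - 3 + \<kappa>) {z \<in> \<Sigma>. hausdorff_measure s ((\<lambda>w. w \<bullet> z) ` Z) = 0} = 0"
    (is "content _ ?E = 0")
proof -
  define \<tau> where "\<tau> = real (DIM('b) - 1) + \<kappa>"
  have \<tau>: "\<tau> = real DIM('a) - 3 + \<kappa>" using dims by (simp add: \<tau>_def of_nat_diff)
  have \<tau>0: "0 < \<tau>" using s dims(1) unfolding \<tau> by linarith
  have d: "2 \<le> DIM('b)" using dims by linarith
  have "content t Z \<noteq> 0" using Z(2) s hausdorff_null_iff_content_null[of t Z] by auto
  then obtain K where K: "compact K" "K \<subseteq> Z" "content t K \<noteq> 0"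
    using analytic_content_compact[OF Z(1)] by blast
  have locally_null: "\<exists>W. open W \<and> p \<in> W \<and> content \<tau> (?E \<inter> W) = 0" if p: "p \<in> \<Sigma>" for p
  proof -
    obtain V \<phi> D D2 u0 where ch: "C2_chart \<Sigma> V (\<phi> :: 'b \<Rightarrow> 'a) D D2" and u0: "u0 \<in> V" "p = \<phi> u0"
      using \<Sigma>(2) p unfolding C2_submanifold_def by blast
    have curv: "\<And>a b. independent {a, b} \<Longrightarrow> a \<noteq> b \<Longrightarrow> sectional_curvature D D2 u0 a b > 1"
      using \<Sigma>(3) ch u0(1) unfolding sectional_curvature_gt1_def by blast
    obtain R c G where R: "0 < R" "R \<le> 1 / 2" "ball u0 R \<subseteq> V" and c: "0 < c" "c \<le> 1"
      and G: "\<And>u. u \<in> ball u0 R \<Longrightarrow> norm (D u) \<le> G \<and> norm (D2 u) \<le> G"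
      and tri: "\<And>e. norm e = 1 \<Longrightarrow> (\<forall>u\<in>ball u0 R. c \<le> \<bar>\<phi> u \<bullet> e\<bar>) \<or>
        (\<exists>b\<in>Basis. \<forall>u\<in>ball u0 R. c \<le> \<bar>D u b \<bullet> e\<bar>) \<or>
        (\<forall>u\<in>ball u0 R. \<forall>a. c * (norm a)\<^sup>2 \<le> \<bar>D2 u a a \<bullet> e\<bar>)"
      using trichotomy_near_point[OF ch \<Sigma>(1) u0(1) d dims(2) curv] by metis
    have \<kappa>: "0 < \<kappa>" using s by simp
    obtain C where C: "C \<ge> 1" "\<And>Y \<nu> N r e. frostman (real (DIM('b) - 1) + \<kappa>) N Y \<nu> \<Longrightarrow> sum \<nu> Y \<le> 1 \<Longrightarrow>
      Y \<subseteq> ball u0 R \<Longrightarrow> norm e = 1 \<Longrightarrow> 1 / 2 ^ N \<le> r \<Longrightarrow> r \<le> 1 \<Longrightarrow>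
      sum \<nu> {y \<in> Y. \<bar>\<phi> y \<bullet> e\<bar> \<le> r} \<le> C * r powr \<kappa>"
      using frostman_chart_level_le[OF ch d R(3,2) c \<kappa> s(4) G tri] by blast
    define A where "A = {u \<in> ball u0 R. content s ((\<lambda>w. w \<bullet> \<phi> u) ` K) = 0}"
    have "content \<tau> A = 0"
      unfolding A_def \<tau>_def by (rule exceptional_parameters_null[OF s(1,3,2) C K(1,3)])
    \<comment> \<open>Dyadic cells are not adapted to maps, so the Lipschitz image is handled by
      Hausdorff measure, which has the same null sets.\<close>
    then have "hausdorff_measure \<tau> A = 0" using \<tau>0 by (rule hausdorff_null_of_content_null[rotated])
    then have "hausdorff_measure \<tau> (\<phi> ` A) = 0"
    proof (rule hausdorff_null_lipschitz_image[OF \<tau>0, of "\<bar>G\<bar> + 1", rotated])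
      fix x y assume "x \<in> A" "y \<in> A"
      then have "dist (\<phi> x) (\<phi> y) \<le> G * dist x y"
        using G by (intro lipschitz_of_chart[OF ch R(3)]) (auto simp: A_def)
      also have "\<dots> \<le> (\<bar>G\<bar> + 1) * dist x y" by (intro mult_right_mono) auto
      finally show "dist (\<phi> x) (\<phi> y) \<le> (\<bar>G\<bar> + 1) * dist x y" .
    qed simp
    then have null: "content \<tau> (\<phi> ` A) = 0" using \<tau>0 by (rule content_null_of_hausdorff_null[rotated])
    obtain W where W: "open W" "\<phi> ` ball u0 R = \<Sigma> \<inter> W"
      using chart_image_open[OF ch open_ball R(3)] by blast
    have "?E \<inter> W \<subseteq> \<phi> ` A"
    proof
      fix z assume z: "z \<in> ?E \<inter> W"
      then obtain u where u: "u \<in> ball u0 R" "z = \<phi> u" using W(2) by blast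
      have "content s ((\<lambda>w. w \<bullet> z) ` Z) = 0"
        using z s(1) hausdorff_null_iff_content_null[of s "(\<lambda>w. w \<bullet> z) ` Z"] by simp
      moreover have "content s ((\<lambda>w. w \<bullet> z) ` K) \<le> content s ((\<lambda>w. w \<bullet> z) ` Z)"
        using K(2) by (intro content_mono image_mono)
      ultimately show "z \<in> \<phi> ` A" using u by (auto simp: A_def)
    qed
    then have "content \<tau> (?E \<inter> W) = 0" using content_mono[of "?E \<inter> W" "\<phi> ` A" \<tau>] null by simp
    moreover have "p \<in> W" using W(2) u0(2) R(1) by (metis IntD2 centre_in_ball imageI)
    ultimately show ?thesis using W(1) by blast
  qed
  define \<W> where "\<W> = {W. open W \<and> content \<tau> (?E \<inter> W) = 0}"
  obtain \<V> where \<V>: "\<V> \<subseteq> \<W>" "countable \<V>" "\<Union>\<V> = \<Union>\<W>"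
    using Lindelof[of \<W>] by (auto simp: \<W>_def)
  have cover: "?E \<subseteq> (\<Union>W\<in>\<V>. ?E \<inter> W)"
  proof
    fix z assume z: "z \<in> ?E"
    then have "z \<in> \<Union>\<W>" using locally_null[of z] by (auto simp: \<W>_def)
    then show "z \<in> (\<Union>W\<in>\<V>. ?E \<inter> W)" using z \<V>(3) by blast
  qed
  have "content \<tau> (\<Union>W\<in>\<V>. ?E \<inter> W) = 0"
    using \<V>(1) by (intro content_UN_countable_null[OF \<V>(2)]) (auto simp: \<W>_def)
  then show ?thesis unfolding \<tau>[symmetric] using cover by (rule content_null_mono)
qed

subsection \<open>Hausdorff dimension\<close>

lemma hausdorff_dim_le: "0 < s \<Longrightarrow> hausdorff_measure s A = 0 \<Longrightarrow> hausdorff_dim A \<le> s"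
  unfolding hausdorff_dim_def by (rule cInf_lower) (auto intro!: bdd_belowI[of _ 0])

lemma hausdorff_null_above_dimension:
  fixes A :: "'a::euclidean_space set"
  assumes "real DIM('a) < s"
  shows "hausdorff_measure s A = 0"
proof (rule hausdorff_null_of_content_null)
  show "content s A = 0"
    using content_mono[of A UNIV s] content_UNIV_null[OF assms] by simp
qed (use assms in linarith)

lemma hausdorff_dim_set_nonempty:
  fixes A :: "'a::euclidean_space set"
  shows "{s. 0 < s \<and> hausdorff_measure s A = 0} \<noteq> {}"
  using hausdorff_null_above_dimension[of "real DIM('a) + 1" A]
  by (auto intro!: exI[of _ "real DIM('a) + 1"] add_nonneg_pos)

lemma hausdorff_dim_nonneg: "0 \<le> hausdorff_dim A" for A :: "'a::euclidean_space set"
  unfolding hausdorff_dim_def by (rule cInf_greatest[OF hausdorff_dim_set_nonempty]) auto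

text \<open>The infimum supplies a null exponent \<open>r < s\<close>; monotonicity in the exponent
  is taken from the content.\<close>

lemma hausdorff_null_of_dim_less:
  fixes A :: "'a::euclidean_space set"
  assumes "hausdorff_dim A < s"
  shows "hausdorff_measure s A = 0"
proof -
  obtain r where r: "r < s" "0 < r" "hausdorff_measure r A = 0"
    using cInf_lessD[OF hausdorff_dim_set_nonempty assms[unfolded hausdorff_dim_def]] by auto
  then have "content r A = 0" using hausdorff_null_iff_content_null by blast
  then have "content s A = 0" using content_antimono_exponent[of r s A] r(1) by simp
  then show ?thesis using r by (intro hausdorff_null_of_content_null) auto
qed

text \<open>Projections are Lipschitz, and every subset of the line is null in each exponent above
  one.\<close>

lemma hausdorff_dim_projection_le:
  fixes Z :: "'a::euclidean_space set"
  shows "hausdorff_dim ((\<lambda>w. w \<bullet> z) ` Z) \<le> min (hausdorff_dim Z) 1"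
proof (rule min.boundedI)
  show "hausdorff_dim ((\<lambda>w. w \<bullet> z) ` Z) \<le> hausdorff_dim Z"
    unfolding hausdorff_dim_def[of Z]
  proof (rule cInf_greatest[OF hausdorff_dim_set_nonempty])
    fix s assume s: "s \<in> {s. 0 < s \<and> hausdorff_measure s Z = 0}"
    have "hausdorff_measure s ((\<lambda>w. w \<bullet> z) ` Z) = 0"
    proof (rule hausdorff_null_lipschitz_image[of s "norm z + 1"])
      fix x y
      have "dist (x \<bullet> z) (y \<bullet> z) \<le> norm (x - y) * norm z"
        using Cauchy_Schwarz_ineq2[of "x - y" z] by (simp add: dist_real_def inner_diff_left)
      also have "\<dots> \<le> (norm z + 1) * dist x y" by (simp add: dist_norm algebra_simps)
      finally show "dist (x \<bullet> z) (y \<bullet> z) \<le> (norm z + 1) * dist x y" .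
    qed (use s in \<open>auto intro: add_nonneg_pos\<close>)
    then show "hausdorff_dim ((\<lambda>w. w \<bullet> z) ` Z) \<le> s" using s by (intro hausdorff_dim_le) auto
  qed
  show "hausdorff_dim ((\<lambda>w. w \<bullet> z) ` Z) \<le> 1"
    by (rule dense_ge) (auto intro!: hausdorff_dim_le hausdorff_null_above_dimension)
qed

theorem theorem1p4:
  fixes \<Sigma> Z :: "'a::euclidean_space set"
  assumes "DIM('a) \<ge> 4"
    and "DIM('b::euclidean_space) + 2 = DIM('a)"
    and "\<Sigma> \<subseteq> sphere 0 1"
    and "C2_submanifold TYPE('b) \<Sigma>"
    and "sectional_curvature_gt1 TYPE('b) \<Sigma>"
    and "analytic_set Z"
  shows "(\<forall>s::real. 0 < s \<and> s < min (hausdorff_dim Z) 1 \<longrightarrow>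
            hausdorff_dim {z \<in> \<Sigma>. hausdorff_dim ((\<lambda>w. w \<bullet> z) ` Z) < s}
              \<le> (real DIM('a) - 3) + s)
       \<and> hausdorff_measure (real DIM('a) - 2)
           {z \<in> \<Sigma>. hausdorff_dim ((\<lambda>w. w \<bullet> z) ` Z) \<noteq> min (hausdorff_dim Z) 1} = 0"
proof (intro conjI allI impI)
  let ?E = "\<lambda>s. {z \<in> \<Sigma>. hausdorff_dim ((\<lambda>w. w \<bullet> z) ` Z) < s}"
  have null: "content (real DIM('a) - 3 + \<kappa>) (?E s) = 0"
    if s: "0 < s" "s < min (hausdorff_dim Z) 1" and \<kappa>: "s < \<kappa>" "\<kappa> < 1" for s \<kappa>
  proof -
    \<comment> \<open>Bounded potentials of the measure on \<open>Z\<close> require an exponent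
      strictly above \<open>s\<close>.\<close>
    obtain t where t: "s < t" "t < hausdorff_dim Z" using dense[of s "hausdorff_dim Z"] s by auto
    have "hausdorff_measure t Z \<noteq> 0" using hausdorff_dim_le[of t Z] t s by auto
    then have "content (real DIM('a) - 3 + \<kappa>) {z \<in> \<Sigma>. hausdorff_measure s ((\<lambda>w. w \<bullet> z) ` Z) = 0} = 0"
      using assms s t \<kappa> by (intro exceptional_set_null[where t = t]) auto
    moreover have "?E s \<subseteq> {z \<in> \<Sigma>. hausdorff_measure s ((\<lambda>w. w \<bullet> z) ` Z) = 0}"
      using hausdorff_null_of_dim_less by blast
    ultimately show ?thesis by (rule content_null_mono)
  qed
  show "hausdorff_dim (?E s) \<le> (real DIM('a) - 3) + s" if s: "0 < s \<and> s < min (hausdorff_dim Z) 1" for s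
  proof -
    \<comment> \<open>Since \<open>DIM('a) = n + 1\<close>, the constant \<open>DIM('a) - 3\<close>
      is \<open>n - 2\<close>. The exponent \<open>\<kappa>\<close> is free between \<open>s\<close>
      and \<open>1\<close>, and letting it decrease to \<open>s\<close> gives the bound.\<close>
    have "hausdorff_dim (?E s) - (real DIM('a) - 3) \<le> \<kappa>" if \<kappa>: "s < \<kappa>" "\<kappa> < 1" for \<kappa>
    proof -
      have pos: "0 < real DIM('a) - 3 + \<kappa>" using assms(1) s \<kappa> by linarith
      have "content (real DIM('a) - 3 + \<kappa>) (?E s) = 0" using s \<kappa> by (intro null) auto
      then have "hausdorff_dim (?E s) \<le> real DIM('a) - 3 + \<kappa>"
        using pos by (intro hausdorff_dim_le hausdorff_null_of_content_null)
      then show ?thesis by linarith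
    qed
    then have "hausdorff_dim (?E s) - (real DIM('a) - 3) \<le> s"
      using s by (intro dense_ge_bounded[of s 1]) auto
    then show ?thesis by linarith
  qed
  \<comment> \<open>The projection never exceeds the expected dimension, so failure of equality
    leaves room for a rational \<open>s\<close>. Countably many exceptional sets suffice, each null
    in dimension \<open>n - 1 = DIM('a) - 2\<close> because \<open>\<kappa> < 1\<close>.\<close>
  define I where "I = {s \<in> \<rat>. 0 < s \<and> s < min (hausdorff_dim Z) 1}"
  have "countable I" unfolding I_def by (rule countable_subset[OF _ countable_rat]) auto
  moreover have "content (real DIM('a) - 2) (?E s) = 0" if "s \<in> I" for s
  proof -
    have s: "0 < s" "s < min (hausdorff_dim Z) 1" using that by (auto simp: I_def)
    then obtain \<kappa> where \<kappa>: "s < \<kappa>" "\<kappa> < 1" using dense[of s 1] by auto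
    have "content (real DIM('a) - 2) (?E s) \<le> content (real DIM('a) - 3 + \<kappa>) (?E s)"
      using \<kappa> by (intro content_antimono_exponent) auto
    then show ?thesis using null[OF s \<kappa>] by simp
  qed
  ultimately have "content (real DIM('a) - 2) (\<Union>s\<in>I. ?E s) = 0"
    by (rule content_UN_countable_null)
  moreover have "{z \<in> \<Sigma>. hausdorff_dim ((\<lambda>w. w \<bullet> z) ` Z) \<noteq> min (hausdorff_dim Z) 1} \<subseteq> (\<Union>s\<in>I. ?E s)"
  proof
    fix z assume z: "z \<in> {z \<in> \<Sigma>. hausdorff_dim ((\<lambda>w. w \<bullet> z) ` Z) \<noteq> min (hausdorff_dim Z) 1}"
    then have "hausdorff_dim ((\<lambda>w. w \<bullet> z) ` Z) < min (hausdorff_dim Z) 1"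
      using hausdorff_dim_projection_le[of z Z] by auto
    then obtain s where s: "s \<in> \<rat>" "hausdorff_dim ((\<lambda>w. w \<bullet> z) ` Z) < s" "s < min (hausdorff_dim Z) 1"
      using Rats_dense_in_real by blast
    then have "0 < s" using hausdorff_dim_nonneg[of "(\<lambda>w. w \<bullet> z) ` Z"] by linarith
    then show "z \<in> (\<Union>s\<in>I. ?E s)" using s z by (auto simp: I_def)
  qed
  ultimately have "content (real DIM('a) - 2)
      {z \<in> \<Sigma>. hausdorff_dim ((\<lambda>w. w \<bullet> z) ` Z) \<noteq> min (hausdorff_dim Z) 1} = 0"
    by (rule content_null_mono)
  then show "hausdorff_measure (real DIM('a) - 2)
      {z \<in> \<Sigma>. hausdorff_dim ((\<lambda>w. w \<bullet> z) ` Z) \<noteq> min (hausdorff_dim Z) 1} = 0"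
    using assms(1) by (intro hausdorff_null_of_content_null) auto
qed

end
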